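(* Let $H_i$ ($i\in\mathbb{N}$) and $H$ be functions $[0,T]\times\mathbb{R}^n\times\mathbb{R}^n\to\mathbb{R}$ satisfying (H1)–(H4) and (HLC) with the same integrable functions $c(\cdot)$ and $k_R(\cdot)$ ($R>0$). Let $g_i$, $g:\mathbb{R}^n\to\mathbb{R}$ be continuous with $g_i\to g$ uniformly on compact sets. Assume $\max\{|H_i(t,0,0)|,|H(t,0,0)|\}\le\mu(t)$ for all $t\in[0,T]$, $i\in\mathbb{N}$, for some integrable $\mu$. Let $(\mathbb{R}^{n+1},f_i,l_i)$ and $(\mathbb{R}^{n+1},f,l)$ be the Steiner representations of $H_i$ and $H$, and let $$V_i(t_0,x_0)=\inf_{(x,a)\in S_{f_i}(t_0,x_0)}\Big\{g_i(x(T))+\int_{t_0}^T l_i(t,x,a)\,dt\Big\},\quad V(t_0,x_0)=\inf_{(x,a)\in S_{f}(t_0,x_0)}\Big\{g(x(T))+\int_{t_0}^T l(t,x,a)\,dt\Big\}.$$ If $H_i(t,\cdot,\cdot)\to H(t,\cdot,\cdot)$ uniformly on compact sets for every $t\in[0,T]$, then $V_i\to V$ uniformly on compact subsets of $[0,T]\times\mathbb{R}^n$.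
   Context: Hypotheses: (H1) $H(\cdot,x,p)$ Lebesgue measurable; (H2) $H(t,\cdot,\cdot)$ continuous; (H3) $H(t,x,\cdot)$ convex; (H4) there is measurable $c\ge0$ with $|H(t,x,p)-H(t,x,q)|\le c(t)(1+|x|)|p-q|$; (HLC) for each $R>0$ there is measurable $k_R\ge0$ with $|H(t,x,p)-H(t,y,p)|\le k_R(t)(1+|p|)|x-y|$ for $x,y\in\bar B_R$, all $p$. $H^*(t,x,v)=\sup_p\{\langle v,p\rangle-H(t,x,p)\}$. $S_f(t_0,x_0)$: pairs $x(\cdot)$ absolutely continuous on $[t_0,T]$, $a(\cdot)\in L^1([t_0,T],\mathbb{R}^{n+1})$, $\dot x=f(t,x,a)$ a.e., $x(t_0)=x_0$. Steiner representation of a Hamiltonian $H$: $E(t,x)=\mathrm{epi}\,H^*(t,x,\cdot)\subset\mathbb{R}^{n+1}$; $\Phi(t,x,a)=E(t,x)\cap\bar B(a,2d(a,E(t,x)))$; Steiner point $s_m(K)=m\int_{S^{m-1}}p\max_{y\in K}\langle p,y\rangle\,\mu(dp)$ ($\mu$ normalized rotation-invariant measure on the unit sphere); $(f,l)(t,x,a)=s_{n+1}(\Phi(t,x,a))$ with $f\in\mathbb{R}^n$, $l\in\mathbb{R}$. *)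

theory Defs
  imports "HOL-Analysis.Analysis"
begin

definition abs_cont_on :: "real set \<Rightarrow> (real \<Rightarrow> 'a::real_normed_vector) \<Rightarrow> bool" where
  "abs_cont_on S x \<longleftrightarrow>
     (\<forall>e>0. \<exists>d>0. \<forall>(N::nat) (u::nat \<Rightarrow> real) (v::nat \<Rightarrow> real).
        (\<forall>k<N. u k \<le> v k \<and> {u k..v k} \<subseteq> S) \<and>
        (\<forall>k<N. \<forall>j<N. k \<noteq> j \<longrightarrow> v k \<le> u j \<or> v j \<le> u k) \<and>
        (\<Sum>k<N. v k - u k) < d
        \<longrightarrow> (\<Sum>k<N. norm (x (v k) - x (u k))) < e)"

type_synonym 'n hamiltonian = "real \<Rightarrow> real^'n \<Rightarrow> real^'n \<Rightarrow> real"

definition hamiltonian_hyps ::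
  "real \<Rightarrow> (real \<Rightarrow> real) \<Rightarrow> (real \<Rightarrow> real \<Rightarrow> real) \<Rightarrow> 'n::finite hamiltonian \<Rightarrow> bool" where
  "hamiltonian_hyps T c k H \<longleftrightarrow>
     (\<forall>x p. (\<lambda>t. H t x p) \<in> borel_measurable (lebesgue_on {0..T})) \<and>
     (\<forall>t\<in>{0..T}. continuous_on UNIV (\<lambda>(x,p). H t x p)) \<and>
     (\<forall>t\<in>{0..T}. \<forall>x. convex_on UNIV (H t x)) \<and>
     (\<forall>t\<in>{0..T}. \<forall>x p q. \<bar>H t x p - H t x q\<bar> \<le> c t * (1 + norm x) * norm (p - q)) \<and>
     (\<forall>R>0. \<forall>t\<in>{0..T}. \<forall>x\<in>cball 0 R. \<forall>y\<in>cball 0 R. \<forall>p.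
        \<bar>H t x p - H t y p\<bar> \<le> k R t * (1 + norm p) * norm (x - y))"

definition epi_conj :: "'n::finite hamiltonian \<Rightarrow> real \<Rightarrow> real^'n \<Rightarrow> ((real^'n) \<times> real) set" where
  "epi_conj H t x = {(v, r). \<forall>p. v \<bullet> p - H t x p \<le> r}"

text \<open>Normalized rotation-invariant measure on the unit sphere, realised as the image of the
  normalized Lebesgue measure on the unit ball under radial projection \<open>y \<mapsto> y / |y|\<close>.
  Hence \<open>\<integral>_{S} \<phi> d\<mu> = (1/vol B) \<integral>_B \<phi>(y/|y|) dy\<close>.\<close>
definition sphere_measure :: "'a::euclidean_space measure" where
  "sphere_measure = distr (uniform_measure lborel (ball 0 1)) borel (\<lambda>y. y /\<^sub>R norm y)"

definition steiner_point :: "'a::euclidean_space set \<Rightarrow> 'a" where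
  "steiner_point K = real DIM('a) *\<^sub>R
     (\<integral>p. (Sup ((\<lambda>y. p \<bullet> y) ` K)) *\<^sub>R p \<partial>sphere_measure)"

definition steiner_Phi :: "'n::finite hamiltonian \<Rightarrow> real \<Rightarrow> real^'n \<Rightarrow> (real^'n) \<times> real
    \<Rightarrow> ((real^'n) \<times> real) set" where
  "steiner_Phi H t x a = epi_conj H t x \<inter> cball a (2 * infdist a (epi_conj H t x))"

definition steiner_f :: "'n::finite hamiltonian \<Rightarrow> real \<Rightarrow> real^'n \<Rightarrow> (real^'n) \<times> real \<Rightarrow> real^'n" where
  "steiner_f H t x a = fst (steiner_point (steiner_Phi H t x a))"

definition steiner_l :: "'n::finite hamiltonian \<Rightarrow> real \<Rightarrow> real^'n \<Rightarrow> (real^'n) \<times> real \<Rightarrow> real" where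
  "steiner_l H t x a = snd (steiner_point (steiner_Phi H t x a))"

definition trajectories ::
  "real \<Rightarrow> (real \<Rightarrow> real^'n \<Rightarrow> (real^'n) \<times> real \<Rightarrow> real^'n::finite) \<Rightarrow> real \<Rightarrow> real^'n
   \<Rightarrow> ((real \<Rightarrow> real^'n) \<times> (real \<Rightarrow> (real^'n) \<times> real)) set" where
  "trajectories T f t0 x0 = {(x, a).
     abs_cont_on {t0..T} x \<and>
     set_integrable lebesgue {t0..T} a \<and>
     (AE t in lebesgue. t \<in> {t0..T} \<longrightarrow>
        (x has_vector_derivative f t (x t) (a t)) (at t within {t0..T})) \<and>
     x t0 = x0}"

text \<open>Extended-valued Lebesgue integral of the running cost (\<open>+\<infinity>\<close> when not integrable;
  the running cost is bounded below by an integrable function along trajectories).\<close>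
definition cost_integral :: "real \<Rightarrow> real \<Rightarrow> (real \<Rightarrow> real) \<Rightarrow> ereal" where
  "cost_integral t0 T h =
     (if set_integrable lebesgue {t0..T} h then ereal (set_lebesgue_integral lebesgue {t0..T} h)
      else \<infinity>)"

definition value_fun ::
  "real \<Rightarrow> (real^'n \<Rightarrow> real) \<Rightarrow> 'n::finite hamiltonian \<Rightarrow> real \<Rightarrow> real^'n \<Rightarrow> ereal" where
  "value_fun T g H t0 x0 =
     (INF xa \<in> trajectories T (steiner_f H) t0 x0.
        ereal (g (fst xa T)) + cost_integral t0 T (\<lambda>t. steiner_l H t (fst xa t) (snd xa t)))"

end

theory Submission
  imports Defs
begin

text \<open>
  The Steiner selection always lies in the epigraph \<open>E(t,x)\<close> of the Lagrangian and fixes every point of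
  it. Hence the value function is the infimum of \<open>g(x(T)) + \<integral> r\<close> over all pairs of an absolutely
  continuous \<open>x\<close> and an integrable \<open>r\<close> with \<open>(x', r) \<in> E(t,x)\<close>, and neither Lipschitz continuity of
  \<open>f\<close>, \<open>l\<close> nor compactness of trajectories is needed. Given such a pair for one Hamiltonian, its distance
  to the epigraph of another one is controlled by the discrepancy of the Hamiltonians on a compact set plus
  \<open>(|r| + \<beta>(t)) / N\<close> with \<open>\<beta>\<close> integrable. Filippov's iteration with metric projections
  then produces a nearby pair for the other Hamiltonian with the same initial point. Applied in both
  directions this compares the value functions uniformly in the initial point.
\<close>

section \<open>Steiner points\<close>

text \<open>The obstacle is that convergence in \<open>p\<close> holds only on compact sets while
  the epigraphs are unbounded: a point \<open>(v, r)\<close> of one epigraph with large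
  \<open>r\<close> can be far from the other epigraph although the Hamiltonians nearly agree on a
  large ball. Convexity confines this effect to the term with the factor \<open>1 / N\<close>, which
  is small only if the cost rate \<open>r\<close> is bounded in L^1 uniformly in the index.
  Evaluating the conjugate at \<open>p = 0\<close> bounds \<open>r\<close> from below by an
  integrable function, so an upper bound on the total cost already bounds the L^1 norm; this is why
  competitors are handled only below a fixed cost level. The order of choices follows: the radius of
  the state ball and the cost level depend on the compact set and on the shared data
  \<open>c\<close>, \<open>k\<close>, \<open>\<mu>\<close> and the terminal costs; then
  \<open>N\<close> is taken large; only then does the index go to infinity. The shared data also
  make the Filippov amplification the same for all Hamiltonians, so both comparisons use the same
  constants.\<close>

lemma integral_ball_homogeneous:
  fixes \<phi> :: "'a::euclidean_space \<Rightarrow> real"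
  assumes m[measurable]: "\<phi> \<in> borel_measurable borel"
    and hom: "\<And>s y. s > 0 \<Longrightarrow> \<phi> (s *\<^sub>R y) = \<phi> y" and r: "r > 0"
  shows "(LINT y|lborel. indicator (ball 0 r) y * \<phi> y)
       = r ^ DIM('a) * (LINT y|lborel. indicator (ball 0 1) y * \<phi> y)"
proof -
  have "(LINT y|lborel. indicator (ball 0 r) y * \<phi> y)
     = (LINT y|density (distr lborel borel (\<lambda>x. 0 + r *\<^sub>R x)) (\<lambda>_. ennreal (\<bar>r\<bar> ^ DIM('a))).
          indicator (ball 0 r) y * \<phi> y)"
    using lborel_affine[of r "0::'a"] r by simp
  also have "\<dots> = (LINT y|lborel. r ^ DIM('a) * (indicator (ball 0 r) (r *\<^sub>R y) * \<phi> (r *\<^sub>R y)))"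
  proof -
    have [measurable]: "(\<lambda>y. indicator (ball 0 r) y * \<phi> y :: real) \<in> borel_measurable borel"
      by (intro borel_measurable_times m borel_measurable_indicator) auto
    show ?thesis
      using r by (subst integral_density) (auto simp: integral_distr)
  qed
  also have "\<dots> = (LINT y|lborel. r ^ DIM('a) * (indicator (ball 0 1) y * \<phi> y))"
    using r by (intro Bochner_Integration.integral_cong)
      (auto simp: indicator_def hom mult_less_cancel_left2)
  finally show ?thesis by simp
qed

text \<open>Radial part of the next computation: the ball \<open>y \<bullet> y < s\<close> has
  radius \<open>sqrt s\<close>, and integrating its \<open>m\<close>-th power over \<open>s\<close>
  produces the constant \<open>2 / (m + 2)\<close>.\<close>

lemma sqrt_power_integral:
  "(LINT s|lborel. indicator {0<..<1} s * sqrt s ^ m) = 2 / (real m + 2)"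
proof -
  have "((\<lambda>x::real. x powr (m/2)) has_integral (1 powr (m/2 + 1) / (m/2+1))) {0..1}"
    by (rule has_integral_powr_from_0) auto
  then have "((\<lambda>x::real. x powr (m/2)) has_integral (2 / (real m + 2))) {0..1}"
    by (simp add: field_simps)
  then have "((\<lambda>x::real. x powr (m/2)) has_integral (2 / (real m + 2))) {0<..<1}"
    using has_integral_open_interval[of "\<lambda>x::real. x powr (m/2)" _ "0::real" 1] by simp
  moreover have "sqrt s ^ m = s powr (m/2)" if "s \<in> {0<..<1}" for s
  proof -
    have "s powr (m/2) = (s powr (1/2)) powr real m" by (simp add: powr_powr)
    also have "\<dots> = sqrt s ^ m" using that by (simp add: powr_half_sqrt powr_realpow)
    finally show ?thesis by simp
  qed
  ultimately have h: "((\<lambda>s. sqrt s ^ m) has_integral (2 / (real m + 2))) {0<..<1}"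
    by (subst has_integral_cong) auto
  have "(LINT s:{0<..<1::real}|lborel. sqrt s ^ m) = integral {0<..<1} (\<lambda>s. sqrt s ^ m)"
  proof (rule set_borel_integral_eq_integral(2))
    show "set_integrable lborel {0<..<1::real} (\<lambda>s. sqrt s ^ m)"
      unfolding set_integrable_def
      by (rule integrableI_bounded_set[where A="{0<..<1}" and B=1])
        (auto simp: power_le_one indicator_def)
  qed
  then show ?thesis using h by (simp add: set_lebesgue_integral_def integral_unique)
qed

text \<open>Layer cake in place of polar coordinates: \<open>1 - y \<bullet> y\<close> is the length
  of \<open>{y \<bullet> y<..<1}\<close>. After Fubini the inner integral runs over the ball of
  radius \<open>sqrt s\<close>, where homogeneity of degree zero extracts the factor
  \<open>sqrt s ^ DIM('a)\<close>.\<close>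

lemma integral_ball_parabola_homogeneous:
  fixes \<phi> :: "'a::euclidean_space \<Rightarrow> real"
  assumes m[measurable]: "\<phi> \<in> borel_measurable borel"
    and hom: "\<And>s y. s > 0 \<Longrightarrow> \<phi> (s *\<^sub>R y) = \<phi> y" and bd: "\<And>y. \<bar>\<phi> y\<bar> \<le> B"
  shows "(LINT y|lborel. indicator (ball 0 1) y * ((1 - y \<bullet> y) * \<phi> y))
       = 2 / (DIM('a) + 2) * (LINT y|lborel. indicator (ball 0 1) y * \<phi> y)"
proof -
  let ?F = "\<lambda>(y::'a) (s::real). indicator (ball 0 1) y * \<phi> y * indicator {y \<bullet> y<..<1} s :: real"
  interpret P: pair_sigma_finite "lborel :: 'a measure" "lborel :: real measure" ..
  have Fm[measurable]: "(\<lambda>(y,s). ?F y s) \<in> borel_measurable (lborel \<Otimes>\<^sub>M lborel)"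
  proof -
    have [measurable]: "Measurable.pred (borel \<Otimes>\<^sub>M borel) (\<lambda>x::'a \<times> real. fst x \<in> ball 0 1)"
      by (rule measurable_compose[OF measurable_fst]) auto
    have [measurable]: "Measurable.pred (borel \<Otimes>\<^sub>M borel) (\<lambda>x::'a \<times> real. fst x \<bullet> fst x < snd x)"
      by measurable
    have [measurable]: "(\<lambda>x. \<phi> (fst x)) \<in> borel_measurable (borel \<Otimes>\<^sub>M (borel :: real measure))"
      by (rule measurable_compose[OF measurable_fst m])
    have "(\<lambda>(y,s). ?F y s) \<in> borel_measurable (borel \<Otimes>\<^sub>M borel)"
      unfolding indicator_def greaterThanLessThan_iff case_prod_beta by measurable
    moreover have "sets (lborel \<Otimes>\<^sub>M lborel) = sets (borel \<Otimes>\<^sub>M borel :: ('a \<times> real) measure)"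
      by (intro sets_pair_measure_cong) auto
    ultimately show ?thesis by (simp only: measurable_cong_sets[of "lborel \<Otimes>\<^sub>M lborel" "borel \<Otimes>\<^sub>M borel"])
  qed
  have fin: "emeasure (lborel \<Otimes>\<^sub>M lborel) (ball (0::'a) 1 \<times> {0..1::real}) < \<infinity>"
    by (simp add: lborel.emeasure_pair_measure_Times ennreal_mult_less_top emeasure_bounded_finite[unfolded infinity_ennreal_def])
  have int: "integrable (lborel \<Otimes>\<^sub>M lborel) (\<lambda>(y,s). ?F y s)"
  proof (rule integrableI_bounded_set[where A="ball (0::'a) 1 \<times> {0..1::real}" and B=B])
    show "AE x in lborel \<Otimes>\<^sub>M lborel. x \<in> ball (0::'a) 1 \<times> {0..1::real} \<longrightarrow>
            norm (case x of (y,s) \<Rightarrow> ?F y s) \<le> B"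
      using bd order_trans[OF abs_ge_zero bd] by (auto simp: indicator_def)
    show "AE x in lborel \<Otimes>\<^sub>M lborel. x \<notin> ball (0::'a) 1 \<times> {0..1::real} \<longrightarrow>
            (case x of (y,s) \<Rightarrow> ?F y s) = 0"
      by (intro always_eventually) (auto simp: indicator_def dest: order.strict_trans1[OF inner_ge_zero])
  qed (use fin in auto)
  have 1: "(LINT y|lborel. indicator (ball 0 1) y * ((1 - y \<bullet> y) * \<phi> y)) = (LINT y|lborel. LINT s|lborel. ?F y s)"
  proof (rule Bochner_Integration.integral_cong[OF refl])
    fix y :: 'a
    have "y \<bullet> y \<le> 1" if "norm y < 1"
      using that by (metis abs_norm_cancel abs_square_le_1 dot_square_norm less_eq_real_def)
    then show "indicator (ball 0 1) y * ((1 - y \<bullet> y) * \<phi> y) = (LINT s|lborel. ?F y s)"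
      by (cases "norm y < 1") auto
  qed
  have 2: "(LINT y|lborel. ?F y s) = indicator {0<..<1} s * sqrt s ^ DIM('a) * (LINT y|lborel. indicator (ball 0 1) y * \<phi> y)" for s
  proof (cases "0 < s \<and> s < 1")
    case True
    have "norm y < sqrt s \<longleftrightarrow> y \<bullet> y < s" for y :: 'a
      by (metis norm_eq_sqrt_inner real_sqrt_less_iff)
    moreover have "norm y < 1" if "y \<bullet> y < s" for y :: 'a
      using that True by (metis norm_eq_sqrt_inner less_trans real_sqrt_lt_1_iff)
    ultimately have "(LINT y|lborel. ?F y s) = (LINT y|lborel. indicator (ball 0 (sqrt s)) y * \<phi> y)"
      using True by (intro Bochner_Integration.integral_cong) (auto simp: indicator_def)
    also have "\<dots> = sqrt s ^ DIM('a) * (LINT y|lborel. indicator (ball 0 1) y * \<phi> y)"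
      using True by (intro integral_ball_homogeneous m hom) auto
    finally show ?thesis using True by simp
  next
    case False
    then have F: "?F y s = 0" for y using inner_ge_zero[of y] by (auto simp: indicator_def simp del: inner_ge_zero)
    have "(LINT y|lborel. ?F y s) = 0" by (simp only: F) simp
    then show ?thesis using False by (simp add: indicator_def)
  qed
  have "(LINT y|lborel. LINT s|lborel. ?F y s) = (LINT s|lborel. LINT y|lborel. ?F y s)"
    using lborel_pair.Fubini_integral[OF int] by simp
  also have "\<dots> = (LINT s|lborel. indicator {0<..<1} s * sqrt s ^ DIM('a)) * (LINT y|lborel. indicator (ball 0 1) y * \<phi> y)"
    unfolding 2 by simp
  finally show ?thesis unfolding 1 sqrt_power_integral by simp
qed

text \<open>The gradient \<open>-2 y\<close> of the weight has norm at most 2 on the unit ball. The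
  bound gives the majorant for the difference quotients in the dominated convergence argument
  below.\<close>

lemma parabola_lipschitz:
  fixes y z :: "'a::real_inner"
  shows "\<bar>max 0 (1 - y \<bullet> y) - max 0 (1 - z \<bullet> z)\<bar> \<le> 2 * norm (y - z)"
proof -
  have *: "max 0 (1 - y \<bullet> y) - max 0 (1 - z \<bullet> z) \<le> 2 * norm (y - z)" for y z :: 'a
  proof (cases "norm y < 1")
    case True
    have tri: "norm z \<le> norm y + norm (y - z)"
      using norm_triangle_sub[of z y] by (simp add: norm_minus_commute)
    show ?thesis
    proof (cases "norm z \<le> 1")
      case z: True
      have "(norm z - norm y) * (norm z + norm y) \<le> norm (y - z) * 2"
      proof (cases "norm z \<le> norm y")
        case True
        then have "(norm z - norm y) * (norm z + norm y) \<le> 0" by (simp add: mult_nonpos_nonneg)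
        then show ?thesis by (smt (verit) norm_ge_zero)
      next
        case False
        then show ?thesis using tri True z by (intro mult_mono) auto
      qed
      moreover have "y \<bullet> y \<le> 1" "z \<bullet> z \<le> 1"
        using True z by (auto simp: dot_square_norm power_le_one)
      ultimately show ?thesis by (simp add: dot_square_norm power2_eq_square algebra_simps)
    next
      case False
      have "(1 - norm y) * (1 + norm y) \<le> norm (y - z) * 2"
        using tri True False by (intro mult_mono) auto
      moreover have "y \<bullet> y \<le> 1" "z \<bullet> z \<ge> 1"
        using True False by (auto simp: dot_square_norm power_le_one)
      ultimately show ?thesis by (simp add: dot_square_norm power2_eq_square algebra_simps)
    qed
  next
    case False
    then have "y \<bullet> y \<ge> 1" by (auto simp: dot_square_norm)
    then show ?thesis by (smt (verit) norm_ge_zero)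
  qed
  show ?thesis using *[of y z] *[of z y] by (simp add: norm_minus_commute abs_le_iff)
qed

text \<open>Subadditivity gives \<open>h (y + \<epsilon>u) - h y \<le> \<epsilon> h u\<close>. Integrating against the weight
  \<open>w y = max 0 (1 - |y|\<^sup>2)\<close> and shifting the translation onto \<open>w\<close> yields, as \<open>\<epsilon> \<rightarrow> 0\<close>, an
  inequality between \<open>h\<close> and \<open>-\<nabla>w\<close>; this replaces the divergence theorem in the usual proof that the
  Steiner point lies in the convex set.\<close>

lemma parabola_weight_sublinear:
  fixes h :: "'a::euclidean_space \<Rightarrow> real" and u :: 'a
  assumes sub: "\<And>x y. h (x + y) \<le> h x + h y" and hom: "\<And>c x. c \<ge> 0 \<Longrightarrow> h (c *\<^sub>R x) = c * h x"
    and bd: "\<And>x. \<bar>h x\<bar> \<le> B * norm x" and cont: "continuous_on UNIV h"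
  shows "2 * (LINT y|lborel. indicator (ball 0 1) y * (h y * (u \<bullet> y)))
         \<le> h u * (LINT y|lborel. indicator (ball (0::'a) 1) y * (1 - y \<bullet> y))"
proof -
  define w :: "'a \<Rightarrow> real" where "w y = max 0 (1 - y \<bullet> y)" for y
  have [measurable]: "h \<in> borel_measurable borel" by (rule borel_measurable_continuous_onI[OF cont])
  have [measurable]: "w \<in> borel_measurable borel" unfolding w_def by measurable
  have B: "B \<ge> 0" using bd[of "SOME i. i \<in> Basis"] norm_some_Basis[where 'a='a] by simp
  have w0: "w y = 0" if "norm y \<ge> 1" for y
    using that by (auto simp: w_def dot_square_norm)
  have w1: "0 \<le> w y" "w y \<le> 1" for y by (auto simp: w_def)
  have nb: "emeasure lborel (cball (0::'a) r) < \<infinity>" for r by (rule emeasure_bounded_finite) auto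
  have wint: "integrable lborel w"
    by (rule integrableI_bounded_set[where A="cball 0 1" and B=1]) (use nb w0 w1 in \<open>auto simp: not_le\<close>)
  define e :: "nat \<Rightarrow> real" where "e n = 1 / (real n + 1)" for n
  have e: "e n > 0" "e n \<le> 1" for n by (auto simp: e_def)
  have e0: "e \<longlonglongrightarrow> 0" unfolding e_def by real_asymp
  \<comment> \<open>Since \<open>e n \<le> 1\<close>, every translated weight vanishes outside the
    ball of this radius, so one integrable majorant serves for all \<open>n\<close>.\<close>
  define r where "r = 1 + norm u"
  define g where "g n y = h y * ((w (y - e n *\<^sub>R u) - w y) / e n)" for n y
  have wr: "w (y - e n *\<^sub>R u) = 0" if "norm y > r" for y n
  proof (rule w0)
    have "norm (e n *\<^sub>R u) \<le> norm u" using e[of n] by (simp add: mult_left_le_one_le)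
    then show "1 \<le> norm (y - e n *\<^sub>R u)"
      using norm_triangle_ineq2[of y "e n *\<^sub>R u"] that unfolding r_def by linarith
  qed
  have hb: "\<bar>h y\<bar> \<le> B * s" if "norm y \<le> s" for y s
    using bd[of y] mult_left_mono[OF that B] by linarith
  have i1: "integrable lborel (\<lambda>y. h y * w (y - e n *\<^sub>R u))" for n
  proof (rule integrableI_bounded_set[where A="cball 0 r" and B="B*r"])
    show "AE x in lborel. x \<in> cball 0 r \<longrightarrow> norm (h x * w (x - e n *\<^sub>R u)) \<le> B * r"
    proof (intro always_eventually allI impI)
      fix x :: 'a assume "x \<in> cball 0 r"
      then have "\<bar>h x\<bar> * \<bar>w (x - e n *\<^sub>R u)\<bar> \<le> (B * r) * 1"
        using w1 hb by (intro mult_mono) (auto simp: B r_def)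
      then show "norm (h x * w (x - e n *\<^sub>R u)) \<le> B * r" by (simp add: abs_mult)
    qed
  qed (use nb wr in auto)
  have i2: "integrable lborel (\<lambda>y. h y * w y)"
  proof (rule integrableI_bounded_set[where A="cball 0 1" and B="B*1"])
    show "AE x in lborel. x \<in> cball 0 1 \<longrightarrow> norm (h x * w x) \<le> B * 1"
    proof (intro always_eventually allI impI)
      fix x :: 'a assume "x \<in> cball 0 1"
      then have "\<bar>h x\<bar> \<le> B * 1" by (intro hb) auto
      then have "\<bar>h x\<bar> * \<bar>w x\<bar> \<le> (B * 1) * 1"
        using w1 by (intro mult_mono) (auto simp: B)
      then show "norm (h x * w x) \<le> B * 1" by (simp add: abs_mult)
    qed
  qed (use nb w0 in auto)
  have sh: "(LINT y|lborel. h y * w (y - e n *\<^sub>R u)) = (LINT y|lborel. h (y + e n *\<^sub>R u) * w y)"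
    and i3: "integrable lborel (\<lambda>y. h (y + e n *\<^sub>R u) * w y)" for n
  proof -
    have D: "lborel = distr lborel borel (\<lambda>x. e n *\<^sub>R u + x)" by (rule lborel_distr_plus[symmetric])
    have "(LINT y|lborel. h y * w (y - e n *\<^sub>R u)) = (LINT y|distr lborel borel (\<lambda>x. e n *\<^sub>R u + x). h y * w (y - e n *\<^sub>R u))"
      using D by simp
    also have "\<dots> = (LINT y|lborel. h (y + e n *\<^sub>R u) * w y)"
      by (subst integral_distr) (auto simp: add.commute)
    finally show "(LINT y|lborel. h y * w (y - e n *\<^sub>R u)) = (LINT y|lborel. h (y + e n *\<^sub>R u) * w y)" .
    have "integrable (distr lborel borel (\<lambda>x. e n *\<^sub>R u + x)) (\<lambda>y. h y * w (y - e n *\<^sub>R u))"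
      using i1[of n] D by simp
    then show "integrable lborel (\<lambda>y. h (y + e n *\<^sub>R u) * w y)"
      by (subst (asm) integrable_distr_eq) (auto simp: add.commute)
  qed
  have le: "(LINT y|lborel. g n y) \<le> h u * (LINT y|lborel. w y)" for n
  proof -
    have "(LINT y|lborel. g n y) = (LINT y|lborel. (h y * w (y - e n *\<^sub>R u) - h y * w y) / e n)"
      unfolding g_def by (simp add: algebra_simps)
    also have "\<dots> = ((LINT y|lborel. h (y + e n *\<^sub>R u) * w y) - (LINT y|lborel. h y * w y)) / e n"
      using i1[of n] i2 by (simp add: sh)
    also have "(LINT y|lborel. h (y + e n *\<^sub>R u) * w y) - (LINT y|lborel. h y * w y)
       = (LINT y|lborel. h (y + e n *\<^sub>R u) * w y - h y * w y)"
      using i3[of n] i2 by simp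
    also have "\<dots> \<le> (LINT y|lborel. e n * h u * w y)"
    proof (rule integral_mono)
      fix y
      have "h (y + e n *\<^sub>R u) \<le> h y + e n * h u" using sub[of y "e n *\<^sub>R u"] hom[of "e n" u] e[of n] by simp
      then show "h (y + e n *\<^sub>R u) * w y - h y * w y \<le> e n * h u * w y"
        using mult_right_mono[OF _ w1(1)] by (fastforce simp: algebra_simps)
    qed (use i3[of n] i2 wint in auto)
    finally show ?thesis using e[of n] by (simp add: divide_right_mono field_simps)
  qed
  have lim: "(\<lambda>n. LINT y|lborel. g n y) \<longlonglongrightarrow> (LINT y|lborel. indicator (ball 0 1) y * (h y * (2 * (u \<bullet> y))))"
  proof (rule integral_dominated_convergence[where w="\<lambda>y. indicator (cball 0 r) y * (B * r * (2 * norm u))"])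
    show "integrable lborel (\<lambda>y. indicator (cball (0::'a) r) y * (B * r * (2 * norm u)))"
      by (intro integrable_mult_left integrable_real_indicator nb) auto
    show "AE y in lborel. (\<lambda>n. g n y) \<longlonglongrightarrow> indicator (ball 0 1) y * (h y * (2 * (u \<bullet> y)))"
    proof -
      \<comment> \<open>The weight has a kink on the unit sphere, where the quotients may have a
        different limit; this set is null.\<close>
      have "sphere (0::'a) 1 \<in> null_sets lborel"
        using negligible_sphere[of "0::'a" 1] by (simp add: negligible_iff_null_sets null_sets_completion_iff)
      then have "AE y in lborel. y \<notin> sphere (0::'a) 1" by (rule AE_not_in)
      then show ?thesis
      proof (eventually_elim)
        fix y :: 'a assume "y \<notin> sphere 0 1"
        then consider "norm y < 1" | "norm y > 1" by fastforce
        then show "(\<lambda>n. g n y) \<longlonglongrightarrow> indicator (ball 0 1) y * (h y * (2 * (u \<bullet> y)))"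
        proof cases
          case 1
          have t: "(\<lambda>n. norm (y - e n *\<^sub>R u)) \<longlonglongrightarrow> norm (y - 0 *\<^sub>R u)"
            by (intro tendsto_intros e0)
          have "eventually (\<lambda>n. norm (y - e n *\<^sub>R u) < 1) sequentially"
            using order_tendstoD(2)[OF t, of 1] 1 by simp
          then have ev: "eventually (\<lambda>n. h y * (2 * (u \<bullet> y) - e n * (u \<bullet> u)) = g n y) sequentially"
          proof eventually_elim
            case (elim n)
            have "(y - e n *\<^sub>R u) \<bullet> (y - e n *\<^sub>R u) \<le> 1" "y \<bullet> y \<le> 1"
              using elim 1 by (auto simp: dot_square_norm power_le_one)
            then have "w (y - e n *\<^sub>R u) - w y = 2 * e n * (u \<bullet> y) - e n * e n * (u \<bullet> u)"
              by (simp add: w_def inner_diff inner_commute algebra_simps)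
            also have "\<dots> = e n * (2 * (u \<bullet> y) - e n * (u \<bullet> u))" by (simp add: algebra_simps)
            finally show ?case using e[of n] by (simp add: g_def)
          qed
          have "(\<lambda>n. h y * (2 * (u \<bullet> y) - e n * (u \<bullet> u))) \<longlonglongrightarrow> h y * (2 * (u \<bullet> y) - 0 * (u \<bullet> u))"
            by (intro tendsto_intros e0)
          from Lim_transform_eventually[OF this ev] show ?thesis using 1 by simp
        next
          case 2
          have t: "(\<lambda>n. norm (y - e n *\<^sub>R u)) \<longlonglongrightarrow> norm (y - 0 *\<^sub>R u)"
            by (intro tendsto_intros e0)
          have "eventually (\<lambda>n. norm (y - e n *\<^sub>R u) > 1) sequentially"
            using order_tendstoD(1)[OF t, of 1] 2 by simp
          then have ev: "eventually (\<lambda>n. 0 = g n y) sequentially"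
            by eventually_elim (use 2 in \<open>simp add: g_def w0\<close>)
          have "(\<lambda>n. g n y) \<longlonglongrightarrow> 0"
            by (rule Lim_transform_eventually[OF tendsto_const ev])
          then show ?thesis using 2 by simp
        qed
      qed
    qed
    show "AE y in lborel. norm (g n y) \<le> indicator (cball 0 r) y * (B * r * (2 * norm u))" for n
    proof (intro always_eventually allI)
      fix y :: 'a
      show "norm (g n y) \<le> indicator (cball 0 r) y * (B * r * (2 * norm u))"
      proof (cases "norm y \<le> r")
        case True
        have "\<bar>w (y - e n *\<^sub>R u) - w y\<bar> \<le> 2 * norm (e n *\<^sub>R u)"
          using parabola_lipschitz[of "y - e n *\<^sub>R u" y] by (simp add: w_def)
        then have "\<bar>(w (y - e n *\<^sub>R u) - w y) / e n\<bar> \<le> 2 * norm u"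
          using e[of n] by (simp add: field_simps)
        then have "\<bar>h y\<bar> * \<bar>(w (y - e n *\<^sub>R u) - w y) / e n\<bar> \<le> (B * r) * (2 * norm u)"
          using hb[OF True] by (intro mult_mono) (auto simp: B r_def)
        then show ?thesis using True by (simp add: g_def abs_mult)
      next
        case False
        then have "norm y \<ge> 1" "norm y > r" by (auto simp: r_def intro: order_trans[of _ "1 + norm u"])
        then show ?thesis by (simp add: g_def w0 wr)
      qed
    qed
    have "(\<lambda>y. indicator (ball 0 1) y * (h y * (2 * (u \<bullet> y))) :: real) \<in> borel_measurable borel"
      by (intro borel_measurable_times borel_measurable_indicator) auto
    then show "(\<lambda>y. indicator (ball 0 1) y * (h y * (2 * (u \<bullet> y))) :: real) \<in> borel_measurable lborel"
      by simp
    have "g n \<in> borel_measurable borel" for n unfolding g_def by measurable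
    then show "g n \<in> borel_measurable lborel" for n by simp
  qed
  have "(LINT y|lborel. indicator (ball 0 1) y * (h y * (2 * (u \<bullet> y)))) \<le> h u * (LINT y|lborel. w y)"
    by (rule LIMSEQ_le_const2[OF lim]) (use le in auto)
  moreover have "(LINT y|lborel. w y) = (LINT y|lborel. indicator (ball (0::'a) 1) y * (1 - y \<bullet> y))"
    by (intro Bochner_Integration.integral_cong)
      (auto simp: w_def indicator_def dot_square_norm power_le_one not_less)
  moreover have "(LINT y|lborel. indicator (ball 0 1) y * (h y * (2 * (u \<bullet> y))))
     = 2 * (LINT y|lborel. indicator (ball 0 1) y * (h y * (u \<bullet> y)))"
  proof -
    have "(LINT y|lborel. indicator (ball 0 1) y * (h y * (2 * (u \<bullet> y))))
       = (LINT y|lborel. 2 * (indicator (ball 0 1) y * (h y * (u \<bullet> y))))"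
      by (intro Bochner_Integration.integral_cong) auto
    then show ?thesis by simp
  qed
  ultimately show ?thesis by simp
qed

text \<open>With the degree-zero function \<open>\<phi>\<close> one has
  \<open>h y * (u \<bullet> y) = (y \<bullet> y) * \<phi> y\<close>. Hence, for m =
  \<open>DIM('a)\<close>, the two sides of \<open>parabola_weight_sublinear\<close> become
  \<open>2 * m / (m + 2) * A\<close> and \<open>h u * (2 / (m + 2) * V)\<close>. The common factor
  cancels, \<open>A / V\<close> is the spherical integral, and the factor m that survives is the one
  in the definition of the Steiner point.\<close>

lemma sublinear_sphere_integral_le:
  fixes h :: "'a::euclidean_space \<Rightarrow> real" and u :: 'a
  assumes sub: "\<And>x y. h (x + y) \<le> h x + h y" and hom: "\<And>c x. c \<ge> 0 \<Longrightarrow> h (c *\<^sub>R x) = c * h x"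
    and bd: "\<And>x. \<bar>h x\<bar> \<le> B * norm x" and cont: "continuous_on UNIV h"
  shows "DIM('a) * (LINT p|sphere_measure. h p * (u \<bullet> p)) \<le> h u"
proof -
  have [measurable]: "h \<in> borel_measurable borel" by (rule borel_measurable_continuous_onI[OF cont])
  have Bn: "B \<ge> 0" using bd[of "SOME i. i \<in> Basis"] norm_some_Basis[where 'a='a] by simp
  define \<phi> where "\<phi> y = h (y /\<^sub>R norm y) * (u \<bullet> (y /\<^sub>R norm y))" for y
  have [measurable]: "\<phi> \<in> borel_measurable borel" unfolding \<phi>_def by measurable
  have \<phi>hom: "\<phi> (s *\<^sub>R y) = \<phi> y" if "s > 0" for s y
  proof -
    have "inverse s * inverse (norm y) * s = inverse (norm y)" using that by simp
    then have "(s *\<^sub>R y) /\<^sub>R norm (s *\<^sub>R y) = y /\<^sub>R norm y" using that by simp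
    then show ?thesis by (simp only: \<phi>_def)
  qed
  have n1: "norm (y /\<^sub>R norm y) \<le> 1" for y :: 'a by (cases "y = 0") auto
  have \<phi>bd: "\<bar>\<phi> y\<bar> \<le> B * norm u" for y
  proof -
    have "\<bar>h (y /\<^sub>R norm y)\<bar> \<le> B"
      using bd[of "y /\<^sub>R norm y"] mult_left_mono[OF n1[of y] Bn] by linarith
    moreover have "\<bar>u \<bullet> (y /\<^sub>R norm y)\<bar> \<le> norm u"
      using Cauchy_Schwarz_ineq2[of u "y /\<^sub>R norm y"] mult_left_mono[OF n1[of y] norm_ge_zero[of u]] by linarith
    ultimately show ?thesis unfolding \<phi>_def abs_mult by (intro mult_mono) (auto simp: Bn)
  qed
  define A V where "A = (LINT y|lborel. indicator (ball 0 1) y * \<phi> y)"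
    and "V = measure lborel (ball (0::'a) 1)"
  let ?m = "real DIM('a)"
  have V: "V > 0" unfolding V_def using content_ball_pos[of 1 "0::'a"] by simp
  have nb: "emeasure lborel (ball (0::'a) 1) < \<infinity>" by (rule emeasure_bounded_finite) auto
  have [measurable]: "(\<lambda>y. indicator (ball (0::'a) 1) y :: real) \<in> borel_measurable borel"
    by (intro borel_measurable_indicator) auto
  have iA: "integrable lborel (\<lambda>y. indicator (ball 0 1) y * \<phi> y)"
    by (rule integrableI_bounded_set[where A="ball 0 1" and B="B * norm u"]) (use nb \<phi>bd in auto)
  have iB: "integrable lborel (\<lambda>y. indicator (ball 0 1) y * ((1 - y \<bullet> y) * \<phi> y))"
  proof (rule integrableI_bounded_set[where A="ball 0 1" and B="1 * (B * norm u)"])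
    show "AE x in lborel. x \<in> ball 0 1 \<longrightarrow>
       norm (indicator (ball 0 1) x * ((1 - x \<bullet> x) * \<phi> x)) \<le> 1 * (B * norm u)"
    proof (intro always_eventually allI impI)
      fix x :: 'a assume "x \<in> ball 0 1"
      then have "\<bar>1 - x \<bullet> x\<bar> \<le> 1" by (auto simp: dot_square_norm power_le_one abs_le_iff)
      then have "\<bar>1 - x \<bullet> x\<bar> * \<bar>\<phi> x\<bar> \<le> 1 * (B * norm u)" using \<phi>bd by (intro mult_mono) auto
      then show "norm (indicator (ball 0 1) x * ((1 - x \<bullet> x) * \<phi> x)) \<le> 1 * (B * norm u)"
        using \<open>x \<in> ball 0 1\<close> by (simp add: abs_mult)
    qed
  qed (use nb in auto)
  have "(LINT y|lborel. indicator (ball 0 1) y * (h y * (u \<bullet> y)))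
     = (LINT y|lborel. indicator (ball 0 1) y * \<phi> y - indicator (ball 0 1) y * ((1 - y \<bullet> y) * \<phi> y))"
  proof (rule Bochner_Integration.integral_cong[OF refl])
    fix y :: 'a
    have "h y * (u \<bullet> y) = (y \<bullet> y) * \<phi> y"
    proof (cases "y = 0")
      case False
      have "h y = norm y * h (y /\<^sub>R norm y)" using hom[of "norm y" "y /\<^sub>R norm y"] False by simp
      moreover have "u \<bullet> y = norm y * (u \<bullet> (y /\<^sub>R norm y))" using False by simp
      ultimately show ?thesis unfolding \<phi>_def by (simp add: dot_square_norm power2_eq_square)
    qed simp
    then show "indicator (ball 0 1) y * (h y * (u \<bullet> y)) =
      indicator (ball 0 1) y * \<phi> y - indicator (ball 0 1) y * ((1 - y \<bullet> y) * \<phi> y)"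
      by (simp add: algebra_simps)
  qed
  also have "\<dots> = A - 2 / (?m + 2) * A"
    using iA iB by (simp add: integral_ball_parabola_homogeneous[OF _ \<phi>hom \<phi>bd] A_def)
  also have "\<dots> = ?m / (?m + 2) * A" by (simp add: field_simps)
  finally have 1: "(LINT y|lborel. indicator (ball 0 1) y * (h y * (u \<bullet> y))) = ?m / (?m + 2) * A" .
  have "(LINT y|lborel. indicator (ball 0 1) (y::'a) * (1 - y \<bullet> y)) = 2 / (?m + 2) * V"
    using integral_ball_parabola_homogeneous[of "\<lambda>y::'a. 1" 1] by (simp add: V_def)
  with 1 parabola_weight_sublinear[OF sub hom bd cont, of u]
  have "2 * (?m / (?m + 2) * A) \<le> h u * (2 / (?m + 2) * V)" by simp
  then have "?m * A * (2 / (?m + 2)) \<le> h u * V * (2 / (?m + 2))" by (simp add: mult_ac)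
  then have "?m * A \<le> h u * V" by (rule mult_right_le_imp_le) simp
  moreover have "(LINT p|sphere_measure. h p * (u \<bullet> p)) = A / V"
  proof -
    have "(LINT p|sphere_measure. h p * (u \<bullet> p)) = (LINT y|uniform_measure lborel (ball 0 1). \<phi> y)"
      unfolding sphere_measure_def \<phi>_def by (subst integral_distr) auto
    also have "uniform_measure lborel (ball (0::'a) 1) = density lborel (\<lambda>y. ennreal (indicator (ball 0 1) y / V))"
    proof -
      have "indicator (ball 0 1) y / emeasure lborel (ball (0::'a) 1) = ennreal (indicator (ball 0 1) y / V)" for y :: 'a
        using nb V divide_ennreal[of 1 V] by (auto simp: V_def emeasure_eq_ennreal_measure indicator_def)
      then show ?thesis unfolding uniform_measure_def by simp
    qed
    also have "(LINT y|\<dots>. \<phi> y) = (LINT y|lborel. (indicator (ball 0 1) y / V) *\<^sub>R \<phi> y)"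
      using V by (intro integral_density) auto
    also have "\<dots> = A / V" unfolding A_def by simp
    finally show ?thesis .
  qed
  ultimately show ?thesis using V by (simp add: pos_divide_le_eq)
qed

lemma support_fun_props:
  fixes K :: "'a::euclidean_space set"
  assumes K: "compact K" "K \<noteq> {}" and h: "\<And>p. h p = Sup ((\<lambda>y. p \<bullet> y) ` K)"
  obtains B where "\<And>x y. h (x + y) \<le> h x + h y" "\<And>c x. c \<ge> 0 \<Longrightarrow> h (c *\<^sub>R x) = c * h x"
    "\<And>x. \<bar>h x\<bar> \<le> B * norm x" "continuous_on UNIV h" "\<And>p y. y \<in> K \<Longrightarrow> p \<bullet> y \<le> h p"
    "\<And>p z. (\<And>y. y \<in> K \<Longrightarrow> p \<bullet> y \<le> z) \<Longrightarrow> h p \<le> z"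
proof -
  obtain B where B: "\<And>y. y \<in> K \<Longrightarrow> norm y \<le> B" using compact_imp_bounded[OF K(1)] by (auto simp: bounded_iff)
  have pB: "p \<bullet> y \<le> B * norm p" "- (B * norm p) \<le> p \<bullet> y" if "y \<in> K" for p y
    using Cauchy_Schwarz_ineq2[of p y] mult_left_mono[OF B[OF that] norm_ge_zero[of p]] by (auto simp: mult.commute abs_le_iff)
  have up: "p \<bullet> y \<le> h p" if "y \<in> K" for p y
    unfolding h using that pB by (intro cSUP_upper) (auto simp: bdd_above_def)
  have least: "h p \<le> z" if "\<And>y. y \<in> K \<Longrightarrow> p \<bullet> y \<le> z" for p z
    unfolding h using that K by (intro cSUP_least) auto
  have sub: "h (x + y) \<le> h x + h y" for x y
    by (rule least) (use up in \<open>auto simp: inner_add_left intro: add_mono\<close>)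
  obtain k where k: "k \<in> K" using K by auto
  have bd: "\<bar>h x\<bar> \<le> B * norm x" for x
    using least[of x "B * norm x"] pB up[OF k, of x] pB(2)[OF k, of x] by (auto simp: abs_le_iff)
  have hom1: "h (c *\<^sub>R x) \<le> c * h x" if "c \<ge> 0" for c x
    by (rule least) (use up that in \<open>auto intro: mult_left_mono\<close>)
  have hom: "h (c *\<^sub>R x) = c * h x" if "c \<ge> 0" for c x
  proof (cases "c = 0")
    case True then show ?thesis using bd[of 0] by simp
  next
    case False
    then have "c * h x \<le> h (c *\<^sub>R x)"
      using hom1[of "1/c" "c *\<^sub>R x"] that by (simp add: field_simps)
    then show ?thesis using hom1[OF that, of x] by simp
  qed
  have B0: "B \<ge> 0" using B[OF k] by (rule order_trans[OF norm_ge_zero])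
  have lip: "dist (h x) (h y) \<le> B * dist x y" for x y
    using sub[of "x - y" y] sub[of "y - x" x] bd[of "x-y"] bd[of "y-x"]
    by (simp add: dist_norm abs_le_iff norm_minus_commute)
  have "B-lipschitz_on UNIV h" by (rule lipschitz_onI) (use lip B0 in auto)
  then have "continuous_on UNIV h" by (rule lipschitz_on_continuous_on)
  then show ?thesis using that[OF sub hom bd _ up least] by blast
qed

text \<open>A hyperplane with normal \<open>u\<close> would strictly separate an outside Steiner
  point from \<open>K\<close>; applying \<open>sublinear_sphere_integral_le\<close> to the support
  function of \<open>K\<close> in the direction \<open>-u\<close> contradicts this.\<close>

lemma steiner_point_mem:
  fixes K :: "'a::euclidean_space set"
  assumes K: "compact K" "convex K" "K \<noteq> {}"
  shows "steiner_point K \<in> K"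
proof (rule ccontr)
  assume "steiner_point K \<notin> K"
  then obtain u b where u: "u \<bullet> steiner_point K < b" "\<And>y. y \<in> K \<Longrightarrow> u \<bullet> y > b"
    using separating_hyperplane_closed_point[OF K(2) compact_imp_closed[OF K(1)]] by blast
  define h where "h p = Sup ((\<lambda>y. p \<bullet> y) ` K)" for p
  obtain B where h: "\<And>x y. h (x + y) \<le> h x + h y" "\<And>c x. c \<ge> 0 \<Longrightarrow> h (c *\<^sub>R x) = c * h x"
    "\<And>x. \<bar>h x\<bar> \<le> B * norm x" "continuous_on UNIV h" "\<And>p y. y \<in> K \<Longrightarrow> p \<bullet> y \<le> h p"
    "\<And>p z. (\<And>y. y \<in> K \<Longrightarrow> p \<bullet> y \<le> z) \<Longrightarrow> h p \<le> z"
    using support_fun_props[OF K(1,3) h_def] by metis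
  have B0: "B \<ge> 0" using h(3)[of "SOME i. i \<in> Basis"] norm_some_Basis[where 'a='a] by simp
  have [measurable]: "h \<in> borel_measurable borel" by (rule borel_measurable_continuous_onI[OF h(4)])
  let ?S = "sphere_measure :: 'a measure"
  have n1: "norm (y /\<^sub>R norm y) \<le> 1" for y :: 'a by (cases "y = 0") auto
  have fin: "emeasure lborel (ball (0::'a) 1) < \<infinity>" by (rule emeasure_bounded_finite) auto
  have pos: "emeasure lborel (ball (0::'a) 1) \<noteq> 0"
    using content_ball_pos[of 1 "0::'a"] by (auto simp: measure_def)
  interpret U: finite_measure "uniform_measure lborel (ball (0::'a) 1)"
    by (rule finite_measureI) (use fin pos in \<open>simp add: ennreal_divide_self\<close>)
  \<comment> \<open>Integrability is what allows the inner product with \<open>-u\<close> to be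
    moved under the vector-valued integral.\<close>
  have int: "integrable ?S (\<lambda>p. h p *\<^sub>R p)"
  proof -
    have "integrable (uniform_measure lborel (ball (0::'a) 1)) (\<lambda>y. h (y /\<^sub>R norm y) *\<^sub>R (y /\<^sub>R norm y))"
    proof (rule U.integrable_const_bound[where B=B])
      have *: "\<bar>h (y /\<^sub>R norm y)\<bar> * norm (y /\<^sub>R norm y) \<le> B * 1" for y :: 'a
        using h(3)[of "y /\<^sub>R norm y"] mult_left_mono[OF n1[of y] B0] n1[of y] B0 by (intro mult_mono) auto
      have "norm (h (y /\<^sub>R norm y) *\<^sub>R (y /\<^sub>R norm y)) \<le> B" for y :: 'a
        using *[of y] by (simp only: norm_scaleR[of "h (y /\<^sub>R norm y)"] real_norm_def mult_1_right)
      then show "AE y in uniform_measure lborel (ball (0::'a) 1). norm (h (y /\<^sub>R norm y) *\<^sub>R (y /\<^sub>R norm y)) \<le> B"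
        by (intro always_eventually allI)
    qed measurable
    then show ?thesis unfolding sphere_measure_def by (subst integrable_distr_eq) auto
  qed
  have "(-u) \<bullet> steiner_point K = DIM('a) * ((-u) \<bullet> (LINT p|?S. h p *\<^sub>R p))"
    unfolding steiner_point_def h_def by simp
  also have "(-u) \<bullet> (LINT p|?S. h p *\<^sub>R p) = (LINT p|?S. (-u) \<bullet> (h p *\<^sub>R p))"
    using int by (rule integral_inner_right[symmetric])
  also have "\<dots> = (LINT p|?S. h p * ((-u) \<bullet> p))" by simp
  also have "real DIM('a) * \<dots> \<le> h (-u)"
    by (rule sublinear_sphere_integral_le[OF h(1-4)])
  also have "h (-u) \<le> -b" by (rule h(6)) (use u(2) in force)
  finally show False using u(1) by simp
qed

lemma steiner_point_singleton: "steiner_point {a :: 'a::euclidean_space} = a"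
  using steiner_point_mem[of "{a}"] by simp

section \<open>Absolutely continuous functions and indefinite integrals\<close>

definition short_family :: "real set \<Rightarrow> real \<Rightarrow> nat \<Rightarrow> (nat \<Rightarrow> real) \<Rightarrow> (nat \<Rightarrow> real) \<Rightarrow> bool" where
  "short_family S d N u v \<longleftrightarrow> (\<forall>k<N. u k \<le> v k \<and> {u k..v k} \<subseteq> S) \<and>
     (\<forall>k<N. \<forall>j<N. k \<noteq> j \<longrightarrow> v k \<le> u j \<or> v j \<le> u k) \<and> (\<Sum>k<N. v k - u k) < d"

lemma abs_cont_on_iff:
  "abs_cont_on S x \<longleftrightarrow>
    (\<forall>e>0. \<exists>d>0. \<forall>N u v. short_family S d N u v \<longrightarrow> (\<Sum>k<N. norm (x (v k) - x (u k))) < e)"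
  unfolding abs_cont_on_def short_family_def ..

lemma integral_sum_nonoverlapping_le:
  fixes D :: "real \<Rightarrow> real"
  assumes D: "D integrable_on {a..b}" "\<And>t. t \<in> {a..b} \<Longrightarrow> 0 \<le> D t"
    and sub: "\<And>k. k < N \<Longrightarrow> u k \<le> v k \<and> {u k..v k} \<subseteq> {a..b}"
    and no: "\<And>k j. k < N \<Longrightarrow> j < N \<Longrightarrow> k \<noteq> j \<Longrightarrow> v k \<le> u j \<or> v j \<le> u k"
  shows "(\<Sum>k<(N::nat). integral {u k..v k} D) \<le> integral {a..b} D"
proof -
  \<comment> \<open>Half-open intervals are truly disjoint even when the closed ones share
    endpoints, and each differs from its closure by at most the null set
    \<open>{u k}\<close>.\<close>
  define f where "f k t = (if t \<in> {u k<..v k} then D t else 0)" for k t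
  have fI: "f k integrable_on {a..b}" "integral {a..b} (f k) = integral {u k..v k} D" if "k < N" for k
  proof -
    have i: "D integrable_on {u k..v k}" using D(1) sub[OF that] by (blast intro: integrable_subinterval_real)
    have neg: "negligible ({u k..v k} - {u k<..v k})" "negligible ({u k<..v k} - {u k..v k})"
      by (rule negligible_subset[of "{u k}"]; auto)+
    have Int: "{u k<..v k} \<inter> {a..b} = {u k<..v k}" using sub[OF that] by force
    have "D integrable_on {u k<..v k}"
      by (rule integrable_spike_set[OF i]; rule negligible_subset[OF neg(1)] negligible_subset[OF neg(2)]; auto)
    then show "f k integrable_on {a..b}"
      unfolding f_def[abs_def] integrable_restrict_Int Int .
    have "integral {a..b} (f k) = integral {u k<..v k} D"
      unfolding f_def[abs_def] integral_restrict_Int Int ..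
    also have "\<dots> = integral {u k..v k} D"
      by (rule integral_spike_set; rule negligible_subset[OF neg(1)] negligible_subset[OF neg(2)]; auto)
    finally show "integral {a..b} (f k) = integral {u k..v k} D" .
  qed
  have "(\<Sum>k<N. integral {u k..v k} D) = integral {a..b} (\<lambda>t. \<Sum>k<N. f k t)"
    using fI by (subst integral_sum) auto
  also have "\<dots> \<le> integral {a..b} D"
  proof (rule integral_le)
    show "(\<lambda>t. \<Sum>k<N. f k t) integrable_on {a..b}" using fI by (intro integrable_sum) auto
    fix t assume t: "t \<in> {a..b}"
    show "(\<Sum>k<N. f k t) \<le> D t"
    proof (cases "\<exists>k<N. t \<in> {u k<..v k}")
      case True
      then obtain k where k: "k < N" "t \<in> {u k<..v k}" by auto
      have "f j t = 0" if "j \<in> {..<N} - {k}" for j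
        using no[of k j] that k by (auto simp: f_def)
      then have "(\<Sum>j<N. f j t) = f k t" using k(1) by (subst sum.remove[of _ k]) auto
      then show ?thesis using k by (simp add: f_def)
    next
      case False
      then have "(\<Sum>k<N. f k t) = 0" by (intro sum.neutral) (auto simp: f_def)
      then show ?thesis using D(2)[OF t] by simp
    qed
  qed (rule D)
  finally show ?thesis .
qed

text \<open>Truncate \<open>G\<close> at a height \<open>n\<close> for which the cut-off part has
  integral below \<open>e / 2\<close>. What remains is at most \<open>n\<close>, so its integral
  over the family is at most \<open>n\<close> times the total length.\<close>

lemma integral_absolute_continuity:
  fixes G :: "real \<Rightarrow> real"
  assumes G: "G absolutely_integrable_on {a..b}" "\<And>t. t \<in> {a..b} \<Longrightarrow> 0 \<le> G t" and e: "e > 0"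
  shows "\<exists>d>0. \<forall>N u v. short_family {a..b} d N u v \<longrightarrow> (\<Sum>k<N. integral {u k..v k} G) < e"
proof -
  define m where "m n t = min (G t) (real n)" for n t
  have Gi: "G integrable_on {a..b}" using G(1) set_lebesgue_integral_eq_integral(1) by blast
  have mi: "m n integrable_on {a..b}" for n
  proof -
    have "m n absolutely_integrable_on {a..b}" unfolding m_def[abs_def]
      by (rule absolutely_integrable_min_1[OF G(1)]) (metis absolutely_integrable_on_const cbox_interval lmeasurable_cbox)
    then show ?thesis using set_lebesgue_integral_eq_integral(1) by blast
  qed
  have "(\<lambda>n. integral {a..b} (m n)) \<longlonglongrightarrow> integral {a..b} G"
  proof (rule dominated_convergence(2)[where h=G])
    fix t assume t: "t \<in> {a..b}"
    have "eventually (\<lambda>n. G t = m n t) sequentially"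
      using eventually_ge_at_top[of "nat \<lceil>G t\<rceil>"] by eventually_elim (simp add: m_def nat_ceiling_le_eq min_def)
    then show "(\<lambda>n. m n t) \<longlonglongrightarrow> G t" by (rule Lim_transform_eventually[OF tendsto_const])
  qed (use mi Gi G(2) in \<open>auto simp: m_def\<close>)
  from order_tendstoD(1)[OF this, of "integral {a..b} G - e/2"] e
  obtain n where n: "integral {a..b} (m n) > integral {a..b} G - e/2"
    by (auto simp: eventually_sequentially)
  show ?thesis
  proof (intro exI[of _ "e / 2 / (real n + 1)"] conjI allI impI)
    show "e / 2 / (real n + 1) > 0" using e by simp
    fix N :: nat and u v :: "nat \<Rightarrow> real"
    assume "short_family {a..b} (e / 2 / (real n + 1)) N u v"
    then have sub: "\<And>k. k < N \<Longrightarrow> u k \<le> v k \<and> {u k..v k} \<subseteq> {a..b}"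
      and no: "\<And>k j. k < N \<Longrightarrow> j < N \<Longrightarrow> k \<noteq> j \<Longrightarrow> v k \<le> u j \<or> v j \<le> u k"
      and small: "(\<Sum>k<N. v k - u k) < e / 2 / (real n + 1)"
      unfolding short_family_def by auto
    have ii: "f integrable_on {u k..v k}" if "f integrable_on {a..b}" "k < N" for f :: "real \<Rightarrow> real" and k
      using that sub by (blast intro: integrable_subinterval_real)
    have "(\<Sum>k<N. integral {u k..v k} G) = (\<Sum>k<N. integral {u k..v k} (\<lambda>t. G t - m n t)) + (\<Sum>k<N. integral {u k..v k} (m n))"
      using ii[OF Gi] ii[OF mi] by (simp add: integral_diff sum_subtractf)
    also have "(\<Sum>k<N. integral {u k..v k} (\<lambda>t. G t - m n t)) \<le> integral {a..b} (\<lambda>t. G t - m n t)"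
      by (rule integral_sum_nonoverlapping_le[OF integrable_diff[OF Gi mi] _ sub no]) (auto simp: m_def)
    also have "\<dots> < e/2" using n Gi mi by (simp add: integral_diff)
    also have "(\<Sum>k<N. integral {u k..v k} (m n)) \<le> (\<Sum>k<N. real n * (v k - u k))"
    proof (rule sum_mono)
      fix k assume "k \<in> {..<N}"
      then have k: "k < N" by simp
      have "integral {u k..v k} (m n) \<le> integral {u k..v k} (\<lambda>_. real n)"
        using ii[OF mi k] by (intro integral_le) (auto simp: m_def)
      also have "\<dots> = real n * (v k - u k)" using sub[OF k] by (simp add: mult.commute)
      finally show "integral {u k..v k} (m n) \<le> real n * (v k - u k)" .
    qed
    also have "\<dots> = real n * (\<Sum>k<N. v k - u k)" by (simp add: sum_distrib_left)
    also have "\<dots> \<le> real n * (e / 2 / (real n + 1))" using small by (intro mult_left_mono) auto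
    also have "\<dots> \<le> e/2" using e by (simp add: field_simps)
    finally show "(\<Sum>k<N. integral {u k..v k} G) < e" by simp
  qed
qed

lemma integral_diff_interval:
  fixes F :: "real \<Rightarrow> 'a::banach"
  assumes "F integrable_on {a..b}" "a \<le> s" "s \<le> t" "t \<le> b"
  shows "integral {a..t} F - integral {a..s} F = integral {s..t} F"
proof -
  have "F integrable_on {a..t}" by (rule integrable_subinterval_real[OF assms(1)]) (use assms in auto)
  from Henstock_Kurzweil_Integration.integral_combine[OF assms(2,3) this]
  show ?thesis by (simp add: algebra_simps)
qed

lemma abs_cont_on_indefinite_integral:
  fixes F :: "real \<Rightarrow> 'a::euclidean_space"
  assumes F: "F absolutely_integrable_on {a..b}"
  shows "abs_cont_on {a..b} (\<lambda>t. z + integral {a..t} F)"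
  unfolding abs_cont_on_iff
proof (intro allI impI)
  fix e :: real assume e: "e > 0"
  have Fi: "F integrable_on {a..b}" using F set_lebesgue_integral_eq_integral(1) by blast
  have nF: "(\<lambda>t. norm (F t)) absolutely_integrable_on {a..b}" using F by (rule absolutely_integrable_norm[unfolded o_def])
  obtain d where d: "d > 0" "\<And>N u v. short_family {a..b} d N u v \<Longrightarrow> (\<Sum>k<N. integral {u k..v k} (\<lambda>t. norm (F t))) < e"
    using integral_absolute_continuity[OF nF norm_ge_zero e] by blast
  show "\<exists>d>0. \<forall>N u v. short_family {a..b} d N u v \<longrightarrow>
        (\<Sum>k<N. norm (z + integral {a..v k} F - (z + integral {a..u k} F))) < e"
  proof (intro exI[of _ d] conjI d(1) allI impI)
    fix N :: nat and u v :: "nat \<Rightarrow> real"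
    assume A: "short_family {a..b} d N u v"
    have "(\<Sum>k<N. norm (z + integral {a..v k} F - (z + integral {a..u k} F))) \<le> (\<Sum>k<N. integral {u k..v k} (\<lambda>t. norm (F t)))"
    proof (rule sum_mono)
      fix k assume "k \<in> {..<N}"
      then have k: "u k \<le> v k" "a \<le> u k" "v k \<le> b" using A by (auto simp: short_family_def)
      have "z + integral {a..v k} F - (z + integral {a..u k} F) = integral {u k..v k} F"
        using integral_diff_interval[OF Fi k(2,1,3)] by simp
      moreover have "norm (integral {u k..v k} F) \<le> integral {u k..v k} (\<lambda>t. norm (F t))"
      proof (rule integral_norm_bound_integral)
        show "F integrable_on {u k..v k}" by (rule integrable_subinterval_real[OF Fi]) (use k in auto)
        show "(\<lambda>t. norm (F t)) integrable_on {u k..v k}"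
          by (rule integrable_subinterval_real[OF set_lebesgue_integral_eq_integral(1)[OF nF]]) (use k in auto)
      qed simp
      ultimately show "norm (z + integral {a..v k} F - (z + integral {a..u k} F)) \<le> integral {u k..v k} (\<lambda>t. norm (F t))" by simp
    qed
    also have "\<dots> < e" using A by (rule d(2))
    finally show "(\<Sum>k<N. norm (z + integral {a..v k} F - (z + integral {a..u k} F))) < e" .
  qed
qed

lemma abs_cont_on_compose:
  assumes x: "abs_cont_on S x" "x ` S \<subseteq> A" and L: "L-lipschitz_on A \<phi>"
  shows "abs_cont_on S (\<lambda>t. \<phi> (x t))"
  unfolding abs_cont_on_iff
proof (intro allI impI)
  fix e :: real assume e: "e > 0"
  have L0: "L \<ge> 0" using L by (rule lipschitz_on_nonneg)
  then have "e / (L + 1) > 0" using e by simp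
  then obtain d where d: "d > 0" "\<And>N u v. short_family S d N u v \<Longrightarrow>
        (\<Sum>k<N. norm (x (v k) - x (u k))) < e / (L + 1)"
    using x(1) unfolding abs_cont_on_iff by blast
  show "\<exists>d>0. \<forall>N u v. short_family S d N u v \<longrightarrow> (\<Sum>k<N. norm (\<phi> (x (v k)) - \<phi> (x (u k)))) < e"
  proof (intro exI[of _ d] conjI d(1) allI impI)
    fix N :: nat and u v :: "nat \<Rightarrow> real"
    assume A: "short_family S d N u v"
    have "(\<Sum>k<N. norm (\<phi> (x (v k)) - \<phi> (x (u k)))) \<le> (\<Sum>k<N. L * norm (x (v k) - x (u k)))"
    proof (rule sum_mono)
      fix k assume "k \<in> {..<N}"
      then have "u k \<le> v k" "{u k..v k} \<subseteq> S" using A by (auto simp: short_family_def)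
      then have "u k \<in> S" "v k \<in> S" by auto
      then show "norm (\<phi> (x (v k)) - \<phi> (x (u k))) \<le> L * norm (x (v k) - x (u k))"
        using lipschitz_onD[OF L, of "x (v k)" "x (u k)"] x(2) by (auto simp: dist_norm)
    qed
    also have "\<dots> = L * (\<Sum>k<N. norm (x (v k) - x (u k)))" by (simp add: sum_distrib_left)
    also have "\<dots> \<le> L * (e / (L + 1))" using d(2)[OF A] L0 by (intro mult_left_mono) auto
    also have "\<dots> < e" using e L0 by (simp add: field_simps)
    finally show "(\<Sum>k<N. norm (\<phi> (x (v k)) - \<phi> (x (u k)))) < e" .
  qed
qed

lemma abs_cont_on_subset:
  assumes x: "abs_cont_on S x" and sub: "S' \<subseteq> S" shows "abs_cont_on S' x"
  unfolding abs_cont_on_iff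
proof (intro allI impI)
  fix e :: real assume "e > 0"
  then obtain d where d: "d > 0" "\<forall>N u v. short_family S d N u v \<longrightarrow> (\<Sum>k<N. norm (x (v k) - x (u k))) < e"
    using x unfolding abs_cont_on_iff by blast
  have "short_family S d N u v" if "short_family S' d N u v" for N u v
    using that order_trans[OF _ sub] by (simp add: short_family_def)
  with d show "\<exists>d>0. \<forall>N u v. short_family S' d N u v \<longrightarrow> (\<Sum>k<N. norm (x (v k) - x (u k))) < e"
    by (intro exI[of _ d]) simp
qed

lemma abs_cont_on_imp_continuous_on:
  assumes x: "abs_cont_on {a..b} x" shows "continuous_on {a..b} x"
  unfolding continuous_on_iff
proof (intro ballI allI impI)
  fix t and e :: real assume t: "t \<in> {a..b}" and e: "e > 0"
  obtain d where d: "d > 0" "\<And>N u v. short_family {a..b} d N u v \<Longrightarrow>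
        (\<Sum>k<N. norm (x (v k) - x (u k))) < e"
    using x e unfolding abs_cont_on_iff by blast
  show "\<exists>d>0. \<forall>s\<in>{a..b}. dist s t < d \<longrightarrow> dist (x s) (x t) < e"
  proof (intro exI[of _ d] conjI d(1) ballI impI)
    fix s assume s: "s \<in> {a..b}" "dist s t < d"
    show "dist (x s) (x t) < e"
      using d(2)[of 1 "\<lambda>_. min s t" "\<lambda>_. max s t"] s t
      by (cases "s \<le> t") (simp_all add: short_family_def dist_norm norm_minus_commute)
  qed
qed

text \<open>Gauge argument: tags in the exceptional null set are confined to an open set of small measure,
  where absolute continuity controls the increments of \<open>x\<close>.\<close>

lemma abs_cont_on_has_integral:
  fixes x :: "real \<Rightarrow> 'a::euclidean_space"
  assumes x: "abs_cont_on {a..b} x" and ab: "a \<le> b"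
    and der: "AE t in lebesgue. t \<in> {a..b} \<longrightarrow> (x has_vector_derivative F t) (at t within {a..b})"
  shows "(F has_integral (x b - x a)) {a..b}"
proof -
  define N where "N = {t \<in> {a..b}. \<not> (x has_vector_derivative F t) (at t within {a..b})}"
  have "N \<in> null_sets lebesgue"
  proof -
    obtain M where M: "M \<in> null_sets lebesgue" "{t \<in> space lebesgue. \<not> (t \<in> {a..b} \<longrightarrow> (x has_vector_derivative F t) (at t within {a..b}))} \<subseteq> M"
      using der unfolding eventually_ae_filter by blast
    show ?thesis by (rule null_sets_completion_subset[OF _ M(1)]) (use M(2) in \<open>auto simp: N_def\<close>)
  qed
  then have N: "negligible N" by (simp add: negligible_iff_null_sets)
  \<comment> \<open>\<open>F\<close> is uncontrolled on \<open>N\<close>. With the value zero there,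
    a tag in \<open>N\<close> contributes only the increment of \<open>x\<close>.\<close>
  define G where "G t = (if t \<in> N then 0 else F t)" for t
  have "(G has_integral (x b - x a)) (cbox a b)"
    unfolding has_integral
  proof (intro allI impI)
    fix e :: real assume e: "e > 0"
    \<comment> \<open>The summand 1 keeps the denominator positive when
      \<open>a = b\<close>.\<close>
    define e' where "e' = e / (2 * (b - a + 1))"
    have e': "e' > 0" "e' * (b - a) < e / 2" using e ab by (auto simp: e'_def field_simps)
    obtain d where d: "d > 0" "\<And>N u v. short_family {a..b} d N u v \<Longrightarrow> (\<Sum>k<N. norm (x (v k) - x (u k))) < e / 2"
    proof -
      have "e / 2 > 0" using e by simp
      then show ?thesis using that x unfolding abs_cont_on_iff by blast
    qed
    obtain U where U: "open U" "N \<subseteq> U" "U - N \<in> lmeasurable" "emeasure lebesgue (U - N) < ennreal d"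
      using sets_lebesgue_outer_open[OF negligible_imp_sets[OF N] d(1)] by blast
    have Um: "U \<in> lmeasurable" and Ud: "measure lebesgue U < d"
    proof -
      have *: "U = (U - N) \<union> N" using U(2) by auto
      show "U \<in> lmeasurable" by (subst *) (intro fmeasurable.Un U(3) negligible_imp_measurable[OF N])
      have "measure lebesgue U \<le> measure lebesgue (U - N) + measure lebesgue N"
        by (subst *) (intro measure_Un_le fmeasurableD U(3) negligible_imp_measurable[OF N])
      also have "\<dots> = measure lebesgue (U - N)" using negligible_imp_measure0[OF N] by simp
      also have "\<dots> < d" using U(4) U(3) d(1) by (simp add: emeasure_eq_measure2 ennreal_less_iff)
      finally show "measure lebesgue U < d" .
    qed
    have "\<exists>\<rho>>0. \<forall>s\<in>{a..b}. \<bar>s - t\<bar> < \<rho> \<longrightarrow> norm (x s - x t - (s - t) *\<^sub>R F t) \<le> e' * \<bar>s - t\<bar>"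
      if "t \<in> {a..b} - N" for t
      using that e'(1) unfolding N_def has_vector_derivative_def has_derivative_within_alt by auto
    then obtain \<rho> where \<rho>: "\<And>t. t \<in> {a..b} - N \<Longrightarrow> \<rho> t > 0"
      "\<And>t s. t \<in> {a..b} - N \<Longrightarrow> s \<in> {a..b} \<Longrightarrow> \<bar>s - t\<bar> < \<rho> t \<Longrightarrow> norm (x s - x t - (s - t) *\<^sub>R F t) \<le> e' * \<bar>s - t\<bar>"
      by metis
    define \<gamma> where "\<gamma> t = (if t \<in> N then U else if t \<in> {a..b} then ball t (\<rho> t) else UNIV)" for t
    have g: "gauge \<gamma>" unfolding gauge_def \<gamma>_def using U(1,2) \<rho>(1) by auto
    show "\<exists>\<gamma>. gauge \<gamma> \<and> (\<forall>D. D tagged_division_of cbox a b \<and> \<gamma> fine D \<longrightarrow>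
             norm ((\<Sum>(t,K)\<in>D. measure lborel K *\<^sub>R G t) - (x b - x a)) < e)"
    proof (intro exI[of _ \<gamma>] conjI g allI impI)
      fix D assume "D tagged_division_of cbox a b \<and> \<gamma> fine D"
      then have D: "D tagged_division_of {a..b}" and fine: "\<gamma> fine D" by auto
      note Dd = tagged_division_ofD[OF D]
      have K: "\<exists>u v. K = {u..v} \<and> u \<le> t \<and> t \<le> v \<and> a \<le> u \<and> v \<le> b" if tK: "(t,K) \<in> D" for t K
      proof -
        obtain p q where pq: "K = {p..q}" using Dd(4)[OF tK] by auto
        have "t \<in> {p..q}" "{p..q} \<subseteq> {a..b}" using Dd(2,3)[OF tK] pq by auto
        then show ?thesis by (intro exI[of _ p] exI[of _ q]) (use pq in auto)
      qed
      \<comment> \<open>Degenerate intervals are dropped: their increments vanish, and disjointness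
        of interiors says nothing about their position.\<close>
      define P where "P = {(t,K) \<in> D. t \<in> N \<and> measure lborel K > 0}"
      have fP: "finite P" using Dd(1) by (auto simp: P_def intro: finite_subset[of _ D])
      obtain f where f: "bij_betw f {..<card P} P"
        using ex_bij_betw_nat_finite[OF fP] by (auto simp: atLeast0LessThan)
      define u v where "u k = Inf (snd (f k))" and "v k = Sup (snd (f k))" for k
      have uv: "snd (f k) = {u k..v k}" "u k < v k" "{u k..v k} \<subseteq> {a..b}" "{u k..v k} \<subseteq> U" "measure lborel (snd (f k)) = v k - u k"
        if k: "k < card P" for k
      proof -
        have "f k \<in> P" using f k by (auto simp: bij_betw_def)
        then obtain t K where tK: "f k = (t,K)" "(t,K) \<in> D" "t \<in> N" "measure lborel K > 0" by (auto simp: P_def)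
        obtain p q where pq: "K = {p..q}" "p \<le> t" "t \<le> q" "a \<le> p" "q \<le> b" using K[OF tK(2)] by auto
        have "K \<subseteq> \<gamma> t" using fine tK(2) by (auto simp: fine_def)
        then have "K \<subseteq> U" using tK(3) by (simp add: \<gamma>_def)
        then show "snd (f k) = {u k..v k}" "u k < v k" "{u k..v k} \<subseteq> {a..b}" "{u k..v k} \<subseteq> U" "measure lborel (snd (f k)) = v k - u k"
          using tK pq by (auto simp: u_def v_def)
      qed
      have disj: "{u k<..<v k} \<inter> {u j<..<v j} = {}" if "k < card P" "j < card P" "k \<noteq> j" for k j
      proof -
        have "f k \<in> P" "f j \<in> P" "f k \<noteq> f j"
          using f that by (auto simp: bij_betw_def inj_on_def)
        then have "f k \<in> D" "f j \<in> D" "f k \<noteq> f j" by (auto simp: P_def)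
        then have "interior (snd (f k)) \<inter> interior (snd (f j)) = {}"
          using Dd(5)[of "fst (f k)" "snd (f k)" "fst (f j)" "snd (f j)"] by simp
        then show ?thesis using uv(1)[OF that(1)] uv(1)[OF that(2)] by simp
      qed
      have no: "v k \<le> u j \<or> v j \<le> u k" if "k < card P" "j < card P" "k \<noteq> j" for k j
      proof (rule ccontr)
        assume c: "\<not> ?thesis"
        have "(max (u k) (u j) + min (v k) (v j)) / 2 \<in> {u k<..<v k} \<inter> {u j<..<v j}"
          using c uv(2)[OF that(1)] uv(2)[OF that(2)] by (auto simp: min_def max_def)
        then show False using disj[OF that] by auto
      qed
      have "(\<Sum>k<card P. v k - u k) = (\<Sum>k<card P. measure lebesgue {u k<..<v k})"
        using uv(2) by (intro sum.cong) (auto simp: less_imp_le)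
      also have "\<dots> = measure lebesgue (\<Union>k<card P. {u k<..<v k})"
      proof (rule measure_finite_Union[symmetric])
        show "disjoint_family_on (\<lambda>k. {u k<..<v k}) {..<card P}"
          unfolding disjoint_family_on_def using disj by blast
        show "emeasure lebesgue {u k<..<v k} \<noteq> \<infinity>" if "k \<in> {..<card P}" for k
          using emeasure_lborel_Ioo[of "u k" "v k"] uv(2)[of k] that by simp
      qed auto
      also have "\<dots> \<le> measure lebesgue U"
      proof (rule measure_mono_fmeasurable[OF _ _ Um])
        show "(\<Union>k<card P. {u k<..<v k}) \<subseteq> U" using uv(4) by fastforce
      qed auto
      also have "\<dots> < d" by (rule Ud)
      finally have "short_family {a..b} d (card P) u v"
        unfolding short_family_def using uv no by (auto simp: less_imp_le)
      then have "(\<Sum>k<card P. norm (x (v k) - x (u k))) < e / 2" by (rule d(2))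
      also have "(\<Sum>k<card P. norm (x (v k) - x (u k))) = (\<Sum>(t,K)\<in>P. norm (x (Sup K) - x (Inf K)))"
        using sum.reindex_bij_betw[OF f, of "\<lambda>(t,K). norm (x (Sup K) - x (Inf K))"]
        by (simp add: u_def v_def case_prod_beta)
      also have "\<dots> = (\<Sum>(t,K)\<in>D. if t \<in> N \<and> measure lborel K > 0 then norm (x (Sup K) - x (Inf K)) else 0)"
      proof -
        have P': "P = {i \<in> D. fst i \<in> N \<and> measure lborel (snd i) > 0}" by (auto simp: P_def)
        show ?thesis unfolding P' sum.inter_filter[OF Dd(1)] by (simp add: case_prod_beta cong: if_cong)
      qed
      finally have bad: "(\<Sum>(t,K)\<in>D. if t \<in> N \<and> measure lborel K > 0 then norm (x (Sup K) - x (Inf K)) else 0) < e/2" .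
      have "(\<Sum>(t,K)\<in>D. measure lborel K *\<^sub>R G t) - (x b - x a) = (\<Sum>(t,K)\<in>D. measure lborel K *\<^sub>R G t - (x (Sup K) - x (Inf K)))"
        using additive_tagged_division_1[OF ab D, of x] by (simp add: sum_subtractf case_prod_beta)
      also have "norm \<dots> \<le> (\<Sum>(t,K)\<in>D. e' * measure lborel K + (if t \<in> N \<and> measure lborel K > 0 then norm (x (Sup K) - x (Inf K)) else 0))"
      proof (rule sum_norm_le, clarify)
        fix t K assume tK: "(t,K) \<in> D"
        obtain p q where pq: "K = {p..q}" "p \<le> t" "t \<le> q" "a \<le> p" "q \<le> b" using K[OF tK] by auto
        then have pq': "p \<le> q" "measure lborel K = q - p" "Sup K = q" "Inf K = p" by auto
        show "norm (measure lborel K *\<^sub>R G t - (x (Sup K) - x (Inf K)))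
           \<le> e' * measure lborel K + (if t \<in> N \<and> measure lborel K > 0 then norm (x (Sup K) - x (Inf K)) else 0)"
        proof (cases "t \<in> N")
          case True
          then show ?thesis using pq' e'(1) by (auto simp: G_def norm_minus_commute)
        next
          case False
          then have t: "t \<in> {a..b} - N" using pq by auto
          have "K \<subseteq> \<gamma> t" using fine tK by (auto simp: fine_def)
          then have "K \<subseteq> ball t (\<rho> t)" using t by (simp add: \<gamma>_def)
          moreover have "p \<in> K" "q \<in> K" using pq pq' by auto
          ultimately have "p \<in> ball t (\<rho> t)" "q \<in> ball t (\<rho> t)" by blast+
          \<comment> \<open>The derivative at the tag compares \<open>x\<close> at each endpoint
            with \<open>x t\<close>, so the increment over the interval is split at
            \<open>t\<close>.\<close>
          then have 1: "norm (x p - x t - (p - t) *\<^sub>R F t) \<le> e' * (t - p)" "norm (x q - x t - (q - t) *\<^sub>R F t) \<le> e' * (q - t)"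
            using \<rho>(2)[OF t, of p] \<rho>(2)[OF t, of q] pq by (auto simp: dist_real_def abs_minus_commute)
          have "measure lborel K *\<^sub>R G t - (x (Sup K) - x (Inf K))
              = (x p - x t - (p - t) *\<^sub>R F t) - (x q - x t - (q - t) *\<^sub>R F t)"
            using False unfolding pq' G_def by (simp add: algebra_simps)
          also have "norm \<dots> \<le> e' * (t - p) + e' * (q - t)"
            by (rule order_trans[OF norm_triangle_ineq4 add_mono[OF 1]])
          also have "\<dots> = e' * measure lborel K" by (simp add: pq' algebra_simps)
          finally show ?thesis using False by simp
        qed
      qed
      also have "\<dots> = e' * (\<Sum>(t,K)\<in>D. measure lborel K) + (\<Sum>(t,K)\<in>D. if t \<in> N \<and> measure lborel K > 0 then norm (x (Sup K) - x (Inf K)) else 0)"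
        by (simp add: sum.distrib sum_distrib_left case_prod_beta)
      also have "(\<Sum>(t,K)\<in>D. measure lborel K) = b - a"
        using additive_content_tagged_division[of D a b] D ab by simp
      finally show "norm ((\<Sum>(t,K)\<in>D. measure lborel K *\<^sub>R G t) - (x b - x a)) < e" using bad e'(2) by linarith
    qed
  qed
  then show ?thesis
    by (intro has_integral_spike[OF N, of _ F G]) (auto simp: G_def)
qed

text \<open>By the Saks-Henstock lemma, disjoint fine intervals on which the mean value is off by more than
  \<open>e\<close> have small total length; Vitali's theorem covers the bad set by such intervals.\<close>

lemma lebesgue_differentiation_bad_set:
  fixes F :: "real \<Rightarrow> 'a::euclidean_space"
  assumes F: "F integrable_on {a..b}" and e: "e > 0"
  shows "negligible {t \<in> {a..b}. \<forall>d>0. \<exists>u v. u \<le> t \<and> t \<le> v \<and> u < v \<and> v - u < d \<and> {u..v} \<subseteq> {a..b} \<and>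
           norm ((v - u) *\<^sub>R F t - integral {u..v} F) > e * (v - u)}"
    (is "negligible ?S")
  unfolding negligible_outer_le
proof (intro allI impI)
  fix \<eta> :: real assume \<eta>: "\<eta> > 0"
  have "F integrable_on cbox a b" and "e * \<eta> > 0" using F e \<eta> by auto
  then obtain \<gamma> where \<gamma>: "gauge \<gamma>"
    and hen: "\<forall>p. p tagged_partial_division_of (cbox a b) \<longrightarrow> \<gamma> fine p \<longrightarrow>
             (\<Sum>(x,k)\<in>p. norm (measure lborel k *\<^sub>R F x - integral k F)) < e * \<eta>"
    by (rule Henstock_lemma) blast
  define K where "K = {(t,u,v). t \<in> ?S \<and> u \<le> t \<and> t \<le> v \<and> u < v \<and> {u..v} \<subseteq> {a..b} \<and> {u..v} \<subseteq> \<gamma> t \<and>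
           norm ((v - u) *\<^sub>R F t - integral {u..v} F) > e * (v - u)}"
  \<comment> \<open>Centres and radii rewrite the intervals as closed balls, the form in which the
    covering theorem takes them.\<close>
  define c r where "c = (\<lambda>(t::real,u,v). (u + v) / 2 :: real)" and "r = (\<lambda>(t::real,u,v). (v - u) / 2 :: real)"
  have cb: "cball (c (t,u,v)) (r (t,u,v)) = {u..v}" for t u v
    by (auto simp: c_def r_def cball_eq_atLeastAtMost field_simps)
  obtain C where C: "countable C" "C \<subseteq> K" "pairwise (\<lambda>i j. disjnt (cball (c i) (r i)) (cball (c j) (r j))) C"
     "negligible (?S - (\<Union>i \<in> C. cball (c i) (r i)))"
  proof (rule Vitali_covering_theorem_cballs[of K r ?S c])
    show "0 < r i" if "i \<in> K" for i using that by (auto simp: K_def r_def)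
    fix t d :: real assume t: "t \<in> ?S" and d: "0 < d"
    have "open (\<gamma> t)" "t \<in> \<gamma> t" using \<gamma> by (auto simp: gauge_def)
    then obtain \<rho> where \<rho>: "\<rho> > 0" "ball t \<rho> \<subseteq> \<gamma> t" using open_contains_ball by blast
    have "min \<rho> d > 0" using \<rho> d by simp
    with t obtain u v where uv: "u \<le> t" "t \<le> v" "u < v" "v - u < min \<rho> d" "{u..v} \<subseteq> {a..b}"
      "norm ((v - u) *\<^sub>R F t - integral {u..v} F) > e * (v - u)" by blast
    have "{u..v} \<subseteq> ball t \<rho>" using uv by (auto simp: dist_real_def)
    then have "(t,u,v) \<in> K" using t uv \<rho>(2) unfolding K_def by auto
    moreover have "t \<in> cball (c (t,u,v)) (r (t,u,v))" unfolding cb using uv by simp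
    moreover have "r (t,u,v) < d" using uv by (simp add: r_def)
    ultimately show "\<exists>i. i \<in> K \<and> t \<in> cball (c i) (r i) \<and> r i < d" by blast
  qed
  \<comment> \<open>On each selected interval the Henstock error exceeds \<open>e\<close> times its
    length, while the errors of a finite disjoint fine family sum to less than
    \<open>e * \<eta>\<close>. So every finite subfamily has total length at most
    \<open>\<eta>\<close>, and this bound passes to the countable union.\<close>
  have le: "measure lebesgue (\<Union>i\<in>D. cball (c i) (r i)) \<le> \<eta>" if D: "D \<subseteq> C" "finite D" for D
  proof -
    define h where "h = (\<lambda>(t::real,u::real,v::real). (t, {u..v}))"
    have DK: "D \<subseteq> K" using D C by auto
    have inj: "inj_on h D"
    proof (rule inj_onI)
      fix i j assume "i \<in> D" "j \<in> D" "h i = h j"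
      then show "i = j" using DK by (cases i; cases j) (auto simp: h_def K_def atLeastatMost_subset_iff set_eq_subset)
    qed
    have "h ` D tagged_partial_division_of (cbox a b)"
      unfolding tagged_partial_division_of_def
    proof (intro conjI allI impI)
      show "finite (h ` D)" using D by auto
      fix t L assume "(t,L) \<in> h ` D"
      then obtain u v where uv: "(t,u,v) \<in> D" "L = {u..v}" by (auto simp: h_def)
      then have k: "(t,u,v) \<in> K" using DK by auto
      show "t \<in> L" "L \<subseteq> cbox a b" using uv k by (auto simp: K_def)
      show "\<exists>p q. L = cbox p q" using uv by auto
    next
      fix t L t' L' assume tL: "(t,L) \<in> h ` D \<and> (t',L') \<in> h ` D \<and> (t,L) \<noteq> (t',L')"
      obtain u v where uv: "(t,u,v) \<in> D" "L = {u..v}" using tL by (auto simp: h_def)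
      obtain u' v' where uv': "(t',u',v') \<in> D" "L' = {u'..v'}" using tL by (auto simp: h_def)
      have ne: "(t,u,v) \<noteq> (t',u',v')" using tL uv uv' by auto
      have mem: "(t,u,v) \<in> C" "(t',u',v') \<in> C" using uv uv' D(1) by auto
      have "disjnt (cball (c (t,u,v)) (r (t,u,v))) (cball (c (t',u',v')) (r (t',u',v')))"
        by (rule pairwiseD[OF C(3) mem ne])
      then have "disjnt {u..v} {u'..v'}" by (simp only: cb)
      then show "interior L \<inter> interior L' = {}"
        using uv(2) uv'(2) interior_subset[of L] interior_subset[of L'] unfolding disjnt_def by blast
    qed
    moreover have "\<gamma> fine (h ` D)"
      using DK unfolding fine_def h_def K_def by auto
    ultimately have "(\<Sum>(x,k)\<in>h ` D. norm (measure lborel k *\<^sub>R F x - integral k F)) < e * \<eta>" using hen by blast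
    also have "(\<Sum>(x,k)\<in>h ` D. norm (measure lborel k *\<^sub>R F x - integral k F))
        = (\<Sum>i\<in>D. norm (measure lborel (snd (h i)) *\<^sub>R F (fst (h i)) - integral (snd (h i)) F))"
      by (simp add: sum.reindex[OF inj] case_prod_beta)
    finally have 1: "(\<Sum>i\<in>D. norm (measure lborel (snd (h i)) *\<^sub>R F (fst (h i)) - integral (snd (h i)) F)) < e * \<eta>" .
    have "e * measure lebesgue (\<Union>i\<in>D. cball (c i) (r i)) \<le> e * (\<Sum>i\<in>D. measure lebesgue (cball (c i) (r i)))"
      using e D by (intro mult_left_mono measure_UNION_le) auto
    also have "\<dots> = (\<Sum>i\<in>D. e * measure lebesgue (cball (c i) (r i)))" by (simp add: sum_distrib_left)
    also have "\<dots> \<le> (\<Sum>i\<in>D. norm (measure lborel (snd (h i)) *\<^sub>R F (fst (h i)) - integral (snd (h i)) F))"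
    proof (rule sum_mono)
      fix i assume "i \<in> D"
      then have "i \<in> K" using DK by auto
      moreover obtain t u v where i: "i = (t,u,v)" by (cases i)
      ultimately show "e * measure lebesgue (cball (c i) (r i)) \<le> norm (measure lborel (snd (h i)) *\<^sub>R F (fst (h i)) - integral (snd (h i)) F)"
        unfolding i cb by (auto simp: h_def K_def)
    qed
    finally have "e * measure lebesgue (\<Union>i\<in>D. cball (c i) (r i)) < e * \<eta>" using 1 by (rule le_less_trans)
    then show ?thesis using e by simp
  qed
  have m: "\<And>i. i \<in> C \<Longrightarrow> cball (c i) (r i) \<in> lmeasurable" by simp
  let ?T = "(\<Union>i\<in>C. cball (c i) (r i)) \<union> (?S - (\<Union>i\<in>C. cball (c i) (r i)))"
  show "\<exists>T. ?S \<subseteq> T \<and> T \<in> lmeasurable \<and> measure lebesgue T \<le> \<eta>"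
  proof (intro exI[of _ ?T] conjI)
    have U: "(\<Union>i\<in>C. cball (c i) (r i)) \<in> lmeasurable" by (rule fmeasurable_UN_bound[OF C(1) m le])
    show "?T \<in> lmeasurable" by (intro fmeasurable.Un U negligible_imp_measurable C(4))
    have "measure lebesgue ?T \<le> measure lebesgue (\<Union>i\<in>C. cball (c i) (r i)) + measure lebesgue (?S - (\<Union>i\<in>C. cball (c i) (r i)))"
      by (intro measure_Un_le fmeasurableD U negligible_imp_measurable C(4))
    also have "\<dots> \<le> \<eta>" using measure_UN_bound[OF C(1) m le] negligible_imp_measure0[OF C(4)] by simp
    finally show "measure lebesgue ?T \<le> \<eta>" .
  qed auto
qed

text \<open>Failure of differentiability at \<open>t\<close> puts \<open>t\<close> into the bad set
  for some tolerance \<open>1 / (n + 1)\<close>, and countably many null sets have a null union. The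
  intervals between \<open>t\<close> and a neighbouring point, on either side, are among those
  tested in the bad set.\<close>

lemma indefinite_integral_has_vector_derivative_AE:
  fixes F :: "real \<Rightarrow> 'a::euclidean_space"
  assumes F: "F integrable_on {a..b}"
  shows "AE t in lebesgue. t \<in> {a..b} \<longrightarrow>
    ((\<lambda>t. z + integral {a..t} F) has_vector_derivative F t) (at t within {a..b})"
proof -
  define S where "S n = {t \<in> {a..b}. \<forall>d>0. \<exists>u v. u \<le> t \<and> t \<le> v \<and> u < v \<and> v - u < d \<and> {u..v} \<subseteq> {a..b} \<and>
           norm ((v - u) *\<^sub>R F t - integral {u..v} F) > inverse (real (Suc n)) * (v - u)}" for n
  have "negligible (\<Union>n. S n)"
    unfolding S_def by (intro negligible_Union_nat lebesgue_differentiation_bad_set F) auto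
  then have "(\<Union>n. S n) \<in> null_sets lebesgue" by (simp add: negligible_iff_null_sets)
  then have "AE t in lebesgue. t \<notin> (\<Union>n. S n)" by (rule AE_not_in)
  then show ?thesis
  proof eventually_elim
    case (elim t)
    show ?case
    proof
      assume t: "t \<in> {a..b}"
      show "((\<lambda>t. z + integral {a..t} F) has_vector_derivative F t) (at t within {a..b})"
        unfolding has_vector_derivative_def has_derivative_within_alt
      proof (intro conjI allI impI)
        show "bounded_linear (\<lambda>x. x *\<^sub>R F t)" by (rule bounded_linear_scaleR_left)
        fix e :: real assume "e > 0"
        then obtain n where n: "inverse (real (Suc n)) < e" using reals_Archimedean by blast
        have "t \<notin> S n" using elim by auto
        then have "\<not> (\<forall>d>0. \<exists>u v. u \<le> t \<and> t \<le> v \<and> u < v \<and> v - u < d \<and> {u..v} \<subseteq> {a..b} \<and>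
           norm ((v - u) *\<^sub>R F t - integral {u..v} F) > inverse (real (Suc n)) * (v - u))"
          unfolding S_def mem_Collect_eq using t by (simp only: simp_thms)
        then obtain d where d: "d > 0" and nd: "\<not> (\<exists>u v. u \<le> t \<and> t \<le> v \<and> u < v \<and> v - u < d \<and> {u..v} \<subseteq> {a..b} \<and>
           norm ((v - u) *\<^sub>R F t - integral {u..v} F) > inverse (real (Suc n)) * (v - u))"
          by (auto simp only: not_all not_imp)
        have d': "norm ((v - u) *\<^sub>R F t - integral {u..v} F) \<le> inverse (real (Suc n)) * (v - u)"
          if uv: "u \<le> t" "t \<le> v" "u < v" "v - u < d" "{u..v} \<subseteq> {a..b}" for u v
        proof (rule ccontr)
          assume "\<not> ?thesis"
          then have "norm ((v - u) *\<^sub>R F t - integral {u..v} F) > inverse (real (Suc n)) * (v - u)" by (rule not_le_imp_less)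
          with uv have "\<exists>u v. u \<le> t \<and> t \<le> v \<and> u < v \<and> v - u < d \<and> {u..v} \<subseteq> {a..b} \<and>
             norm ((v - u) *\<^sub>R F t - integral {u..v} F) > inverse (real (Suc n)) * (v - u)"
            by (intro exI[of _ u] exI[of _ v] conjI)
          with nd show False by (rule notE)
        qed
        show "\<exists>d>0. \<forall>s\<in>{a..b}. norm (s - t) < d \<longrightarrow>
               norm (z + integral {a..s} F - (z + integral {a..t} F) - (s - t) *\<^sub>R F t) \<le> e * norm (s - t)"
        proof (intro exI[of _ d] conjI d ballI impI)
          fix s assume s: "s \<in> {a..b}" "norm (s - t) < d"
          consider "s = t" | "s < t" | "t < s" by linarith
          then show "norm (z + integral {a..s} F - (z + integral {a..t} F) - (s - t) *\<^sub>R F t) \<le> e * norm (s - t)"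
          proof cases
            case 1 then show ?thesis by simp
          next
            case 2
            have "integral {a..t} F - integral {a..s} F = integral {s..t} F"
              using s t 2 by (intro integral_diff_interval[OF F]) auto
            then have "z + integral {a..s} F - (z + integral {a..t} F) - (s - t) *\<^sub>R F t = (t - s) *\<^sub>R F t - integral {s..t} F"
              by (simp add: algebra_simps)
            moreover have "norm ((t - s) *\<^sub>R F t - integral {s..t} F) \<le> inverse (real (Suc n)) * (t - s)"
              using s t 2 by (intro d') auto
            moreover have le: "inverse (real (Suc n)) * (t - s) \<le> e * (t - s)" using n 2 by (intro mult_right_mono) auto
            ultimately have "norm (z + integral {a..s} F - (z + integral {a..t} F) - (s - t) *\<^sub>R F t) \<le> e * (t - s)"
              using order_trans[OF _ le] by metis
            then show ?thesis using 2 by simp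
          next
            case 3
            have "integral {a..s} F - integral {a..t} F = integral {t..s} F"
              using s t 3 by (intro integral_diff_interval[OF F]) auto
            then have "norm (z + integral {a..s} F - (z + integral {a..t} F) - (s - t) *\<^sub>R F t) = norm ((s - t) *\<^sub>R F t - integral {t..s} F)"
              by (subst norm_minus_cancel[symmetric]) (simp add: algebra_simps)
            moreover have "norm ((s - t) *\<^sub>R F t - integral {t..s} F) \<le> inverse (real (Suc n)) * (s - t)"
              using s t 3 by (intro d') auto
            moreover have le: "inverse (real (Suc n)) * (s - t) \<le> e * (s - t)" using n 3 by (intro mult_right_mono) auto
            ultimately have "norm (z + integral {a..s} F - (z + integral {a..t} F) - (s - t) *\<^sub>R F t) \<le> e * (s - t)"
              using order_trans[OF _ le] by metis
            then show ?thesis using 3 by simp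
          qed
        qed
      qed
    qed
  qed
qed

text \<open>The chain rule holds almost everywhere and \<open>exp (2 C) / 2\<close>, with
  \<open>C\<close> the primitive of \<open>c\<close>, is absolutely continuous, so it is recovered
  from its derivative. The factor 2 in the exponent is deliberate: integrating \<open>c\<close>
  times the weight returns at most half of the weight at the right endpoint. This gain of 1/2
  absorbs the integral term in Gronwall's inequality and makes the Filippov increments decay
  geometrically.\<close>

lemma exp_weight_has_integral:
  fixes c :: "real \<Rightarrow> real"
  assumes c: "c absolutely_integrable_on {a..b}" "\<And>t. t \<in> {a..b} \<Longrightarrow> 0 \<le> c t"
    and st: "a \<le> s" "s \<le> t" "t \<le> b"
  shows "((\<lambda>r. c r * exp (2 * integral {a..r} c)) has_integral
            (exp (2 * integral {a..t} c) - exp (2 * integral {a..s} c)) / 2) {s..t}"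
proof -
  define C where "C r = integral {a..r} c" for r
  have ci: "c integrable_on {a..b}" using c(1) set_lebesgue_integral_eq_integral(1) by blast
  have ac: "abs_cont_on {a..b} C"
    using abs_cont_on_indefinite_integral[OF c(1), of 0] by (simp add: C_def[abs_def])
  have bnd: "C r \<in> {0..C b}" if "r \<in> {a..b}" for r
  proof -
    have i: "c integrable_on {u..v}" if "a \<le> u" "v \<le> b" for u v
      by (rule integrable_subinterval_real[OF ci]) (use that in auto)
    have "0 \<le> C r" unfolding C_def using that c(2) by (intro Henstock_Kurzweil_Integration.integral_nonneg i) auto
    moreover have "0 \<le> integral {r..b} c" using that c(2) by (intro Henstock_Kurzweil_Integration.integral_nonneg i) auto
    ultimately show ?thesis
      using integral_diff_interval[OF ci, of r b] that by (auto simp: C_def)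
  qed
  \<comment> \<open>The exponential is Lipschitz only on bounded sets; the monotone primitive
    \<open>C\<close> takes its values in this interval.\<close>
  have L: "(exp (2 * C b))-lipschitz_on {0..C b} (\<lambda>y. exp (2 * y) / 2)"
  proof (rule bounded_derivative_imp_lipschitz[where f'="\<lambda>y h. h * exp (2 * y)"])
    show "((\<lambda>y. exp (2 * y) / 2) has_derivative (\<lambda>h. h * exp (2 * y))) (at y within {0..C b})" for y :: real
      by (auto intro!: derivative_eq_intros)
    show "onorm (\<lambda>h. h * exp (2 * y)) \<le> exp (2 * C b)" if "y \<in> {0..C b}" for y
    proof (rule onorm_bound)
      fix h :: real
      have "\<bar>h\<bar> * exp (2 * y) \<le> \<bar>h\<bar> * exp (2 * C b)" using that by (intro mult_left_mono) auto
      then show "norm (h * exp (2 * y)) \<le> exp (2 * C b) * norm h" by (simp add: abs_mult mult.commute)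
    qed simp
  qed auto
  have ac2: "abs_cont_on {a..b} (\<lambda>r. exp (2 * C r) / 2)"
    by (rule abs_cont_on_compose[OF ac _ L]) (use bnd in auto)
  then have ac3: "abs_cont_on {s..t} (\<lambda>r. exp (2 * C r) / 2)"
    by (rule abs_cont_on_subset) (use st in auto)
  have "AE r in lebesgue. r \<in> {a..b} \<longrightarrow> (C has_vector_derivative c r) (at r within {a..b})"
    using indefinite_integral_has_vector_derivative_AE[OF ci, of 0] by (simp add: C_def[abs_def])
  then have "AE r in lebesgue. r \<in> {s..t} \<longrightarrow>
     ((\<lambda>r. exp (2 * C r) / 2) has_vector_derivative c r * exp (2 * C r)) (at r within {s..t})"
  proof eventually_elim
    case (elim r)
    show ?case
    proof
      assume r: "r \<in> {s..t}"
      then have "(C has_real_derivative c r) (at r within {a..b})"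
        using elim st by (auto simp: has_real_derivative_iff_has_vector_derivative)
      then have "(C has_real_derivative c r) (at r within {s..t})"
        by (rule DERIV_subset) (use st in auto)
      then have "((\<lambda>r. exp (2 * C r) / 2) has_real_derivative c r * exp (2 * C r)) (at r within {s..t})"
        by (auto intro!: derivative_eq_intros)
      then show "((\<lambda>r. exp (2 * C r) / 2) has_vector_derivative c r * exp (2 * C r)) (at r within {s..t})"
        by (simp add: has_real_derivative_iff_has_vector_derivative)
    qed
  qed
  from abs_cont_on_has_integral[OF ac3 st(2) this]
  show ?thesis by (simp add: C_def diff_divide_distrib)
qed

section \<open>Epigraphs of conjugate functions\<close>

text \<open>The form of \<open>epi_conj\<close> with \<open>t\<close> and \<open>x\<close> frozen.
  Writing the epigraph by inequalities keeps the conjugate, which may be infinite, out of the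
  formulas.\<close>

definition conj_epi :: "('a::euclidean_space \<Rightarrow> real) \<Rightarrow> ('a \<times> real) set" where
  "conj_epi h = {(v, r). \<forall>p. v \<bullet> p - h p \<le> r}"

lemma mem_conj_epi_iff: "(v, r) \<in> conj_epi h \<longleftrightarrow> (\<forall>p. v \<bullet> p - h p \<le> r)"
  by (simp add: conj_epi_def)

lemma epi_conj_eq: "epi_conj H t x = conj_epi (H t x)"
  by (simp add: epi_conj_def conj_epi_def)

text \<open>Separate the point \<open>(q, h q)\<close> from the strict epigraph of \<open>h\<close>.
  Because \<open>h\<close> is finite everywhere, the hyperplane cannot be vertical:
  \<open>\<beta> = 0\<close> would force \<open>\<alpha> = 0\<close>. Dividing the normal by
  \<open>-\<beta>\<close> gives the slope.\<close>

lemma convex_subgradient_exists: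
  fixes h :: "'a::euclidean_space \<Rightarrow> real"
  assumes h: "convex_on UNIV h"
  obtains v where "\<And>p. h q + v \<bullet> (p - q) \<le> h p"
proof -
  let ?S = "{(p, r). h p < r}"
  have cv: "convex ?S"
  proof (rule convexI, clarsimp)
    fix x r y s and u v :: real
    assume a: "h x < r" "h y < s" "0 \<le> u" "0 \<le> v" "u + v = 1"
    have "h (u *\<^sub>R x + v *\<^sub>R y) \<le> u * h x + v * h y"
      using h a by (auto simp: convex_on_def)
    also have "\<dots> < u * r + v * s"
    proof (cases "u = 0")
      case True then show ?thesis using a by simp
    next
      case False
      then show ?thesis using a by (intro add_less_le_mono mult_strict_left_mono mult_left_mono) auto
    qed
    finally show "h (u *\<^sub>R x + v *\<^sub>R y) < u * r + v * s" .
  qed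
  have "(q, h q + 1) \<in> ?S" "?S \<inter> {(q, h q)} = {}" by auto
  then obtain a b where ab: "a \<noteq> 0" "\<forall>z\<in>?S. a \<bullet> z \<le> b" "\<forall>z\<in>{(q, h q)}. a \<bullet> z \<ge> b"
    using separating_hyperplane_sets[OF cv convex_singleton[of "(q, h q)"]] by blast
  obtain \<alpha> \<beta> where a: "a = (\<alpha>, \<beta>)" by (cases a)
  have le: "\<alpha> \<bullet> p + \<beta> * r \<le> \<alpha> \<bullet> q + \<beta> * h q" if "h p < r" for p r
    using ab(2,3) that by (force simp: a)
  have "\<beta> \<le> 0" using le[of q "h q + 1"] by (simp add: algebra_simps)
  moreover have "\<beta> \<noteq> 0"
  proof
    assume 0: "\<beta> = 0"
    have "\<alpha> \<bullet> (q + \<alpha>) \<le> \<alpha> \<bullet> q" using le[of "q + \<alpha>" "h (q + \<alpha>) + 1"] 0 by simp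
    then have "\<alpha> \<bullet> \<alpha> \<le> 0" by (simp add: inner_add_right)
    then have "\<alpha> = 0" by (metis inner_eq_zero_iff inner_ge_zero antisym)
    then show False using ab(1) a 0 by (simp add: zero_prod_def)
  qed
  ultimately have \<beta>: "\<beta> < 0" by simp
  have lim: "\<alpha> \<bullet> p + \<beta> * h p \<le> \<alpha> \<bullet> q + \<beta> * h q" for p
  proof (rule field_le_epsilon)
    fix e :: real assume "e > 0"
    then have "\<alpha> \<bullet> p + \<beta> * (h p + e / (-\<beta>)) \<le> \<alpha> \<bullet> q + \<beta> * h q" using \<beta> by (intro le) (simp add: divide_neg_neg divide_pos_neg)
    then show "\<alpha> \<bullet> p + \<beta> * h p \<le> \<alpha> \<bullet> q + \<beta> * h q + e" using \<beta> by (simp add: algebra_simps)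
  qed
  show ?thesis
  proof (rule that[of "\<alpha> /\<^sub>R (-\<beta>)"])
    fix p
    have "\<alpha> \<bullet> (p - q) / (-\<beta>) \<le> h p - h q"
      using lim[of p] \<beta> by (subst pos_divide_le_eq) (auto simp: inner_diff_right algebra_simps)
    then show "h q + (\<alpha> /\<^sub>R (-\<beta>)) \<bullet> (p - q) \<le> h p" by (simp add: divide_inverse mult.commute)
  qed
qed

lemma closed_conj_epi: "closed (conj_epi h)"
proof -
  have "conj_epi h = (\<Inter>p. {z. fst z \<bullet> p - h p \<le> snd z})" by (auto simp: conj_epi_def)
  then show ?thesis by (auto intro!: closed_INT closed_Collect_le continuous_intros)
qed

lemma convex_conj_epi: "convex (conj_epi h)"
proof (rule convexI)
  fix x y and u v :: real
  assume a: "x \<in> conj_epi h" "y \<in> conj_epi h" "0 \<le> u" "0 \<le> v" "u + v = 1"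
  have "fst (u *\<^sub>R x + v *\<^sub>R y) \<bullet> p - h p \<le> snd (u *\<^sub>R x + v *\<^sub>R y)" for p
  proof -
    have "u * (fst x \<bullet> p - h p) + v * (fst y \<bullet> p - h p) \<le> u * snd x + v * snd y"
      using a by (intro add_mono mult_left_mono) (auto simp: conj_epi_def)
    moreover have "u * (fst x \<bullet> p - h p) + v * (fst y \<bullet> p - h p) = u * (fst x \<bullet> p) + v * (fst y \<bullet> p) - (u + v) * h p"
      by (simp add: algebra_simps)
    ultimately show ?thesis using a(5) by (simp add: inner_add_left)
  qed
  then show "u *\<^sub>R x + v *\<^sub>R y \<in> conj_epi h" by (simp add: conj_epi_def case_prod_beta)
qed

lemma conj_epi_subgradient:
  assumes "\<And>p. h q + v \<bullet> (p - q) \<le> h p"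
  shows "(v, v \<bullet> q - h q) \<in> conj_epi h"
  using assms by (auto simp: conj_epi_def inner_diff_right algebra_simps)

lemma conj_epi_nonempty: "convex_on UNIV h \<Longrightarrow> conj_epi h \<noteq> {}"
  using convex_subgradient_exists conj_epi_subgradient by (metis empty_iff)

lemma infdist_closest_point:
  fixes a :: "'a::euclidean_space"
  assumes "closed S" "S \<noteq> {}"
  shows "infdist a S = dist a (closest_point S a)"
  using assms by (metis infdist_eq_setdist setdist_closest_point)

text \<open>Distance to a convex set in terms of its support function: for a normal direction \<open>(q, -1)\<close> the
  support function of the epigraph of the conjugate is \<open>h q\<close>, and horizontal normals are limits of these.\<close>

lemma infdist_conj_epi_le_iff:
  fixes h :: "'a::euclidean_space \<Rightarrow> real"
  assumes h: "convex_on UNIV h" and d: "d \<ge> 0"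
  shows "infdist (w, s) (conj_epi h) \<le> d \<longleftrightarrow> (\<forall>q. w \<bullet> q - s - h q \<le> d * norm (q, 1::real))"
proof -
  let ?E = "conj_epi h"
  note E = closed_conj_epi[of h] conj_epi_nonempty[OF h]
  obtain v r where vr: "closest_point ?E (w, s) = (v, r)" by (cases "closest_point ?E (w, s)")
  have mem: "(v, r) \<in> ?E" using closest_point_in_set[OF E, of "(w,s)"] vr by simp
  have D: "infdist (w, s) ?E = norm (w - v, s - r)"
    using infdist_closest_point[OF E, of "(w,s)"] vr by (simp add: dist_norm)
  have proj: "(w - v) \<bullet> (v' - v) + (s - r) * (r' - r) \<le> 0" if "(v', r') \<in> ?E" for v' r'
    using closest_point_dot[OF convex_conj_epi closed_conj_epi that, of "(w,s)"] vr by simp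
  \<comment> \<open>The epigraph is closed upwards; testing the projection inequality with the point
    raised by 1 shows that projecting never lowers the second component.\<close>
  have "v \<bullet> p - h p \<le> r + 1" for p
    using mem[unfolded mem_conj_epi_iff, rule_format, of p] by linarith
  then have "s - r \<le> 0" using proj[of v "r + 1"] by (simp add: mem_conj_epi_iff)
  define \<xi> where "\<xi> = r - s"
  define n where "n = w - v"
  define D where "D = norm (n, \<xi>)"
  have Deq: "infdist (w, s) ?E = D"
    unfolding D D_def n_def \<xi>_def norm_Pair by (simp add: power2_commute)
  have \<xi>: "\<xi> \<ge> 0" using \<open>s - r \<le> 0\<close> by (simp add: \<xi>_def)
  have D2: "D * D = n \<bullet> n + \<xi> * \<xi>" unfolding D_def norm_Pair by (simp add: dot_square_norm power2_eq_square)
  show ?thesis unfolding Deq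
  proof
    assume le: "D \<le> d"
    show "\<forall>q. w \<bullet> q - s - h q \<le> d * norm (q, 1::real)"
    proof
      fix q
      have "v \<bullet> q - h q \<le> r" using mem by (auto simp: conj_epi_def)
      then have "w \<bullet> q - s - h q \<le> (n, \<xi>) \<bullet> (q, 1)" by (simp add: n_def \<xi>_def inner_diff_left)
      also have "\<dots> \<le> D * norm (q, 1::real)" unfolding D_def by (rule norm_cauchy_schwarz)
      also have "\<dots> \<le> d * norm (q, 1::real)" using le by (rule mult_right_mono) simp
      finally show "w \<bullet> q - s - h q \<le> d * norm (q, 1::real)" .
    qed
  next
    assume A: "\<forall>q. w \<bullet> q - s - h q \<le> d * norm (q, 1::real)"
    show "D \<le> d"
    proof (rule ccontr)
      assume "\<not> D \<le> d"
      then have Dd: "D > d" "D > 0" using d by auto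
      show False
      proof (cases "\<xi> = 0")
        case False
        then have l: "\<xi> > 0" using \<xi> by simp
        \<comment> \<open>The residual of the projection is then \<open>\<xi>\<close> times
          \<open>(q, -1)\<close>. A subgradient at \<open>q\<close> yields a point of the epigraph
          at which the linear form \<open>(q, -1)\<close> takes the value \<open>h q\<close>;
          comparing it with the projection evaluates the hypothesis at \<open>q\<close> as
          \<open>D * D \<le> d * D\<close>.\<close>
        define q where "q = n /\<^sub>R \<xi>"
        have nq: "n = \<xi> *\<^sub>R q" using l by (simp add: q_def)
        obtain v' where v': "\<And>p. h q + v' \<bullet> (p - q) \<le> h p" using convex_subgradient_exists[OF h] by blast
        have "\<xi> * (q \<bullet> (v' - v)) + (- \<xi>) * (v' \<bullet> q - h q - r) \<le> 0"
          using proj[OF conj_epi_subgradient[OF v']] nq by (simp add: n_def \<xi>_def)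
        then have "\<xi> * (h q + r - q \<bullet> v) \<le> 0" by (simp add: algebra_simps inner_diff_right inner_commute)
        then have "h q \<le> v \<bullet> q - r" using l by (simp add: mult_le_0_iff inner_commute)
        then have "n \<bullet> q + \<xi> \<le> w \<bullet> q - s - h q" by (simp add: n_def \<xi>_def inner_diff_left)
        also have "\<dots> \<le> d * norm (q, 1::real)" using A by blast
        also have "norm (q, 1::real) = D / \<xi>"
        proof -
          have "(n, \<xi>) = \<xi> *\<^sub>R (q, 1::real)" using nq by simp
          then have "D = \<xi> * norm (q, 1::real)" unfolding D_def using l by (metis abs_of_pos norm_scaleR)
          then show ?thesis using l by simp
        qed
        finally have "(n \<bullet> q + \<xi>) * \<xi> \<le> d * D" using l by (simp add: field_simps)
        moreover have "(n \<bullet> q + \<xi>) * \<xi> = D * D" unfolding D2 nq by (simp add: algebra_simps)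
        ultimately show False using Dd by simp
      next
        case True
        then have nD: "norm n = D" by (simp add: D_def norm_Pair)
        \<comment> \<open>Horizontal residual: no single momentum represents this normal, so the
          momenta \<open>\<tau> n\<close> are used. The left side grows linearly in
          \<open>\<tau>\<close> while the right side stays fixed.\<close>
        have bound: "\<tau> * (D * (D - d)) \<le> d + s + h 0" if "\<tau> > 0" for \<tau>
        proof -
          define q where "q = \<tau> *\<^sub>R n"
          obtain v' where v': "\<And>p. h q + v' \<bullet> (p - q) \<le> h p" using convex_subgradient_exists[OF h] by blast
          have "n \<bullet> (v' - v) \<le> 0"
            using proj[OF conj_epi_subgradient[OF v']] True by (simp add: n_def \<xi>_def)
          then have "\<tau> * (n \<bullet> v') \<le> \<tau> * (n \<bullet> v)" using that by (simp add: inner_diff_right)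
          then have "v' \<bullet> q \<le> v \<bullet> q" by (simp add: q_def inner_commute)
          then have "h q \<le> h 0 + v \<bullet> q" using v'[of 0] by simp
          then have "n \<bullet> q - s - h 0 \<le> w \<bullet> q - s - h q" by (simp add: n_def inner_diff_left)
          also have "\<dots> \<le> d * norm (q, 1::real)" using A by blast
          also have "\<dots> \<le> d * (\<tau> * D + 1)"
          proof (rule mult_left_mono[OF _ d])
            have "norm (q, 1::real) \<le> norm q + norm (1::real)" by (rule norm_Pair_le)
            then show "norm (q, 1::real) \<le> \<tau> * D + 1" using nD that by (simp add: q_def)
          qed
          finally have "n \<bullet> q - s - h 0 \<le> d * (\<tau> * D + 1)" .
          moreover have "n \<bullet> q = \<tau> * (D * D)" using D2 True by (simp add: q_def)
          ultimately show ?thesis by (simp add: algebra_simps)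
        qed
        define P where "P = D * (D - d)"
        have pos: "P > 0" using Dd by (simp add: P_def)
        define \<tau> where "\<tau> = (\<bar>d + s + h 0\<bar> + 1) / P"
        have "\<tau> > 0" using pos by (simp add: \<tau>_def)
        from bound[OF this, folded P_def] have "\<bar>d + s + h 0\<bar> + 1 \<le> d + s + h 0" using pos by (simp add: \<tau>_def)
        then show False by simp
      qed
    qed
  qed
qed

text \<open>Testing with \<open>p = \<tau> v\<close> makes the left side of the defining inequality
  at least \<open>\<tau> * norm v * (norm v - L) - h 0\<close>, which is unbounded in
  \<open>\<tau>\<close> if \<open>norm v > L\<close>. Thus Lipschitz continuity in \<open>p\<close>
  bounds the velocities.\<close>

lemma conj_epi_fst_bound:
  fixes h :: "'a::euclidean_space \<Rightarrow> real"
  assumes lip: "\<And>p. \<bar>h p - h 0\<bar> \<le> L * norm p" and vr: "(v, r) \<in> conj_epi h"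
  shows "norm v \<le> L"
proof (rule ccontr)
  assume "\<not> norm v \<le> L"
  then have L: "norm v > L" by simp
  have "L \<ge> 0" using order_trans[OF abs_ge_zero lip[of "SOME i. i \<in> Basis"]] norm_some_Basis[where 'a='a] by simp
  define P where "P = norm v * (norm v - L)"
  have pos: "P > 0" unfolding P_def using \<open>L \<ge> 0\<close> L by (intro mult_pos_pos) auto
  have bound: "\<tau> * P \<le> r + h 0" if "\<tau> > 0" for \<tau>
  proof -
    have "v \<bullet> (\<tau> *\<^sub>R v) - h (\<tau> *\<^sub>R v) \<le> r" using vr unfolding mem_conj_epi_iff by blast
    moreover have "h (\<tau> *\<^sub>R v) \<le> h 0 + L * (\<tau> * norm v)" using lip[of "\<tau> *\<^sub>R v"] that by (simp add: abs_le_iff)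
    ultimately show ?thesis by (simp add: P_def algebra_simps power2_norm_eq_inner[symmetric] power2_eq_square)
  qed
  define \<tau> where "\<tau> = (\<bar>r + h 0\<bar> + 1) / P"
  have "\<tau> > 0" using pos by (simp add: \<tau>_def)
  from bound[OF this] have "\<bar>r + h 0\<bar> + 1 \<le> r + h 0" using pos by (simp add: \<tau>_def)
  then show False by simp
qed

lemma conj_epi_snd_bound: "(v, r) \<in> conj_epi h \<Longrightarrow> - h 0 \<le> r"
  using mem_conj_epi_iff[of v r h] by (auto dest: spec[of _ 0])

lemma one_plus_norm_le_norm_Pair: "1 + norm q \<le> 2 * norm (q, 1::real)"
proof -
  have "norm q \<le> norm (q, 1::real)" "norm (1::real) \<le> norm (q, 1::real)"
    using norm_fst_le[of q "1::real"] norm_snd_le[of "1::real" q] by auto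
  then show ?thesis by simp
qed

text \<open>The growth \<open>1 + norm p\<close> of the modulus in (HLC) is comparable to the length
  of the normal \<open>(p, -1)\<close>, with factor 2, so large momenta cause no loss. This is the
  source of the Lipschitz dependence of the epigraph on \<open>x\<close> with constant
  \<open>2 k\<close>.\<close>

lemma infdist_conj_epi_le_lipschitz:
  fixes h h' :: "'a::euclidean_space \<Rightarrow> real"
  assumes h': "convex_on UNIV h'" and le: "\<And>p. h p - h' p \<le> \<kappa> * (1 + norm p)" and \<kappa>: "\<kappa> \<ge> 0"
    and a: "a \<in> conj_epi h"
  shows "infdist a (conj_epi h') \<le> 2 * \<kappa>"
proof -
  obtain w s where ws: "a = (w, s)" by (cases a)
  have "w \<bullet> q - s - h' q \<le> 2 * \<kappa> * norm (q, 1::real)" for q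
  proof -
    have "w \<bullet> q - s - h' q \<le> \<kappa> * (1 + norm q)" 
      using a[unfolded ws mem_conj_epi_iff, rule_format, of q] le[of q] by linarith
    also have "\<dots> \<le> \<kappa> * (2 * norm (q, 1::real))" using \<kappa> by (intro mult_left_mono one_plus_norm_le_norm_Pair)
    finally show ?thesis by simp
  qed
  then show ?thesis unfolding ws using \<kappa> by (subst infdist_conj_epi_le_iff[OF h']) auto
qed

text \<open>Closeness of \<open>h\<close> and \<open>h'\<close> is only required on a ball: by convexity the defect at a large momentum
  is controlled by the one at the rescaled momentum, at the price of a term linear in the cost \<open>s\<close>.\<close>

lemma infdist_conj_epi_le_local:
  fixes h h' :: "'a::euclidean_space \<Rightarrow> real"
  assumes h': "convex_on UNIV h'" and le: "\<And>p. norm p \<le> N \<Longrightarrow> h p - h' p \<le> \<delta>" and \<delta>: "\<delta> \<ge> 0"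
    and N: "N \<ge> 1" and a: "(w, s) \<in> conj_epi h"
  shows "infdist (w, s) (conj_epi h') \<le> \<delta> + (\<bar>s\<bar> + \<bar>h' 0\<bar>) / N"
proof -
  have base: "w \<bullet> q - s - h' q \<le> \<delta>" if "norm q \<le> N" for q
    using a[unfolded mem_conj_epi_iff, rule_format, of q] le[OF that] by linarith
  have "w \<bullet> q - s - h' q \<le> (\<delta> + (\<bar>s\<bar> + \<bar>h' 0\<bar>) / N) * norm (q, 1::real)" for q
  proof -
    have n1: "1 \<le> norm (q, 1::real)" "norm q \<le> norm (q, 1::real)"
      using norm_fst_le[of q "1::real"] norm_snd_le[of "1::real" q] by auto
    have c0: "0 \<le> (\<bar>s\<bar> + \<bar>h' 0\<bar>) / N" using N by simp
    show ?thesis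
    proof (cases "norm q \<le> N")
      case True
      have "w \<bullet> q - s - h' q \<le> \<delta> * 1" using base[OF True] by simp
      also have "\<dots> \<le> (\<delta> + (\<bar>s\<bar> + \<bar>h' 0\<bar>) / N) * norm (q, 1::real)" using \<delta> c0 n1 by (intro mult_mono) auto
      finally show ?thesis .
    next
      case False
      \<comment> \<open>The rescaled momentum \<open>\<theta> q\<close> lies on the sphere of radius
        \<open>N\<close>, where the hypothesis applies. Convexity compares \<open>h'\<close> there
        with its values at \<open>q\<close> and at 0; dividing by \<open>\<theta>\<close> turns the
        resulting error into a multiple of \<open>norm q / N\<close>.\<close>
      define \<theta> where "\<theta> = N / norm q"
      have "norm q > 0" using False N by linarith
      then have \<theta>: "0 < \<theta>" "\<theta> < 1" using False N by (simp_all add: \<theta>_def)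
      have "norm (\<theta> *\<^sub>R q) \<le> N" using False N by (simp add: \<theta>_def)
      then have 1: "\<theta> * (w \<bullet> q) - s - h' (\<theta> *\<^sub>R q) \<le> \<delta>" using base[of "\<theta> *\<^sub>R q"] by simp
      have 2: "h' (\<theta> *\<^sub>R q) \<le> \<theta> * h' q + (1 - \<theta>) * h' 0"
        using convex_onD[OF h', of "1-\<theta>" q 0] \<theta> by simp
      have "\<theta> * (w \<bullet> q - s - h' q) \<le> \<delta> + (1 - \<theta>) * (s + h' 0)"
        using 1 2 by (simp add: algebra_simps)
      also have "(1 - \<theta>) * (s + h' 0) \<le> 1 * (\<bar>s\<bar> + \<bar>h' 0\<bar>)"
      proof -
        have "(1 - \<theta>) * (s + h' 0) \<le> (1 - \<theta>) * (\<bar>s\<bar> + \<bar>h' 0\<bar>)" using \<theta> by (intro mult_left_mono) auto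
        also have "\<dots> \<le> 1 * (\<bar>s\<bar> + \<bar>h' 0\<bar>)" using \<theta> by (intro mult_right_mono) auto
        finally show ?thesis .
      qed
      finally have "w \<bullet> q - s - h' q \<le> (\<delta> + (\<bar>s\<bar> + \<bar>h' 0\<bar>)) / \<theta>"
        using \<theta> by (simp add: field_simps)
      also have "\<dots> = (\<delta> / N + (\<bar>s\<bar> + \<bar>h' 0\<bar>) / N) * norm q"
        unfolding add_divide_distrib[symmetric] by (simp add: \<theta>_def)
      also have "\<dots> \<le> (\<delta> + (\<bar>s\<bar> + \<bar>h' 0\<bar>) / N) * norm (q, 1::real)"
        using \<delta> c0 n1 N by (intro mult_mono add_right_mono) (auto simp: divide_le_eq mult_le_cancel_left1)
      finally show ?thesis .
    qed
  qed
  then show ?thesis using \<delta> N by (subst infdist_conj_epi_le_iff[OF h']) auto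
qed

section \<open>Measurability of projections\<close>

text \<open>The squared distance has gradient \<open>2 (a - closest_point S a)\<close>, here with an
  explicit quadratic remainder. The upper bound tests \<open>a + z\<close> with the projection of
  \<open>a\<close>; the lower one tests \<open>a\<close> with the projection of \<open>a + z\<close>
  and uses that the projection is nonexpansive.\<close>

lemma infdist_square_gradient:
  fixes a z :: "'a::euclidean_space"
  assumes S: "closed S" "convex S" "S \<noteq> {}"
  shows "\<bar>(infdist (a + z) S)\<^sup>2 - (infdist a S)\<^sup>2 - 2 * (z \<bullet> (a - closest_point S a))\<bar> \<le> (norm z)\<^sup>2"
proof -
  let ?\<pi> = "closest_point S"
  have d: "infdist y S = norm (y - ?\<pi> y)" for y using infdist_closest_point[OF S(1,3)] by (simp add: dist_norm)
  have sq: "(infdist y S)\<^sup>2 = (y - ?\<pi> y) \<bullet> (y - ?\<pi> y)" for y by (simp add: d power2_norm_eq_inner)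
  have le: "(infdist y S)\<^sup>2 \<le> (y - p) \<bullet> (y - p)" if "p \<in> S" for y p
  proof -
    have "infdist y S \<le> norm (y - p)" using infdist_le[OF that] by (simp add: dist_norm)
    then show ?thesis by (metis infdist_nonneg power2_norm_eq_inner power_mono)
  qed
  have in_S: "?\<pi> y \<in> S" for y by (rule closest_point_in_set[OF S(1,3)])
  have up: "(infdist (a + z) S)\<^sup>2 \<le> (infdist a S)\<^sup>2 + 2 * (z \<bullet> (a - ?\<pi> a)) + z \<bullet> z"
    using le[OF in_S[of a], of "a + z"] by (simp add: sq inner_commute algebra_simps)
  have "(infdist a S)\<^sup>2 \<le> (infdist (a + z) S)\<^sup>2 - 2 * (z \<bullet> (a + z - ?\<pi> (a + z))) + z \<bullet> z"
    using le[OF in_S[of "a + z"], of a] by (simp add: sq inner_commute algebra_simps)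
  moreover have "z \<bullet> (?\<pi> (a + z) - ?\<pi> a) \<le> z \<bullet> z"
  proof -
    have "z \<bullet> (?\<pi> (a + z) - ?\<pi> a) \<le> norm z * norm (?\<pi> (a + z) - ?\<pi> a)" by (rule norm_cauchy_schwarz)
    also have "\<dots> \<le> norm z * norm z"
      using closest_point_lipschitz[OF S(2,1,3), of "a + z" a] by (intro mult_left_mono) (auto simp: dist_norm)
    finally show ?thesis by (simp add: power2_norm_eq_inner[symmetric] power2_eq_square)
  qed
  ultimately have "(infdist a S)\<^sup>2 + 2 * (z \<bullet> (a - ?\<pi> a)) - z \<bullet> z \<le> (infdist (a + z) S)\<^sup>2"
    by (simp add: algebra_simps)
  with up show ?thesis by (simp add: abs_le_iff power2_norm_eq_inner)
qed

text \<open>The projection is a pointwise limit of difference quotients of the squared distance function.\<close>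

lemma borel_measurable_closest_point:
  fixes a :: "'b \<Rightarrow> 'a::euclidean_space"
  assumes S: "\<And>t. t \<in> space M \<Longrightarrow> closed (S t)" "\<And>t. t \<in> space M \<Longrightarrow> convex (S t)" "\<And>t. t \<in> space M \<Longrightarrow> S t \<noteq> {}"
    and a: "a \<in> borel_measurable M" and m: "\<And>z. (\<lambda>t. infdist (a t + z) (S t)) \<in> borel_measurable M"
  shows "(\<lambda>t. closest_point (S t) (a t)) \<in> borel_measurable M"
proof (subst borel_measurable_euclidean_space, intro ballI)
  fix i :: 'a assume i: "i \<in> Basis"
  define e :: "nat \<Rightarrow> real" where "e n = 1 / (real n + 1)" for n
  have e: "e n > 0" for n by (simp add: e_def)
  have e0: "e \<longlonglongrightarrow> 0" unfolding e_def by real_asymp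
  have "(\<lambda>t. ((infdist (a t + e n *\<^sub>R i) (S t))\<^sup>2 - (infdist (a t + 0) (S t))\<^sup>2) / e n) \<in> borel_measurable M" for n
    by (intro borel_measurable_divide borel_measurable_diff borel_measurable_power m borel_measurable_const)
  then have "(\<lambda>t. 2 * (i \<bullet> (a t - closest_point (S t) (a t)))) \<in> borel_measurable M"
  proof (rule borel_measurable_LIMSEQ_real[rotated])
    fix t assume t: "t \<in> space M"
    let ?q = "\<lambda>n. ((infdist (a t + e n *\<^sub>R i) (S t))\<^sup>2 - (infdist (a t + 0) (S t))\<^sup>2) / e n"
    let ?l = "2 * (i \<bullet> (a t - closest_point (S t) (a t)))"
    have bd: "\<bar>?q n - ?l\<bar> \<le> e n" for n
    proof -
      have "\<bar>(infdist (a t + e n *\<^sub>R i) (S t))\<^sup>2 - (infdist (a t) (S t))\<^sup>2 - e n * ?l\<bar> \<le> e n * e n"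
        using infdist_square_gradient[OF S[OF t], of "a t" "e n *\<^sub>R i"] e[of n] i
        by (simp add: power2_eq_square algebra_simps)
      moreover have "?q n - ?l = ((infdist (a t + e n *\<^sub>R i) (S t))\<^sup>2 - (infdist (a t) (S t))\<^sup>2 - e n * ?l) / e n"
        using e[of n] by (simp add: diff_divide_distrib)
      ultimately show ?thesis using e[of n] by (simp add: abs_divide divide_le_eq)
    qed
    have "(\<lambda>n. ?q n - ?l) \<longlonglongrightarrow> 0"
      by (rule Lim_null_comparison[OF always_eventually e0]) (use bd in simp)
    then show "?q \<longlonglongrightarrow> ?l" by (simp add: LIM_zero_iff)
  qed
  then have "(\<lambda>t. a t \<bullet> i - (2 * (i \<bullet> (a t - closest_point (S t) (a t)))) / 2) \<in> borel_measurable M"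
    using a by measurable
  then show "(\<lambda>t. closest_point (S t) (a t) \<bullet> i) \<in> borel_measurable M"
    by (simp add: inner_diff_right inner_commute diff_divide_distrib)
qed

text \<open>\<open>infdist_conj_epi_le_iff\<close> writes each sublevel set as an intersection over
  all momenta \<open>q\<close>. Continuity in \<open>q\<close> reduces it to a countable dense set,
  so no measurable selection theorem is involved.\<close>

lemma borel_measurable_infdist_conj_epi:
  fixes h :: "'b \<Rightarrow> 'a::euclidean_space \<Rightarrow> real"
  assumes cv: "\<And>t. t \<in> space M \<Longrightarrow> convex_on UNIV (h t)" and ct: "\<And>t. t \<in> space M \<Longrightarrow> continuous_on UNIV (h t)"
    and m: "\<And>q. (\<lambda>t. h t q) \<in> borel_measurable M" and a[measurable]: "a \<in> borel_measurable M"
  shows "(\<lambda>t. infdist (a t) (conj_epi (h t))) \<in> borel_measurable M"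
proof (subst borel_measurable_iff_le, intro allI)
  fix d :: real
  obtain Q :: "'a set" where Q: "countable Q" "\<And>X. open X \<Longrightarrow> X \<noteq> {} \<Longrightarrow> \<exists>b\<in>Q. b \<in> X"
    using countable_dense_setE by metis
  have dense: "closure Q = UNIV"
  proof (rule ccontr)
    assume "closure Q \<noteq> UNIV"
    then obtain b where "b \<in> Q" "b \<in> - closure Q" using Q(2)[of "- closure Q"] by auto
    then show False using closure_subset by auto
  qed
  show "{t \<in> space M. infdist (a t) (conj_epi (h t)) \<le> d} \<in> sets M"
  proof (cases "d \<ge> 0")
    case True
    have "{t \<in> space M. infdist (a t) (conj_epi (h t)) \<le> d}
        = {t \<in> space M. \<forall>q\<in>Q. fst (a t) \<bullet> q - snd (a t) - h t q \<le> d * norm (q, 1::real)}"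
    proof (intro Collect_cong conj_cong refl)
      fix t assume t: "t \<in> space M"
      let ?C = "{q. fst (a t) \<bullet> q - snd (a t) - h t q \<le> d * norm (q, 1::real)}"
      have "closed ?C" by (intro closed_Collect_le continuous_intros ct[OF t])
      then have "Q \<subseteq> ?C \<Longrightarrow> ?C = UNIV" using closure_minimal[of Q ?C] dense by auto
      then have "(\<forall>q\<in>Q. fst (a t) \<bullet> q - snd (a t) - h t q \<le> d * norm (q, 1::real)) \<longleftrightarrow>
         (\<forall>q. fst (a t) \<bullet> q - snd (a t) - h t q \<le> d * norm (q, 1::real))" by blast
      then show "infdist (a t) (conj_epi (h t)) \<le> d \<longleftrightarrow>
        (\<forall>q\<in>Q. fst (a t) \<bullet> q - snd (a t) - h t q \<le> d * norm (q, 1::real))"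
        using infdist_conj_epi_le_iff[OF cv[OF t] True, of "fst (a t)" "snd (a t)"] by simp
    qed
    also have "\<dots> \<in> sets M"
    proof (rule sets.sets_Collect_countable_All'[OF _ Q(1)])
      fix q
      have [measurable]: "(\<lambda>t. h t q) \<in> borel_measurable M" by (rule m)
      have [measurable]: "(\<lambda>t. fst (a t)) \<in> borel_measurable M" "(\<lambda>t. snd (a t)) \<in> borel_measurable M"
        using a by (auto simp: borel_prod[symmetric])
      show "{t \<in> space M. fst (a t) \<bullet> q - snd (a t) - h t q \<le> d * norm (q, 1::real)} \<in> sets M"
        by measurable
    qed
    finally show ?thesis .
  next
    case False
    then have "{t \<in> space M. infdist (a t) (conj_epi (h t)) \<le> d} = {}"
      using infdist_nonneg by (metis (no_types, lifting) Collect_empty_eq order_trans)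
    then show ?thesis by (simp only: sets.empty_sets)
  qed
qed

text \<open>For a simple function in place of \<open>x\<close> the composition is patched together
  from finitely many measurable sections; continuity in the second argument then carries
  measurability to the limit.\<close>

lemma borel_measurable_caratheodory_compose:
  fixes G :: "'b \<Rightarrow> 'a::{metric_space,second_countable_topology} \<Rightarrow> real"
  assumes m: "\<And>y. (\<lambda>t. G t y) \<in> borel_measurable M" and ct: "\<And>t. t \<in> space M \<Longrightarrow> continuous_on UNIV (G t)"
    and x: "x \<in> borel_measurable M"
  shows "(\<lambda>t. G t (x t)) \<in> borel_measurable M"
proof -
  obtain F where F: "\<And>i. simple_function M (F i)" "\<And>t. t \<in> space M \<Longrightarrow> (\<lambda>i. F i t) \<longlonglongrightarrow> x t"
    using borel_measurable_implies_sequence_metric[OF x, of undefined] by blast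
  show ?thesis
  proof (rule borel_measurable_LIMSEQ_real)
    fix t assume t: "t \<in> space M"
    show "(\<lambda>i. G t (F i t)) \<longlonglongrightarrow> G t (x t)"
      using continuous_on_tendsto_compose[OF ct[OF t] F(2)[OF t]] by simp
  next
    fix i
    have fin: "finite (F i ` space M)" using F(1) by (rule simple_functionD)
    show "(\<lambda>t. G t (F i t)) \<in> borel_measurable M"
    proof (rule measurable_compose_countable'[where I="F i ` space M"])
      show "F i \<in> measurable M (count_space (F i ` space M))"
        unfolding measurable_count_space_eq2[OF fin] using F(1)[of i] by (auto dest: simple_functionD)
    qed (use m fin in \<open>auto intro: countable_finite\<close>)
  qed
qed

section \<open>Trajectories and Filippov approximation\<close>

lemma absint_imp_int: "f absolutely_integrable_on S \<Longrightarrow> f integrable_on S"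
  for f :: "real \<Rightarrow> 'a::euclidean_space"
  by (rule set_lebesgue_integral_eq_integral(1))

lemma absint_measurable:
  fixes f :: "real \<Rightarrow> 'a::euclidean_space"
  assumes "f absolutely_integrable_on {a..b}"
  shows "f \<in> borel_measurable (lebesgue_on {a..b})"
  by (rule integrable_imp_measurable[OF absint_imp_int[OF assms]])

lemma absint_subinterval:
  fixes f :: "real \<Rightarrow> 'a::euclidean_space"
  assumes "f absolutely_integrable_on {a..b}" "{s..t} \<subseteq> {a..b}"
  shows "f absolutely_integrable_on {s..t}"
  using assms by (intro set_integrable_subset[OF assms(1)]) auto

lemma absint_times_continuous:
  fixes c f :: "real \<Rightarrow> real"
  assumes c: "c absolutely_integrable_on {a..b}" and f: "continuous_on {a..b} f"
  shows "(\<lambda>s. c s * f s) absolutely_integrable_on {a..b}"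
proof -
  have "(\<lambda>s. f s * c s) absolutely_integrable_on {a..b}"
    by (intro absolutely_integrable_bounded_measurable_product_real c
        continuous_imp_measurable_on_sets_lebesgue[OF f] compact_imp_bounded[OF compact_continuous_image[OF f]]) auto
  then show ?thesis by (simp add: mult.commute)
qed

lemma integral_subinterval_le:
  fixes f :: "real \<Rightarrow> real"
  assumes f: "f integrable_on {a..b}" "\<And>t. t \<in> {a..b} \<Longrightarrow> 0 \<le> f t" and st: "{s..t} \<subseteq> {a..b}"
  shows "integral {s..t} f \<le> integral {a..b} f" "0 \<le> integral {s..t} f"
proof -
  have i: "f integrable_on {s..t}" by (rule integrable_subinterval_real[OF f(1) st])
  show "integral {s..t} f \<le> integral {a..b} f"
    using f st by (intro integral_subset_le i) auto
  show "0 \<le> integral {s..t} f"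
    using f(2) st by (intro Henstock_Kurzweil_Integration.integral_nonneg i) auto
qed

lemma integral_le_exp_weight:
  fixes c f :: "real \<Rightarrow> real"
  assumes c: "c absolutely_integrable_on {0..T}" "\<And>t. t \<in> {0..T} \<Longrightarrow> 0 \<le> c t"
    and st: "0 \<le> s" "s \<le> t" "t \<le> T" and M: "M \<ge> 0" and f: "f integrable_on {s..t}"
    and le: "\<And>r. r \<in> {s..t} \<Longrightarrow> f r \<le> c r * (M * exp (2 * integral {0..r} c))"
  shows "integral {s..t} f \<le> M * exp (2 * integral {0..t} c) / 2"
proof -
  have h: "((\<lambda>r. M * (c r * exp (2 * integral {0..r} c))) has_integral
       M * ((exp (2 * integral {0..t} c) - exp (2 * integral {0..s} c)) / 2)) {s..t}"
    by (rule has_integral_mult_right[OF exp_weight_has_integral[OF c st]])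
  have "integral {s..t} f \<le> M * ((exp (2 * integral {0..t} c) - exp (2 * integral {0..s} c)) / 2)"
    by (rule has_integral_le[OF integrable_integral[OF f] h]) (use le in \<open>simp add: mult_ac\<close>)
  also have "\<dots> \<le> M * (exp (2 * integral {0..t} c) / 2)" using M by (intro mult_left_mono) auto
  finally show ?thesis by simp
qed

text \<open>Take the maximum of \<open>1 + norm (x t)\<close> divided by the exponential weight. At
  the maximum point the integral term is at most half of the left side and is absorbed. The exponent
  is not sharp; its form is chosen because the Filippov iteration below preserves exactly this
  bound.\<close>

lemma gronwall_bound:
  fixes c :: "real \<Rightarrow> real" and x :: "real \<Rightarrow> 'a::real_normed_vector"
  assumes c: "c absolutely_integrable_on {0..T}" "\<And>t. t \<in> {0..T} \<Longrightarrow> 0 \<le> c t"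
    and t0: "0 \<le> t0" "t0 \<le> T" and x: "continuous_on {t0..T} x" and \<rho>: "\<rho> \<ge> 0"
    and le: "\<And>t. t \<in> {t0..T} \<Longrightarrow> norm (x t) \<le> \<rho> + integral {t0..t} (\<lambda>s. c s * (1 + norm (x s)))"
    and t: "t \<in> {t0..T}"
  shows "1 + norm (x t) \<le> 2 * (1 + \<rho>) * exp (2 * integral {0..t} c)"
proof -
  define C where "C t = integral {0..t} c" for t
  have Cc: "continuous_on {0..T} C" unfolding C_def
    by (rule indefinite_integral_continuous_1[OF absint_imp_int[OF c(1)]])
  define y where "y t = (1 + norm (x t)) * exp (- 2 * C t)" for t
  have yc: "continuous_on {t0..T} y" unfolding y_def
    by (intro continuous_intros x continuous_on_subset[OF Cc]) (use t0 in auto)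
  obtain t1 where t1: "t1 \<in> {t0..T}" "\<And>s. s \<in> {t0..T} \<Longrightarrow> y s \<le> y t1"
    using continuous_attains_sup[OF compact_Icc _ yc] t0 by auto
  have xy: "1 + norm (x s) = y s * exp (2 * C s)" for s
    unfolding y_def by (simp add: mult.assoc exp_add[symmetric])
  have y0: "y t1 \<ge> 0" unfolding y_def by simp
  have "integral {t0..t1} (\<lambda>s. c s * (1 + norm (x s))) \<le> y t1 * exp (2 * C t1) / 2"
    unfolding C_def
  proof (rule integral_le_exp_weight[OF c t0(1) _ _ y0])
    show "(\<lambda>s. c s * (1 + norm (x s))) integrable_on {t0..t1}"
      by (intro absint_imp_int absint_times_continuous absint_subinterval[OF c(1)] continuous_intros
          continuous_on_subset[OF x]) (use t1 t0 in auto)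
    fix r assume r: "r \<in> {t0..t1}"
    have "y r * exp (2 * C r) \<le> y t1 * exp (2 * C r)" using t1 r by (intro mult_right_mono) auto
    then show "c r * (1 + norm (x r)) \<le> c r * (y t1 * exp (2 * integral {0..r} c))"
      using c(2)[of r] r t0 t1 by (intro mult_left_mono) (auto simp: xy C_def)
  qed (use t1 in auto)
  then have "y t1 * exp (2 * C t1) \<le> 1 + \<rho> + y t1 * exp (2 * C t1) / 2"
    using le[OF t1(1)] xy[of t1] by linarith
  then have a: "y t1 * exp (2 * C t1) \<le> 2 * (1 + \<rho>)" by simp
  have "C t1 \<ge> 0" unfolding C_def using t1 t0 by (intro integral_subinterval_le(2)[OF absint_imp_int[OF c(1)] c(2)]) auto
  then have "y t1 * 1 \<le> y t1 * exp (2 * C t1)" using y0 by (intro mult_left_mono) auto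
  with a t1(2)[OF t] have "y t \<le> 2 * (1 + \<rho>)" by linarith
  then have "y t * exp (2 * C t) \<le> 2 * (1 + \<rho>) * exp (2 * C t)" by (rule mult_right_mono) simp
  then show ?thesis unfolding xy C_def .
qed

text \<open>A control is a pair (velocity, cost rate). Recovering the state by integrating the
  velocity leaves only an inclusion for the control to be solved by iteration.\<close>

definition traj :: "real \<Rightarrow> 'a::euclidean_space \<Rightarrow> (real \<Rightarrow> 'a \<times> real) \<Rightarrow> real \<Rightarrow> 'a" where
  "traj t0 x0 a t = x0 + integral {t0..t} (\<lambda>s. fst (a s))"

lemma absint_fst_snd:
  fixes a :: "real \<Rightarrow> 'a::euclidean_space \<times> real"
  assumes "a absolutely_integrable_on S"
  shows "(\<lambda>s. fst (a s)) absolutely_integrable_on S" "(\<lambda>s. snd (a s)) absolutely_integrable_on S"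
  using absolutely_integrable_linear[OF assms bounded_linear_fst] absolutely_integrable_linear[OF assms bounded_linear_snd]
  by (simp_all add: o_def)

lemma continuous_on_traj:
  assumes "a absolutely_integrable_on {t0..T}" shows "continuous_on {t0..T} (traj t0 x0 a)"
  unfolding traj_def
  by (intro continuous_intros indefinite_integral_continuous_1 absint_imp_int absint_fst_snd assms)

lemma norm_traj_diff_le:
  assumes a: "a absolutely_integrable_on {t0..T}" and b: "b absolutely_integrable_on {t0..T}"
    and t: "t \<in> {t0..T}"
  shows "norm (traj t0 x0 a t - traj t0 x0 b t) \<le> integral {t0..t} (\<lambda>s. norm (a s - b s))"
proof -
  have sub: "{t0..t} \<subseteq> {t0..T}" using t by auto
  note a' = absint_subinterval[OF a sub] and b' = absint_subinterval[OF b sub]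
  note ai = absint_imp_int[OF absint_fst_snd(1)[OF a']] and bi = absint_imp_int[OF absint_fst_snd(1)[OF b']]
  have "traj t0 x0 a t - traj t0 x0 b t = integral {t0..t} (\<lambda>s. fst (a s) - fst (b s))"
    unfolding traj_def using ai bi by (simp add: integral_diff)
  also have "norm \<dots> \<le> integral {t0..t} (\<lambda>s. norm (a s - b s))"
  proof (rule integral_norm_bound_integral)
    show "(\<lambda>s. fst (a s) - fst (b s)) integrable_on {t0..t}" using ai bi by (rule integrable_diff)
    show "(\<lambda>s. norm (a s - b s)) integrable_on {t0..t}"
      by (intro absint_imp_int set_integrable_norm set_integral_diff(1) a' b')
    show "norm (fst (a s) - fst (b s)) \<le> norm (a s - b s)" for s
      by (metis fst_diff norm_fst_le prod.collapse)
  qed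
  finally show ?thesis .
qed

section \<open>Bounds shared by all Hamiltonians and the associated differential inclusions\<close>

locale control_bounds =
  fixes T :: real and c :: "real \<Rightarrow> real" and k :: "real \<Rightarrow> real \<Rightarrow> real" and \<mu> :: "real \<Rightarrow> real"
  assumes c_int: "c absolutely_integrable_on {0..T}" and c_nonneg: "\<And>t. t \<in> {0..T} \<Longrightarrow> 0 \<le> c t"
    and k_int: "\<And>R. R > 0 \<Longrightarrow> k R absolutely_integrable_on {0..T}"
    and k_nonneg: "\<And>R t. R > 0 \<Longrightarrow> t \<in> {0..T} \<Longrightarrow> 0 \<le> k R t"
    and \<mu>_int: "\<mu> absolutely_integrable_on {0..T}" and \<mu>_nonneg: "\<And>t. t \<in> {0..T} \<Longrightarrow> 0 \<le> \<mu> t"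
begin

definition hamil :: "'n::finite hamiltonian \<Rightarrow> bool" where
  "hamil H \<longleftrightarrow> hamiltonian_hyps T c k H \<and> (\<forall>t\<in>{0..T}. \<bar>H t 0 0\<bar> \<le> \<mu> t)"

text \<open>\<open>rad\<close> bounds all trajectories starting in the ball of radius \<open>\<rho>\<close> (Gronwall with \<open>c\<close>), \<open>bnd\<close> bounds
  the distance from \<open>0\<close> to the epigraphs and the minimal running cost, \<open>lip\<close> is a Lipschitz constant of
  \<open>x \<mapsto> epi_conj H t x\<close>, and \<open>gain\<close> is the amplification factor in Filippov's estimate.\<close>

definition rad :: "real \<Rightarrow> real" where "rad \<rho> = 2 * (1 + \<rho>) * exp (2 * integral {0..T} c)"

definition bnd :: "real \<Rightarrow> real \<Rightarrow> real" where "bnd R t = \<mu> t + k R t * R + c t * (1 + R)"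

definition lip :: "real \<Rightarrow> real \<Rightarrow> real" where "lip R t = 2 * k R t"

definition gain :: "real \<Rightarrow> real" where
  "gain R = 1 + 2 * integral {0..T} (lip R) * exp (2 * integral {0..T} (lip R))"

text \<open>The inclusion is required at every \<open>t\<close>, not just almost everywhere: limits
  of projections and Steiner selections satisfy it pointwise, so no exceptional sets have to be
  carried along.\<close>

definition admissible :: "'n::finite hamiltonian \<Rightarrow> real \<Rightarrow> real^'n \<Rightarrow> (real \<Rightarrow> (real^'n) \<times> real) \<Rightarrow> bool" where
  "admissible H t0 x0 a \<longleftrightarrow> a absolutely_integrable_on {t0..T} \<and>
     (\<forall>t\<in>{t0..T}. a t \<in> epi_conj H t (traj t0 x0 a t))"

lemma bnd_int: "R > 0 \<Longrightarrow> bnd R absolutely_integrable_on {0..T}"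
  unfolding bnd_def[abs_def]
  by (intro set_integral_add(1) set_integrable_mult_left \<mu>_int k_int c_int)

lemma bnd_nonneg: "R > 0 \<Longrightarrow> t \<in> {0..T} \<Longrightarrow> 0 \<le> bnd R t"
  unfolding bnd_def using c_nonneg k_nonneg \<mu>_nonneg by (intro add_nonneg_nonneg mult_nonneg_nonneg) auto

lemma lip_int: "R > 0 \<Longrightarrow> lip R absolutely_integrable_on {0..T}"
  unfolding lip_def[abs_def] by (intro set_integrable_mult_right k_int)

lemma lip_nonneg: "R > 0 \<Longrightarrow> t \<in> {0..T} \<Longrightarrow> 0 \<le> lip R t"
  unfolding lip_def using k_nonneg by simp

lemma rad_pos: "\<rho> \<ge> 0 \<Longrightarrow> rad \<rho> > 0" unfolding rad_def by simp

lemma gain_ge_1: "R > 0 \<Longrightarrow> T \<ge> 0 \<Longrightarrow> gain R \<ge> 1"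
  unfolding gain_def
  using integral_subinterval_le(2)[OF absint_imp_int[OF lip_int] lip_nonneg, of R 0 T] by simp

lemma weight_le_rad:
  assumes "\<rho> \<ge> 0" "t \<in> {0..T}" "1 + r \<le> 2 * (1 + \<rho>) * exp (2 * integral {0..t} c)"
  shows "r \<le> rad \<rho>"
proof -
  have "integral {0..t} c \<le> integral {0..T} c"
    using assms(2) by (intro integral_subinterval_le(1)[OF absint_imp_int[OF c_int] c_nonneg]) auto
  then have "2 * (1 + \<rho>) * exp (2 * integral {0..t} c) \<le> rad \<rho>"
    unfolding rad_def using assms(1) by (intro mult_left_mono) auto
  then show "r \<le> rad \<rho>" using assms(3) by linarith
qed

context
  fixes H :: "'n::finite hamiltonian"
  assumes H: "hamil H"
begin

lemma H_meas: "(\<lambda>t. H t x p) \<in> borel_measurable (lebesgue_on {0..T})"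
  using H unfolding hamil_def hamiltonian_hyps_def by blast

lemma H_cont: "t \<in> {0..T} \<Longrightarrow> continuous_on UNIV (\<lambda>(x,p). H t x p)"
  using H unfolding hamil_def hamiltonian_hyps_def by blast

lemma H_convex: "t \<in> {0..T} \<Longrightarrow> convex_on UNIV (H t x)"
  using H unfolding hamil_def hamiltonian_hyps_def by blast

lemma H_lip_p: "t \<in> {0..T} \<Longrightarrow> \<bar>H t x p - H t x q\<bar> \<le> c t * (1 + norm x) * norm (p - q)"
  using H unfolding hamil_def hamiltonian_hyps_def by blast

lemma H_lip_x: "t \<in> {0..T} \<Longrightarrow> R > 0 \<Longrightarrow> norm x \<le> R \<Longrightarrow> norm y \<le> R \<Longrightarrow>
    \<bar>H t x p - H t y p\<bar> \<le> k R t * (1 + norm p) * norm (x - y)"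
  using H unfolding hamil_def hamiltonian_hyps_def by (simp add: mem_cball)

lemma H_cont_x: "t \<in> {0..T} \<Longrightarrow> continuous_on UNIV (\<lambda>x. H t x p)"
  using continuous_on_compose2[OF H_cont continuous_on_Pair[OF continuous_on_id continuous_on_const] subset_UNIV] by simp

lemma H_cont_p: "t \<in> {0..T} \<Longrightarrow> continuous_on UNIV (H t x)"
  using continuous_on_compose2[OF H_cont continuous_on_Pair[OF continuous_on_const continuous_on_id] subset_UNIV] by simp

lemma H_bound:
  assumes t: "t \<in> {0..T}" and R: "R > 0" and x: "norm x \<le> R"
  shows "\<bar>H t x p\<bar> \<le> \<mu> t + k R t * R + c t * (1 + R) * norm p"
proof -
  have "\<bar>H t x p - H t x 0\<bar> \<le> c t * (1 + norm x) * norm p" using H_lip_p[OF t, of x p 0] by simp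
  also have "\<dots> \<le> c t * (1 + R) * norm p" using x c_nonneg[OF t] R by (intro mult_mono mult_nonneg_nonneg) auto
  finally have 1: "\<bar>H t x p - H t x 0\<bar> \<le> c t * (1 + R) * norm p" .
  have "\<bar>H t x 0 - H t 0 0\<bar> \<le> k R t * norm x" using H_lip_x[OF t R x, of 0 0] R by simp
  also have "\<dots> \<le> k R t * R" using x k_nonneg[OF R t] by (intro mult_left_mono) auto
  finally have 2: "\<bar>H t x 0 - H t 0 0\<bar> \<le> k R t * R" .
  have "\<bar>H t 0 0\<bar> \<le> \<mu> t" using H t unfolding hamil_def by blast
  with 1 2 show ?thesis by linarith
qed

lemma H_bound_0: "t \<in> {0..T} \<Longrightarrow> R > 0 \<Longrightarrow> norm x \<le> R \<Longrightarrow> \<bar>H t x 0\<bar> \<le> bnd R t"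
  using H_bound[of t R x 0] c_nonneg[of t] by (simp add: bnd_def add_increasing2)

lemma epi_conj_basic:
  assumes "t \<in> {0..T}"
  shows "closed (epi_conj H t x)" "convex (epi_conj H t x)" "epi_conj H t x \<noteq> {}"
  using closed_conj_epi convex_conj_epi conj_epi_nonempty[OF H_convex[OF assms]] by (auto simp: epi_conj_eq)

lemma epi_conj_fst_bound:
  assumes t: "t \<in> {0..T}" and a: "a \<in> epi_conj H t x"
  shows "norm (fst a) \<le> c t * (1 + norm x)"
  using conj_epi_fst_bound[of "H t x" "c t * (1 + norm x)" "fst a" "snd a"] H_lip_p[OF t, of x _ 0] a
  by (simp add: epi_conj_eq)

lemma epi_conj_snd_bound:
  assumes t: "t \<in> {0..T}" and R: "R > 0" "norm x \<le> R" and a: "a \<in> epi_conj H t x"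
  shows "- bnd R t \<le> snd a"
  using conj_epi_snd_bound[of "fst a" "snd a" "H t x"] H_bound_0[OF t R] a by (simp add: epi_conj_eq)

text \<open>By \<open>infdist_conj_epi_le_iff\<close> this amounts to the linear growth of
  \<open>- H t x q\<close> in \<open>q\<close>. The result is an integrable bound on the defect of
  the zero control, and through the triangle inequality on the defect of any control.\<close>

lemma infdist_0_epi_conj_le:
  assumes t: "t \<in> {0..T}" and R: "R > 0" "norm x \<le> R"
  shows "infdist 0 (epi_conj H t x) \<le> bnd R t"
proof -
  have "0 \<bullet> q - 0 - H t x q \<le> bnd R t * norm (q, 1::real)" for q
  proof -
    have n1: "1 \<le> norm (q, 1::real)" "norm q \<le> norm (q, 1::real)"
      using norm_fst_le[of q "1::real"] norm_snd_le[of "1::real" q] by auto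
    have "- H t x q \<le> (\<mu> t + k R t * R) * 1 + c t * (1 + R) * norm q" using H_bound[OF t R, of q] by simp
    also have "\<dots> \<le> (\<mu> t + k R t * R) * norm (q, 1::real) + c t * (1 + R) * norm (q, 1::real)"
      using n1 \<mu>_nonneg[OF t] k_nonneg[OF R(1) t] c_nonneg[OF t] R by (intro add_mono mult_left_mono) auto
    finally show ?thesis by (simp add: bnd_def algebra_simps)
  qed
  then show ?thesis
    using infdist_conj_epi_le_iff[OF H_convex[OF t] bnd_nonneg[OF R(1) t], of 0 0 x]
    by (simp add: epi_conj_eq zero_prod_def)
qed

lemma infdist_epi_conj_lip:
  assumes t: "t \<in> {0..T}" and R: "R > 0" "norm x \<le> R" "norm y \<le> R" and a: "a \<in> epi_conj H t x"
  shows "infdist a (epi_conj H t y) \<le> lip R t * norm (y - x)"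
proof -
  have "infdist a (conj_epi (H t y)) \<le> 2 * (k R t * norm (y - x))"
  proof (rule infdist_conj_epi_le_lipschitz[OF H_convex[OF t]])
    show "H t x p - H t y p \<le> k R t * norm (y - x) * (1 + norm p)" for p
      using H_lip_x[OF t R, of p] by (simp add: norm_minus_commute mult_ac)
  qed (use k_nonneg[OF R(1) t] a in \<open>auto simp: epi_conj_eq\<close>)
  then show ?thesis by (simp add: epi_conj_eq lip_def)
qed

lemma measurable_infdist_epi_conj:
  assumes t0: "0 \<le> t0" and x: "continuous_on {t0..T} x" and a: "a \<in> borel_measurable (lebesgue_on {t0..T})"
  shows "(\<lambda>t. infdist (a t) (epi_conj H t (x t))) \<in> borel_measurable (lebesgue_on {t0..T})"
  unfolding epi_conj_eq
proof (rule borel_measurable_infdist_conj_epi[OF _ _ _ a])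
  fix t assume "t \<in> space (lebesgue_on {t0..T})"
  then have t: "t \<in> {0..T}" using t0 by auto
  show "convex_on UNIV (H t (x t))" by (rule H_convex[OF t])
  show "continuous_on UNIV (H t (x t))" by (rule H_cont_p[OF t])
next
  fix q
  show "(\<lambda>t. H t (x t) q) \<in> borel_measurable (lebesgue_on {t0..T})"
  proof (rule borel_measurable_caratheodory_compose[where G="\<lambda>t y. H t y q"])
    show "(\<lambda>t. H t y q) \<in> borel_measurable (lebesgue_on {t0..T})" for y
      by (rule measurable_restrict_mono[OF H_meas]) (use t0 in auto)
    show "continuous_on UNIV (\<lambda>y. H t y q)" if "t \<in> space (lebesgue_on {t0..T})" for t
      using that t0 by (intro H_cont_x) auto
    show "x \<in> borel_measurable (lebesgue_on {t0..T})"
      by (rule continuous_imp_measurable_on_sets_lebesgue[OF x]) auto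
  qed
qed

lemma measurable_closest_point_epi_conj:
  assumes t0: "0 \<le> t0" and x: "continuous_on {t0..T} x" and a: "a \<in> borel_measurable (lebesgue_on {t0..T})"
  shows "(\<lambda>t. closest_point (epi_conj H t (x t)) (a t)) \<in> borel_measurable (lebesgue_on {t0..T})"
proof (rule borel_measurable_closest_point[OF _ _ _ a])
  fix t assume "t \<in> space (lebesgue_on {t0..T})"
  then have t: "t \<in> {0..T}" using t0 by auto
  show "closed (epi_conj H t (x t))" "convex (epi_conj H t (x t))" "epi_conj H t (x t) \<noteq> {}"
    by (rule epi_conj_basic[OF t])+
next
  fix z
  show "(\<lambda>t. infdist (a t + z) (epi_conj H t (x t))) \<in> borel_measurable (lebesgue_on {t0..T})"
    by (rule measurable_infdist_epi_conj[OF t0 x]) (use a in measurable)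
qed

lemma infdist_epi_conj_le:
  assumes t: "t \<in> {0..T}" and R: "R > 0" "norm x \<le> R"
  shows "infdist a (epi_conj H t x) \<le> norm a + bnd R t"
  using infdist_triangle[of a "epi_conj H t x" 0] infdist_0_epi_conj_le[OF t R] by simp

lemma infdist_epi_conj_int:
  assumes t0: "0 \<le> t0" and R: "R > 0" "\<And>t. t \<in> {t0..T} \<Longrightarrow> norm (x t) \<le> R"
    and x: "continuous_on {t0..T} x" and a: "a absolutely_integrable_on {t0..T}"
  shows "(\<lambda>t. infdist (a t) (epi_conj H t (x t))) absolutely_integrable_on {t0..T}"
proof (rule measurable_bounded_by_integrable_imp_absolutely_integrable)
  have sub: "{t0..T} \<subseteq> {0..T}" using t0 by auto
  show "(\<lambda>t. infdist (a t) (epi_conj H t (x t))) \<in> borel_measurable (lebesgue_on {t0..T})"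
    by (intro measurable_infdist_epi_conj t0 x absint_measurable a)
  show "(\<lambda>t. norm (a t) + bnd R t) integrable_on {t0..T}"
    by (intro absint_imp_int set_integral_add(1) set_integrable_norm a absint_subinterval[OF bnd_int[OF R(1)] sub])
  show "norm (infdist (a t) (epi_conj H t (x t))) \<le> norm (a t) + bnd R t" if "t \<in> {t0..T}" for t
    using infdist_epi_conj_le[of t R "x t" "a t"] that t0 R infdist_nonneg[of "a t"] by auto
qed auto

text \<open>Filippov's successive approximations: each control is the projection of the previous one onto the
  epigraphs along the previous trajectory; the weight \<open>exp (2 K t)\<close> makes the increments decay like \<open>2\<^sup>-\<^sup>n\<close>.\<close>

lemma filippov_approximation:
  assumes t0: "0 \<le> t0" "t0 \<le> T" and \<rho>: "norm x0 \<le> \<rho>" and a: "a absolutely_integrable_on {t0..T}"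
    and B0: "\<And>t. t \<in> {t0..T} \<Longrightarrow> 1 + norm (traj t0 x0 a t) \<le> 2 * (1 + \<rho>) * exp (2 * integral {0..t} c)"
  defines "m \<equiv> integral {t0..T} (\<lambda>t. infdist (a t) (epi_conj H t (traj t0 x0 a t)))"
  shows "\<exists>b. admissible H t0 x0 b \<and> integral {t0..T} (\<lambda>t. norm (b t - a t)) \<le> gain (rad \<rho>) * m"
proof -
  have \<rho>0: "\<rho> \<ge> 0" using \<rho> norm_ge_zero by (rule order_trans[rotated])
  define R where "R = rad \<rho>"
  have R: "R > 0" unfolding R_def by (rule rad_pos[OF \<rho>0])
  have sub: "{t0..T} \<subseteq> {0..T}" using t0 by auto
  have T0: "t \<in> {0..T}" if "t \<in> {t0..T}" for t using that t0 by auto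
  define A where "A n = rec_nat a (\<lambda>_ b t. closest_point (epi_conj H t (traj t0 x0 b t)) (b t)) n" for n
  define X where "X n = traj t0 x0 (A n)" for n
  have A0: "A 0 = a" and AS: "A (Suc n) t = closest_point (epi_conj H t (X n t)) (A n t)" for n t
    by (simp_all add: A_def X_def)
  define W where "W t = 2 * (1 + \<rho>) * exp (2 * integral {0..t} c)" for t
  have AE: "A (Suc n) t \<in> epi_conj H t (X n t)" if "t \<in> {t0..T}" for n t
    unfolding AS by (rule closest_point_in_set) (use epi_conj_basic[OF T0[OF that]] in auto)
  have Ad: "norm (A (Suc n) t - A n t) = infdist (A n t) (epi_conj H t (X n t))" if "t \<in> {t0..T}" for n t
    unfolding AS by (subst infdist_closest_point) (use epi_conj_basic[OF T0[OF that]] in \<open>auto simp: dist_norm norm_minus_commute\<close>)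
  \<comment> \<open>The bound \<open>W\<close> reproduces itself: the projected velocity is at most
    \<open>c * W\<close>, whose integral is at most \<open>W / 2\<close>, and the initial point
    contributes \<open>1 + \<rho> \<le> W / 2\<close>. All iterates therefore stay in the ball of
    radius \<open>R\<close>, where one Lipschitz function \<open>lip R\<close> is valid.\<close>
  have I: "A n absolutely_integrable_on {t0..T} \<and> (\<forall>t\<in>{t0..T}. 1 + norm (X n t) \<le> W t)" for n
  proof (induction n)
    case 0
    show ?case using a B0 by (simp add: A0 X_def W_def)
  next
    case (Suc n)
    then have An: "A n absolutely_integrable_on {t0..T}" and Xn: "\<And>t. t \<in> {t0..T} \<Longrightarrow> 1 + norm (X n t) \<le> W t" by auto
    have XR: "norm (X n t) \<le> R" if "t \<in> {t0..T}" for t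
      using weight_le_rad[OF \<rho>0 T0[OF that]] Xn[OF that] by (simp add: W_def R_def)
    have ASi: "A (Suc n) absolutely_integrable_on {t0..T}"
    proof (rule measurable_bounded_by_integrable_imp_absolutely_integrable)
      have "A (Suc n) = (\<lambda>t. closest_point (epi_conj H t (X n t)) (A n t))" by (rule ext) (rule AS)
      then show "A (Suc n) \<in> borel_measurable (lebesgue_on {t0..T})"
        unfolding X_def using measurable_closest_point_epi_conj[OF t0(1) continuous_on_traj[OF An] absint_measurable[OF An]] by simp
      show "(\<lambda>t. norm (A n t) + (norm (A n t) + bnd R t)) integrable_on {t0..T}"
        by (intro absint_imp_int set_integral_add(1) set_integrable_norm An absint_subinterval[OF bnd_int[OF R] sub])
      show "norm (A (Suc n) t) \<le> norm (A n t) + (norm (A n t) + bnd R t)" if "t \<in> {t0..T}" for t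
        using norm_triangle_sub[of "A (Suc n) t" "A n t"] Ad[OF that, of n]
          infdist_epi_conj_le[OF T0[OF that] R XR[OF that], of "A n t"] by linarith
    qed auto
    have "1 + norm (X (Suc n) t) \<le> W t" if t: "t \<in> {t0..T}" for t
    proof -
      have sub': "{t0..t} \<subseteq> {t0..T}" using t by auto
      note i = absint_fst_snd(1)[OF absint_subinterval[OF ASi sub']]
      have "norm (X (Suc n) t) \<le> norm x0 + norm (integral {t0..t} (\<lambda>s. fst (A (Suc n) s)))"
        unfolding X_def traj_def by (rule norm_triangle_ineq)
      also have "norm (integral {t0..t} (\<lambda>s. fst (A (Suc n) s))) \<le> integral {t0..t} (\<lambda>s. norm (fst (A (Suc n) s)))"
        by (intro integral_norm_bound_integral absint_imp_int set_integrable_norm i) simp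
      also have "\<dots> \<le> (2 * (1 + \<rho>)) * exp (2 * integral {0..t} c) / 2"
      proof (rule integral_le_exp_weight[OF c_int c_nonneg t0(1)])
        show "(\<lambda>s. norm (fst (A (Suc n) s))) integrable_on {t0..t}"
          by (intro absint_imp_int set_integrable_norm i)
        fix r assume r: "r \<in> {t0..t}"
        then have r': "r \<in> {t0..T}" using t by auto
        have "norm (fst (A (Suc n) r)) \<le> c r * (1 + norm (X n r))"
          by (rule epi_conj_fst_bound[OF T0[OF r'] AE[OF r']])
        also have "\<dots> \<le> c r * W r" using Xn[OF r'] c_nonneg[OF T0[OF r']] by (intro mult_left_mono) auto
        finally show "norm (fst (A (Suc n) r)) \<le> c r * (2 * (1 + \<rho>) * exp (2 * integral {0..r} c))"
          by (simp add: W_def)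
      qed (use t \<rho>0 in auto)
      finally have 1: "norm (X (Suc n) t) \<le> norm x0 + W t / 2" by (simp add: W_def)
      have "0 \<le> integral {0..t} c"
        by (rule integral_subinterval_le(2)[OF absint_imp_int[OF c_int] c_nonneg]) (use t in auto)
      then have "(1 + \<rho>) * 1 \<le> (1 + \<rho>) * exp (2 * integral {0..t} c)" using \<rho>0 by (intro mult_left_mono) auto
      then have "1 + \<rho> \<le> W t / 2" by (simp add: W_def algebra_simps)
      with 1 \<rho> show ?thesis by simp
    qed
    with ASi show ?case by blast
  qed
  then have Ai: "A n absolutely_integrable_on {t0..T}" and XW: "t \<in> {t0..T} \<Longrightarrow> 1 + norm (X n t) \<le> W t" for n t by auto
  have XR: "norm (X n t) \<le> R" if "t \<in> {t0..T}" for n t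
    using weight_le_rad[OF \<rho>0 T0[OF that]] XW[OF that] by (simp add: W_def R_def)
  define \<gamma> where "\<gamma> t = infdist (a t) (epi_conj H t (traj t0 x0 a t))" for t
  have \<gamma>A: "\<gamma> t = infdist (A 0 t) (epi_conj H t (X 0 t))" for t by (simp add: \<gamma>_def A0 X_def)
  have \<gamma>0: "\<gamma> t \<ge> 0" for t unfolding \<gamma>_def by (rule infdist_nonneg)
  have \<gamma>i: "\<gamma> absolutely_integrable_on {t0..T}"
    unfolding \<gamma>A[abs_def] by (intro infdist_epi_conj_int[OF t0(1) R XR] Ai) (auto simp: X_def intro: continuous_on_traj[OF Ai])
  have m\<gamma>: "m = integral {t0..T} \<gamma>" by (simp add: m_def \<gamma>_def[abs_def])
  have m0: "m \<ge> 0" unfolding m\<gamma> using \<gamma>0 by (intro Henstock_Kurzweil_Integration.integral_nonneg absint_imp_int \<gamma>i)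
  define K where "K t = integral {0..t} (lip R)" for t
  have KT: "K t \<le> K T" "0 \<le> K t" if "t \<in> {0..T}" for t
    unfolding K_def using that by (intro integral_subinterval_le[OF absint_imp_int[OF lip_int[OF R]] lip_nonneg[OF R]]; auto)+
  \<comment> \<open>The first increment is at most the total defect \<open>m\<close>. Each later
    control increment is at most \<open>lip R\<close> times the previous state increment, and
    integrating against the weight halves the bound.\<close>
  have XD: "norm (X (Suc n) t - X n t) \<le> m / 2 ^ n * exp (2 * K t)" if t: "t \<in> {t0..T}" for n t
    using t
  proof (induction n arbitrary: t)
    case (0 t)
    have "norm (X (Suc 0) t - X 0 t) \<le> integral {t0..t} (\<lambda>s. norm (A (Suc 0) s - A 0 s))"
      unfolding X_def by (rule norm_traj_diff_le[OF Ai Ai 0])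
    also have "\<dots> = integral {t0..t} \<gamma>"
      using 0 by (intro Henstock_Kurzweil_Integration.integral_cong) (auto simp: Ad \<gamma>A)
    also have "\<dots> \<le> m" unfolding m\<gamma>
      using 0 \<gamma>0 by (intro integral_subinterval_le(1)[OF absint_imp_int[OF \<gamma>i]]) auto
    also have "m * 1 \<le> m * exp (2 * K t)" using KT(2)[OF T0[OF 0]] m0 by (intro mult_left_mono) auto
    finally show ?case by simp
  next
    case (Suc n t)
    have "norm (X (Suc (Suc n)) t - X (Suc n) t) \<le> integral {t0..t} (\<lambda>s. norm (A (Suc (Suc n)) s - A (Suc n) s))"
      unfolding X_def by (rule norm_traj_diff_le[OF Ai Ai Suc.prems])
    also have "\<dots> \<le> m / 2 ^ n * exp (2 * K t) / 2"
      unfolding K_def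
    proof (rule integral_le_exp_weight[OF lip_int[OF R] lip_nonneg[OF R] t0(1)])
      have s: "{t0..t} \<subseteq> {t0..T}" using Suc.prems by auto
      show "(\<lambda>s. norm (A (Suc (Suc n)) s - A (Suc n) s)) integrable_on {t0..t}"
        by (intro absint_imp_int set_integrable_norm set_integral_diff(1) absint_subinterval[OF Ai s])
      fix r assume "r \<in> {t0..t}"
      then have r: "r \<in> {t0..T}" using Suc.prems by auto
      have "norm (A (Suc (Suc n)) r - A (Suc n) r) = infdist (A (Suc n) r) (epi_conj H r (X (Suc n) r))"
        by (rule Ad[OF r])
      also have "\<dots> \<le> lip R r * norm (X (Suc n) r - X n r)"
        by (rule infdist_epi_conj_lip[OF T0[OF r] R XR[OF r] XR[OF r] AE[OF r]])
      also have "\<dots> \<le> lip R r * (m / 2 ^ n * exp (2 * K r))"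
        using Suc.IH[OF r] lip_nonneg[OF R T0[OF r]] by (intro mult_left_mono) auto
      finally show "norm (A (Suc (Suc n)) r - A (Suc n) r) \<le> lip R r * (m / 2 ^ n * exp (2 * integral {0..r} (lip R)))"
        by (simp add: K_def)
    qed (use Suc.prems m0 in auto)
    finally show ?case by (simp add: mult.commute)
  qed
  define \<Lambda> where "\<Lambda> = m * exp (2 * K T)"
  have \<Lambda>0: "\<Lambda> \<ge> 0" using m0 by (simp add: \<Lambda>_def)
  \<comment> \<open>The geometric decay of the controls starts only at index 1:
    \<open>A 0 = a\<close> need not lie in any of the epigraphs, so the first increment is the
    defect \<open>\<gamma>\<close> itself.\<close>
  have AD: "norm (A (Suc (Suc n)) t - A (Suc n) t) \<le> lip R t * \<Lambda> / 2 ^ n" if t: "t \<in> {t0..T}" for n t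
  proof -
    have "norm (A (Suc (Suc n)) t - A (Suc n) t) \<le> lip R t * norm (X (Suc n) t - X n t)"
      unfolding Ad[OF t] by (rule infdist_epi_conj_lip[OF T0[OF t] R XR[OF t] XR[OF t] AE[OF t]])
    also have "\<dots> \<le> lip R t * (m / 2 ^ n * exp (2 * K T))"
    proof (rule mult_left_mono[OF _ lip_nonneg[OF R T0[OF t]]])
      have "m / 2 ^ n * exp (2 * K t) \<le> m / 2 ^ n * exp (2 * K T)"
        using m0 KT[OF T0[OF t]] by (intro mult_left_mono) auto
      with XD[OF t] show "norm (X (Suc n) t - X n t) \<le> m / 2 ^ n * exp (2 * K T)" by (rule order_trans)
    qed
    finally show ?thesis by (simp add: \<Lambda>_def)
  qed
  \<comment> \<open>Defect plus the sum of all later increments, the factor 2 being the geometric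
    series. \<open>G\<close> bounds \<open>A n - a\<close> for every \<open>n\<close>, and its
    integral is the origin of \<open>gain R * m\<close>.\<close>
  define G where "G t = \<gamma> t + 2 * \<Lambda> * lip R t" for t
  have lip0: "lip R t * \<Lambda> \<ge> 0" if "t \<in> {t0..T}" for t using lip_nonneg[OF R T0[OF that]] \<Lambda>0 by simp
  have Aa: "norm (A n t - a t) \<le> G t" if t: "t \<in> {t0..T}" for n t
  proof (cases n)
    case 0
    then show ?thesis using \<gamma>0[of t] lip0[OF t] by (simp add: A0 G_def mult_ac)
  next
    case (Suc n')
    \<comment> \<open>\<open>2 - 2 / 2 ^ n'\<close> is the partial geometric sum
      \<open>1 + 1/2 + ...\<close> with \<open>n'\<close> terms.\<close>
    have "norm (A (Suc n') t - a t) \<le> \<gamma> t + lip R t * \<Lambda> * (2 - 2 / 2 ^ n')" for n'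
    proof (induction n')
      case 0
      show ?case using Ad[OF t, of 0] by (simp add: A0[symmetric] \<gamma>A)
    next
      case (Suc n')
      have "norm (A (Suc (Suc n')) t - a t) \<le> norm (A (Suc (Suc n')) t - A (Suc n') t) + norm (A (Suc n') t - a t)"
        using norm_triangle_ineq[of "A (Suc (Suc n')) t - A (Suc n') t" "A (Suc n') t - a t"] by simp
      also have "\<dots> \<le> lip R t * \<Lambda> / 2 ^ n' + (\<gamma> t + lip R t * \<Lambda> * (2 - 2 / 2 ^ n'))"
        by (intro add_mono AD[OF t] Suc.IH)
      also have "\<dots> = \<gamma> t + lip R t * \<Lambda> * (2 - 2 / 2 ^ Suc n')" by (simp add: field_simps)
      finally show ?case .
    qed
    also have "\<gamma> t + lip R t * \<Lambda> * (2 - 2 / 2 ^ n') \<le> \<gamma> t + lip R t * \<Lambda> * 2"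
      using lip0[OF t] by (intro add_left_mono mult_left_mono) auto
    finally show ?thesis using Suc by (simp add: G_def mult_ac)
  qed
  \<comment> \<open>The telescoping series gives the limit control by a formula; its terms are
    summable at each \<open>t\<close> in \<open>{t0..T}\<close>.\<close>
  define b where "b t = a t + (\<Sum>n. A (Suc n) t - A n t)" for t
  have lim: "(\<lambda>n. A n t) \<longlonglongrightarrow> b t" if t: "t \<in> {t0..T}" for t
  proof -
    have "summable (\<lambda>n. lip R t * \<Lambda> * (1 / 2) ^ n)" by (intro summable_mult summable_geometric) auto
    then have "summable (\<lambda>n. A (Suc (Suc n)) t - A (Suc n) t)"
      by (rule summable_comparison_test'[where N=0]) (use AD[OF t] in \<open>auto simp: power_divide\<close>)
    then have "summable (\<lambda>n. A (Suc n) t - A n t)" by (subst (asm) summable_Suc_iff)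
    then have "(\<lambda>n. \<Sum>i<n. A (Suc i) t - A i t) \<longlonglongrightarrow> (\<Sum>n. A (Suc n) t - A n t)" by (rule summable_LIMSEQ)
    moreover have "(\<Sum>i<n. A (Suc i) t - A i t) = A n t - a t" for n
      using sum_lessThan_telescope[of "\<lambda>i. A i t" n] by (simp add: A0)
    ultimately have "(\<lambda>n. A n t - a t) \<longlonglongrightarrow> (\<Sum>n. A (Suc n) t - A n t)" by (simp only:)
    from tendsto_add[OF tendsto_const[of "a t"] this] show ?thesis by (simp add: b_def)
  qed
  have Gi: "G absolutely_integrable_on {t0..T}"
    unfolding G_def[abs_def] by (intro set_integral_add(1) \<gamma>i set_integrable_mult_right absint_subinterval[OF lip_int[OF R] sub])
  define D where "D t = norm (a t) + G t" for t
  have Di: "D integrable_on {t0..T}" unfolding D_def[abs_def]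
    by (intro absint_imp_int set_integral_add(1) set_integrable_norm a Gi)
  have AnD: "norm (A n t) \<le> D t" if "t \<in> {t0..T}" for n t
    using norm_triangle_sub[of "A n t" "a t"] Aa[OF that, of n] unfolding D_def by linarith
  have bi: "b absolutely_integrable_on {t0..T}"
  proof (rule dominated_convergence_absolutely_integrable[OF Ai Di _ lim])
    show "norm (b t) \<le> D t" if "t \<in> {t0..T}" for t
      by (rule LIMSEQ_le_const2[OF tendsto_norm[OF lim[OF that]]]) (use AnD[OF that] in auto)
  qed
  have Xlim: "(\<lambda>n. X n t) \<longlonglongrightarrow> traj t0 x0 b t" if t: "t \<in> {t0..T}" for t
  proof -
    have s: "{t0..t} \<subseteq> {t0..T}" using t by auto
    have "(\<lambda>n. integral {t0..t} (\<lambda>s. fst (A n s))) \<longlonglongrightarrow> integral {t0..t} (\<lambda>s. fst (b s))"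
    proof (rule dominated_convergence(2)[where h=D])
      show "(\<lambda>s. fst (A n s)) integrable_on {t0..t}" for n
        by (intro absint_imp_int absint_fst_snd absint_subinterval[OF Ai s])
      show "D integrable_on {t0..t}" by (rule integrable_subinterval_real[OF Di s])
      fix n r assume "r \<in> {t0..t}"
      then have r: "r \<in> {t0..T}" using s by auto
      show "norm (fst (A n r)) \<le> D r"
        using norm_fst_le[of "fst (A n r)" "snd (A n r)"] AnD[OF r, of n] by simp
      show "(\<lambda>n. fst (A n r)) \<longlonglongrightarrow> fst (b r)" by (intro tendsto_fst lim[OF r])
    qed
    then show ?thesis unfolding X_def traj_def by (intro tendsto_intros)
  qed
  \<comment> \<open>\<open>A (Suc n)\<close> belongs to the epigraph along \<open>X n\<close>, one
    index behind. Both sequences converge, so for each fixed \<open>p\<close> the defining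
    inequality passes to the limit by continuity of \<open>H\<close> in \<open>x\<close>.\<close>
  have "b t \<in> epi_conj H t (traj t0 x0 b t)" if t: "t \<in> {t0..T}" for t
  proof -
    have "fst (b t) \<bullet> p - H t (traj t0 x0 b t) p \<le> snd (b t)" for p
    proof (rule LIMSEQ_le)
      have l: "(\<lambda>n. A (Suc n) t) \<longlonglongrightarrow> b t" using lim[OF t] by (rule LIMSEQ_Suc)
      have "(\<lambda>n. H t (X n t) p) \<longlonglongrightarrow> H t (traj t0 x0 b t) p"
        using continuous_on_tendsto_compose[OF H_cont_x[OF T0[OF t]] Xlim[OF t]] by simp
      then show "(\<lambda>n. fst (A (Suc n) t) \<bullet> p - H t (X n t) p) \<longlonglongrightarrow> fst (b t) \<bullet> p - H t (traj t0 x0 b t) p"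
        by (intro tendsto_intros l)
      show "(\<lambda>n. snd (A (Suc n) t)) \<longlonglongrightarrow> snd (b t)" by (intro tendsto_intros l)
      have "fst (A (Suc n) t) \<bullet> p - H t (X n t) p \<le> snd (A (Suc n) t)" for n
        using AE[OF t, of n] mem_conj_epi_iff[of "fst (A (Suc n) t)" "snd (A (Suc n) t)" "H t (X n t)"] by (simp add: epi_conj_eq)
      then show "\<exists>N. \<forall>n\<ge>N. fst (A (Suc n) t) \<bullet> p - H t (X n t) p \<le> snd (A (Suc n) t)" by blast
    qed
    then show ?thesis
      using mem_conj_epi_iff[of "fst (b t)" "snd (b t)" "H t (traj t0 x0 b t)"] by (simp add: epi_conj_eq)
  qed
  with bi have adm: "admissible H t0 x0 b" unfolding admissible_def by blast
  have "integral {t0..T} (\<lambda>t. norm (b t - a t)) \<le> integral {t0..T} G"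
  proof (rule integral_le)
    show "(\<lambda>t. norm (b t - a t)) integrable_on {t0..T}"
      by (intro absint_imp_int set_integrable_norm set_integral_diff(1) bi a)
    show "norm (b t - a t) \<le> G t" if "t \<in> {t0..T}" for t
      by (rule LIMSEQ_le_const2[OF tendsto_norm[OF tendsto_diff[OF lim[OF that] tendsto_const]]])
        (use Aa[OF that] in auto)
  qed (rule absint_imp_int[OF Gi])
  also have "\<dots> = m + 2 * \<Lambda> * integral {t0..T} (lip R)"
    unfolding G_def[abs_def] m\<gamma>
  proof -
    have "(\<lambda>t. 2 * \<Lambda> * lip R t) integrable_on {t0..T}"
      by (intro absint_imp_int set_integrable_mult_right absint_subinterval[OF lip_int[OF R] sub])
    from Henstock_Kurzweil_Integration.integral_add[OF absint_imp_int[OF \<gamma>i] this]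
    show "integral {t0..T} (\<lambda>t. \<gamma> t + 2 * \<Lambda> * lip R t) = integral {t0..T} \<gamma> + 2 * \<Lambda> * integral {t0..T} (lip R)"
      by simp
  qed
  also have "\<dots> \<le> m + 2 * \<Lambda> * K T"
    unfolding K_def using \<Lambda>0 sub
    by (intro add_left_mono mult_left_mono integral_subinterval_le(1)[OF absint_imp_int[OF lip_int[OF R]] lip_nonneg[OF R]]) auto
  also have "\<dots> = gain R * m" by (simp add: gain_def \<Lambda>_def K_def algebra_simps)
  finally show ?thesis using adm unfolding R_def by blast
qed

lemma admissible_bound:
  assumes t0: "0 \<le> t0" "t0 \<le> T" and \<rho>: "norm x0 \<le> \<rho>" and a: "admissible H t0 x0 a" and t: "t \<in> {t0..T}"
  shows "1 + norm (traj t0 x0 a t) \<le> 2 * (1 + \<rho>) * exp (2 * integral {0..t} c)"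
proof -
  have ai: "a absolutely_integrable_on {t0..T}" using a by (simp add: admissible_def)
  have \<rho>0: "\<rho> \<ge> 0" using \<rho> norm_ge_zero by (rule order_trans[rotated])
  have x: "continuous_on {t0..T} (traj t0 x0 a)" by (rule continuous_on_traj[OF ai])
  show ?thesis
  proof (rule gronwall_bound[OF c_int c_nonneg t0 x \<rho>0 _ t])
    fix s assume s: "s \<in> {t0..T}"
    then have sub: "{t0..s} \<subseteq> {t0..T}" "{t0..s} \<subseteq> {0..T}" using t0 by auto
    have "norm (integral {t0..s} (\<lambda>r. fst (a r))) \<le> integral {t0..s} (\<lambda>r. c r * (1 + norm (traj t0 x0 a r)))"
    proof (rule integral_norm_bound_integral)
      show "(\<lambda>r. fst (a r)) integrable_on {t0..s}"
        by (intro absint_imp_int absint_fst_snd absint_subinterval[OF ai sub(1)])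
      show "(\<lambda>r. c r * (1 + norm (traj t0 x0 a r))) integrable_on {t0..s}"
        by (intro absint_imp_int absint_times_continuous absint_subinterval[OF c_int sub(2)] continuous_intros
            continuous_on_subset[OF x sub(1)])
      show "norm (fst (a r)) \<le> c r * (1 + norm (traj t0 x0 a r))" if "r \<in> {t0..s}" for r
        using that sub a by (intro epi_conj_fst_bound) (auto simp: admissible_def)
    qed
    then show "norm (traj t0 x0 a s) \<le> \<rho> + integral {t0..s} (\<lambda>r. c r * (1 + norm (traj t0 x0 a r)))"
      unfolding traj_def[of _ _ _ s] using norm_triangle_ineq[of x0 "integral {t0..s} (\<lambda>r. fst (a r))"] \<rho> by linarith
  qed auto
qed

text \<open>Filippov's construction is started from the zero control, whose trajectory is the
  constant \<open>x0\<close> and whose defect is at most \<open>bnd\<close>. The bound is uniform in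
  the Hamiltonian, in \<open>t0\<close> and in \<open>x0\<close>, which makes it an a priori cost
  level.\<close>

lemma admissible_exists:
  assumes t0: "0 \<le> t0" "t0 \<le> T" and \<rho>: "norm x0 \<le> \<rho>"
  shows "\<exists>b. admissible H t0 x0 b \<and>
           integral {t0..T} (\<lambda>t. norm (b t)) \<le> gain (rad \<rho>) * integral {0..T} (bnd (rad \<rho>))"
proof -
  have \<rho>0: "\<rho> \<ge> 0" using \<rho> norm_ge_zero by (rule order_trans[rotated])
  define R where "R = rad \<rho>"
  have R: "R > 0" unfolding R_def by (rule rad_pos[OF \<rho>0])
  have sub: "{t0..T} \<subseteq> {0..T}" using t0 by auto
  define a :: "real \<Rightarrow> (real^'n) \<times> real" where "a = (\<lambda>_. 0)"
  have tr: "traj t0 x0 a t = x0" for t by (simp add: traj_def a_def)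
  have ai: "a absolutely_integrable_on {t0..T}" unfolding a_def by (simp add: set_integrable_def)
  have W: "1 + norm x0 \<le> 2 * (1 + \<rho>) * exp (2 * integral {0..t} c)" if "t \<in> {t0..T}" for t
  proof -
    have "0 \<le> integral {0..t} c"
      by (rule integral_subinterval_le(2)[OF absint_imp_int[OF c_int] c_nonneg]) (use that in auto)
    then have "2 * (1 + \<rho>) * 1 \<le> 2 * (1 + \<rho>) * exp (2 * integral {0..t} c)" using \<rho>0 by (intro mult_left_mono) auto
    moreover have "1 + norm x0 \<le> 2 * (1 + \<rho>) * 1" using \<rho> \<rho>0 by simp
    ultimately show ?thesis by (rule order_trans[rotated])
  qed
  have x0R: "norm x0 \<le> R"
    using weight_le_rad[OF \<rho>0 _ W[of T]] t0 by (simp add: R_def)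
  obtain b where b: "admissible H t0 x0 b"
    "integral {t0..T} (\<lambda>t. norm (b t - a t)) \<le> gain R * integral {t0..T} (\<lambda>t. infdist (a t) (epi_conj H t (traj t0 x0 a t)))"
    using filippov_approximation[OF t0 \<rho> ai] W unfolding tr R_def by blast
  have "integral {t0..T} (\<lambda>t. infdist (a t) (epi_conj H t (traj t0 x0 a t))) \<le> integral {t0..T} (bnd R)"
  proof (rule integral_le)
    show "(\<lambda>t. infdist (a t) (epi_conj H t (traj t0 x0 a t))) integrable_on {t0..T}"
      using absint_imp_int[OF infdist_epi_conj_int[OF t0(1) R x0R continuous_on_const ai]] by (simp only: tr)
    show "bnd R integrable_on {t0..T}" by (rule absint_imp_int[OF absint_subinterval[OF bnd_int[OF R] sub]])
    show "infdist (a t) (epi_conj H t (traj t0 x0 a t)) \<le> bnd R t" if "t \<in> {t0..T}" for t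
      using infdist_0_epi_conj_le[OF _ R x0R, of t] that sub unfolding tr by (auto simp: a_def)
  qed
  also have "\<dots> \<le> integral {0..T} (bnd R)"
    by (rule integral_subinterval_le(1)[OF absint_imp_int[OF bnd_int[OF R]] bnd_nonneg[OF R] sub])
  finally have "gain R * integral {t0..T} (\<lambda>t. infdist (a t) (epi_conj H t (traj t0 x0 a t))) \<le> gain R * integral {0..T} (bnd R)"
    using gain_ge_1[OF R] t0 by (intro mult_left_mono) auto
  with b show ?thesis by (auto simp: a_def R_def intro!: exI[of _ b])
qed

section \<open>Passage between Steiner controls and admissible pairs\<close>

lemma steiner_of_member:
  assumes "a \<in> epi_conj H t x"
  shows "steiner_f H t x a = fst a" "steiner_l H t x a = snd a"
proof -
  have "steiner_Phi H t x a = {a}" using assms by (auto simp: steiner_Phi_def)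
  then show "steiner_f H t x a = fst a" "steiner_l H t x a = snd a"
    by (simp_all add: steiner_f_def steiner_l_def steiner_point_singleton)
qed

text \<open>The radius in \<open>steiner_Phi\<close> is twice the distance, so the set contains the
  projection of \<open>a\<close> and is a nonempty compact convex set to which
  \<open>steiner_point_mem\<close> applies.\<close>

lemma steiner_point_in_epi_conj:
  assumes t: "t \<in> {0..T}"
  shows "(steiner_f H t x a, steiner_l H t x a) \<in> epi_conj H t x"
proof -
  let ?E = "epi_conj H t x"
  note E = epi_conj_basic[OF t, of x]
  have "closest_point ?E a \<in> steiner_Phi H t x a"
    unfolding steiner_Phi_def using closest_point_in_set[OF E(1,3), of a] infdist_closest_point[OF E(1,3), of a]
      infdist_nonneg[of a ?E] by auto
  moreover have "compact (steiner_Phi H t x a)" unfolding steiner_Phi_def by (intro closed_Int_compact E(1)) simp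
  moreover have "convex (steiner_Phi H t x a)" unfolding steiner_Phi_def by (intro convex_Int E(2)) simp
  ultimately have "steiner_point (steiner_Phi H t x a) \<in> steiner_Phi H t x a" by (intro steiner_point_mem) auto
  then show ?thesis by (simp add: steiner_Phi_def steiner_f_def steiner_l_def)
qed

lemma value_fun_le_admissible:
  assumes t0: "0 \<le> t0" and a: "admissible H t0 x0 a"
  shows "value_fun T g H t0 x0 \<le> ereal (g (traj t0 x0 a T) + integral {t0..T} (\<lambda>t. snd (a t)))"
proof -
  have ai: "a absolutely_integrable_on {t0..T}" and mem: "\<And>t. t \<in> {t0..T} \<Longrightarrow> a t \<in> epi_conj H t (traj t0 x0 a t)"
    using a by (auto simp: admissible_def)
  let ?x = "traj t0 x0 a"
  have "AE t in lebesgue. t \<in> {t0..T} \<longrightarrow> (?x has_vector_derivative fst (a t)) (at t within {t0..T})"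
    using indefinite_integral_has_vector_derivative_AE[OF absint_imp_int[OF absint_fst_snd(1)[OF ai]], of x0]
    unfolding traj_def[abs_def] .
  then have "AE t in lebesgue. t \<in> {t0..T} \<longrightarrow> (?x has_vector_derivative steiner_f H t (?x t) (a t)) (at t within {t0..T})"
    by eventually_elim (auto simp: steiner_of_member(1)[OF mem])
  then have tr: "(?x, a) \<in> trajectories T (steiner_f H) t0 x0"
    unfolding trajectories_def using ai abs_cont_on_indefinite_integral[OF absint_fst_snd(1)[OF ai], of x0]
    by (simp add: traj_def[abs_def])
  have eq: "steiner_l H t (?x t) (a t) = snd (a t)" if "t \<in> {t0..T}" for t by (rule steiner_of_member(2)[OF mem[OF that]])
  have si: "set_integrable lebesgue {t0..T} (\<lambda>t. steiner_l H t (?x t) (a t))"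
    using absint_fst_snd(2)[OF ai] by (subst set_integrable_cong[OF refl refl eq]) auto
  have "cost_integral t0 T (\<lambda>t. steiner_l H t (?x t) (a t)) = ereal (integral {t0..T} (\<lambda>t. snd (a t)))"
  proof -
    have "integral {t0..T} (\<lambda>t. steiner_l H t (?x t) (a t)) = integral {t0..T} (\<lambda>t. snd (a t))"
      by (rule Henstock_Kurzweil_Integration.integral_cong) (rule eq)
    then show ?thesis
      unfolding cost_integral_def using si by (simp add: set_lebesgue_integral_eq_integral(2)[OF si])
  qed
  then show ?thesis unfolding value_fun_def by (intro INF_lower2[OF tr]) simp
qed

text \<open>The control \<open>a\<close> itself need not lie in the epigraph, so it is replaced by
  the pair \<open>b\<close> of its Steiner values. The fundamental theorem for absolutely continuous
  functions shows that \<open>b\<close> generates the same state \<open>x\<close>.\<close>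

lemma trajectory_imp_admissible:
  assumes t0: "0 \<le> t0" "t0 \<le> T" and tr: "(x, a) \<in> trajectories T (steiner_f H) t0 x0"
    and fin: "set_integrable lebesgue {t0..T} (\<lambda>t. steiner_l H t (x t) (a t))"
  shows "\<exists>b. admissible H t0 x0 b \<and> ereal (g (x T)) + cost_integral t0 T (\<lambda>t. steiner_l H t (x t) (a t))
            = ereal (g (traj t0 x0 b T) + integral {t0..T} (\<lambda>t. snd (b t)))"
proof -
  define F l where "F t = steiner_f H t (x t) (a t)" and "l t = steiner_l H t (x t) (a t)" for t
  have ac: "abs_cont_on {t0..T} x" and x0: "x t0 = x0"
    and der: "AE t in lebesgue. t \<in> {t0..T} \<longrightarrow> (x has_vector_derivative F t) (at t within {t0..T})"
    using tr by (auto simp: trajectories_def F_def)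
  have xc: "continuous_on {t0..T} x" by (rule abs_cont_on_imp_continuous_on[OF ac])
  have sub: "{t0..T} \<subseteq> {0..T}" using t0 by auto
  have Fint: "(F has_integral (x s - x0)) {t0..s}" if s: "s \<in> {t0..T}" for s
  proof -
    have "AE t in lebesgue. t \<in> {t0..s} \<longrightarrow> (x has_vector_derivative F t) (at t within {t0..s})"
      using der by eventually_elim (use s in \<open>auto intro: has_vector_derivative_within_subset\<close>)
    from abs_cont_on_has_integral[OF abs_cont_on_subset[OF ac] _ this] show ?thesis using s x0 by simp
  qed
  have mem: "(F t, l t) \<in> epi_conj H t (x t)" if "t \<in> {t0..T}" for t
    unfolding F_def l_def using that sub by (intro steiner_point_in_epi_conj) auto
  \<comment> \<open>The fundamental theorem gives gauge integrability and hence measurability;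
    absolute integrability comes from the linear growth bound on velocities in the epigraph.\<close>
  have Fi: "F absolutely_integrable_on {t0..T}"
  proof (rule measurable_bounded_by_integrable_imp_absolutely_integrable)
    show "F \<in> borel_measurable (lebesgue_on {t0..T})"
      using Fint[of T] t0 by (intro integrable_imp_measurable) auto
    show "(\<lambda>t. c t * (1 + norm (x t))) integrable_on {t0..T}"
      by (intro absint_imp_int absint_times_continuous absint_subinterval[OF c_int sub] continuous_intros xc)
    show "norm (F t) \<le> c t * (1 + norm (x t))" if "t \<in> {t0..T}" for t
      using epi_conj_fst_bound[OF _ mem[OF that]] that sub by auto
  qed auto
  define b where "b t = (F t, l t)" for t
  have li: "l absolutely_integrable_on {t0..T}" using fin unfolding l_def[abs_def] .
  have "(\<lambda>t. (F t, 0) + (0, l t)) absolutely_integrable_on {t0..T}"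
  proof (rule set_integral_add(1))
    have "bounded_linear (\<lambda>v::real^'n. (v, 0::real))" "bounded_linear (\<lambda>r::real. (0::real^'n, r))"
      by (intro bounded_linear_Pair bounded_linear_ident bounded_linear_zero)+
    then show "(\<lambda>t. (F t, 0::real)) absolutely_integrable_on {t0..T}" "(\<lambda>t. (0::real^'n, l t)) absolutely_integrable_on {t0..T}"
      using absolutely_integrable_linear[OF Fi] absolutely_integrable_linear[OF li] by (fastforce simp: o_def)+
  qed
  then have bi: "b absolutely_integrable_on {t0..T}" by (simp add: b_def[abs_def])
  have trb: "traj t0 x0 b t = x t" if "t \<in> {t0..T}" for t
    using integral_unique[OF Fint[OF that]] by (simp add: traj_def b_def)
  have "admissible H t0 x0 b" unfolding admissible_def using bi mem trb by (simp add: b_def)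
  moreover have "cost_integral t0 T (\<lambda>t. steiner_l H t (x t) (a t)) = ereal (integral {t0..T} (\<lambda>t. snd (b t)))"
    unfolding cost_integral_def using fin
    by (simp add: set_lebesgue_integral_eq_integral(2)[OF fin] b_def l_def[abs_def])
  ultimately show ?thesis using trb[of T] t0 by auto
qed

end

section \<open>Stability of value functions\<close>

text \<open>The lower bound \<open>- bnd \<le> r\<close> implies
  \<open>\<bar>r\<bar> \<le> r + 2 bnd\<close>, so an upper bound on the cost controls its L^1
  norm.\<close>

lemma integral_abs_snd_admissible_le:
  assumes H: "hamil H" and t0: "0 \<le> t0" "t0 \<le> T" and \<rho>: "norm x0 \<le> \<rho>" and a: "admissible H t0 x0 a"
  shows "integral {t0..T} (\<lambda>t. \<bar>snd (a t)\<bar>)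
       \<le> integral {t0..T} (\<lambda>t. snd (a t)) + 2 * integral {0..T} (bnd (rad \<rho>))"
proof -
  have \<rho>0: "\<rho> \<ge> 0" using \<rho> norm_ge_zero by (rule order_trans[rotated])
  define R where "R = rad \<rho>"
  have R: "R > 0" unfolding R_def by (rule rad_pos[OF \<rho>0])
  have sub: "{t0..T} \<subseteq> {0..T}" using t0 by auto
  have si: "(\<lambda>t. snd (a t)) absolutely_integrable_on {t0..T}"
    using a by (intro absint_fst_snd) (simp add: admissible_def)
  have bi: "bnd R integrable_on {t0..T}" by (rule absint_imp_int[OF absint_subinterval[OF bnd_int[OF R] sub]])
  have h: "((\<lambda>t. snd (a t) + 2 * bnd R t) has_integral
       (integral {t0..T} (\<lambda>t. snd (a t)) + 2 * integral {t0..T} (bnd R))) {t0..T}"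
    by (intro has_integral_add has_integral_mult_right integrable_integral absint_imp_int[OF si] bi)
  have "integral {t0..T} (\<lambda>t. \<bar>snd (a t)\<bar>) \<le> integral {t0..T} (\<lambda>t. snd (a t)) + 2 * integral {t0..T} (bnd R)"
  proof (rule has_integral_le[OF integrable_integral h])
    show "(\<lambda>t. \<bar>snd (a t)\<bar>) integrable_on {t0..T}" by (intro absint_imp_int set_integrable_abs si)
    fix t assume t: "t \<in> {t0..T}"
    then have t': "t \<in> {0..T}" using sub by auto
    have "norm (traj t0 x0 a t) \<le> R"
      unfolding R_def by (rule weight_le_rad[OF \<rho>0 t' admissible_bound[OF H t0 \<rho> a t]])
    then have "- bnd R t \<le> snd (a t)"
      using a t by (intro epi_conj_snd_bound[OF H t' R]) (auto simp: admissible_def)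
    then show "\<bar>snd (a t)\<bar> \<le> snd (a t) + 2 * bnd R t" using bnd_nonneg[OF R t'] by linarith
  qed
  also have "integral {t0..T} (bnd R) \<le> integral {0..T} (bnd R)"
    by (rule integral_subinterval_le(1)[OF absint_imp_int[OF bnd_int[OF R]] bnd_nonneg[OF R] sub])
  finally show ?thesis by (simp add: R_def)
qed

text \<open>Filippov's construction for \<open>H2\<close> starts from a control admissible for
  \<open>H1\<close>. Its growth assumption on the starting trajectory is supplied by Gronwall's
  bound for \<open>H1\<close>, which has the required form because both Hamiltonians share
  \<open>c\<close>. Its defect is bounded by integrating
  \<open>infdist_conj_epi_le_local\<close>.\<close>

lemma admissible_perturbation:
  assumes H1: "hamil H1" and H2: "hamil H2" and t0: "0 \<le> t0" "t0 \<le> T" and \<rho>: "norm x0 \<le> \<rho>"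
    and a: "admissible H1 t0 x0 a" and N: "N \<ge> 1"
    and D: "D integrable_on {0..T}" "\<And>t. t \<in> {0..T} \<Longrightarrow> 0 \<le> D t"
    and le: "\<And>t x p. t \<in> {0..T} \<Longrightarrow> norm x \<le> rad \<rho> \<Longrightarrow> norm p \<le> N \<Longrightarrow> \<bar>H1 t x p - H2 t x p\<bar> \<le> D t"
    and S: "integral {t0..T} (\<lambda>t. \<bar>snd (a t)\<bar>) \<le> S"
  shows "\<exists>b. admissible H2 t0 x0 b \<and> integral {t0..T} (\<lambda>t. norm (b t - a t))
     \<le> gain (rad \<rho>) * (integral {0..T} D + (S + integral {0..T} (bnd (rad \<rho>))) / N)"
proof -
  have \<rho>0: "\<rho> \<ge> 0" using \<rho> norm_ge_zero by (rule order_trans[rotated])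
  define R where "R = rad \<rho>"
  have R: "R > 0" unfolding R_def by (rule rad_pos[OF \<rho>0])
  have sub: "{t0..T} \<subseteq> {0..T}" using t0 by auto
  have ai: "a absolutely_integrable_on {t0..T}" using a by (simp add: admissible_def)
  have xR: "norm (traj t0 x0 a t) \<le> R" if "t \<in> {t0..T}" for t
    unfolding R_def using that sub by (intro weight_le_rad[OF \<rho>0 _ admissible_bound[OF H1 t0 \<rho> a that]]) auto
  let ?\<gamma> = "\<lambda>t. infdist (a t) (epi_conj H2 t (traj t0 x0 a t))"
  obtain b where b: "admissible H2 t0 x0 b"
    "integral {t0..T} (\<lambda>t. norm (b t - a t)) \<le> gain R * integral {t0..T} ?\<gamma>"
    using filippov_approximation[OF H2 t0 \<rho> ai admissible_bound[OF H1 t0 \<rho> a]] unfolding R_def by blast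
  have Di: "D integrable_on {t0..T}" by (rule integrable_subinterval_real[OF D(1) sub])
  have bi: "bnd R integrable_on {t0..T}" by (rule absint_imp_int[OF absint_subinterval[OF bnd_int[OF R] sub]])
  have si: "(\<lambda>t. \<bar>snd (a t)\<bar>) integrable_on {t0..T}" by (intro absint_imp_int set_integrable_abs absint_fst_snd ai)
  have h: "((\<lambda>t. D t + (\<bar>snd (a t)\<bar> + bnd R t) / N) has_integral
      (integral {t0..T} D + (integral {t0..T} (\<lambda>t. \<bar>snd (a t)\<bar>) + integral {t0..T} (bnd R)) / N)) {t0..T}"
    by (intro has_integral_add has_integral_divide integrable_integral Di bi si)
  have "integral {t0..T} ?\<gamma> \<le> integral {t0..T} D + (integral {t0..T} (\<lambda>t. \<bar>snd (a t)\<bar>) + integral {t0..T} (bnd R)) / N"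
  proof (rule has_integral_le[OF integrable_integral h])
    show "?\<gamma> integrable_on {t0..T}"
      by (intro absint_imp_int infdist_epi_conj_int[OF H2 t0(1) R xR] continuous_on_traj ai)
    fix t assume t: "t \<in> {t0..T}"
    then have t': "t \<in> {0..T}" using sub by auto
    let ?x = "traj t0 x0 a t"
    have "infdist (fst (a t), snd (a t)) (conj_epi (H2 t ?x)) \<le> D t + (\<bar>snd (a t)\<bar> + \<bar>H2 t ?x 0\<bar>) / N"
    proof (rule infdist_conj_epi_le_local[OF H_convex[OF H2 t'] _ D(2)[OF t'] N])
      show "H1 t ?x p - H2 t ?x p \<le> D t" if "norm p \<le> N" for p
        using le[OF t' xR[OF t, unfolded R_def] that] by linarith
      show "(fst (a t), snd (a t)) \<in> conj_epi (H1 t ?x)" using a t by (simp add: admissible_def epi_conj_eq)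
    qed
    also have "\<dots> \<le> D t + (\<bar>snd (a t)\<bar> + bnd R t) / N"
      using H_bound_0[OF H2 t' R xR[OF t]] N by (intro add_left_mono divide_right_mono) auto
    finally show "?\<gamma> t \<le> D t + (\<bar>snd (a t)\<bar> + bnd R t) / N" by (simp add: epi_conj_eq)
  qed
  also have "\<dots> \<le> integral {0..T} D + (S + integral {0..T} (bnd R)) / N"
    using N S by (intro add_mono divide_right_mono integral_subinterval_le(1)[OF D sub]
        integral_subinterval_le(1)[OF absint_imp_int[OF bnd_int[OF R]] bnd_nonneg[OF R] sub]) auto
  finally have "gain R * integral {t0..T} ?\<gamma> \<le> gain R * (integral {0..T} D + (S + integral {0..T} (bnd R)) / N)"
    using gain_ge_1[OF R] t0 by (intro mult_left_mono) auto
  with b show ?thesis unfolding R_def by (intro exI[of _ b]) auto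
qed

text \<open>Only competitors whose cost is below the a priori bound \<open>M\<close> of both value functions matter, and for
  these the running cost is bounded in \<open>L\<^sup>1\<close>, as \<open>admissible_perturbation\<close> requires.\<close>

lemma value_fun_perturbation:
  fixes H1 H2 :: "'n::finite hamiltonian"
  assumes H1: "hamil H1" and H2: "hamil H2" and t0: "0 \<le> t0" "t0 \<le> T" and \<rho>: "norm x0 \<le> \<rho>" and N: "N \<ge> 1"
    and D: "D integrable_on {0..T}" "\<And>t. t \<in> {0..T} \<Longrightarrow> 0 \<le> D t"
    and le: "\<And>t x p. t \<in> {0..T} \<Longrightarrow> norm x \<le> rad \<rho> \<Longrightarrow> norm p \<le> N \<Longrightarrow> \<bar>H1 t x p - H2 t x p\<bar> \<le> D t"
    and g1: "\<And>x. norm x \<le> rad \<rho> \<Longrightarrow> \<bar>g1 x\<bar> \<le> G" and g2: "\<And>x. norm x \<le> rad \<rho> \<Longrightarrow> \<bar>g2 x\<bar> \<le> G"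
    and g12: "\<And>x y. norm x \<le> rad \<rho> \<Longrightarrow> norm y \<le> rad \<rho> \<Longrightarrow> norm (x - y) \<le> \<Delta> \<Longrightarrow> g2 y \<le> g1 x + e / 2"
    and \<Delta>: "\<Delta> \<le> e / 2"
    and B: "B = integral {0..T} (bnd (rad \<rho>))"
    and small: "gain (rad \<rho>) * (integral {0..T} D + (2 * G + gain (rad \<rho>) * B + 2 * B + B) / N) \<le> \<Delta>"
    and e: "e > 0"
  shows "value_fun T g2 H2 t0 x0 \<le> value_fun T g1 H1 t0 x0 + ereal e"
proof -
  have \<rho>0: "\<rho> \<ge> 0" using \<rho> norm_ge_zero by (rule order_trans[rotated])
  have TT: "T \<in> {t0..T}" "T \<in> {0..T}" using t0 by auto
  let ?V = "value_fun T g2 H2 t0 x0"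
  \<comment> \<open>Bound on the total cost of the competitor for \<open>H2\<close> provided by
    \<open>admissible_exists\<close>: terminal cost at most \<open>G\<close>, running cost at most
    its L^1 norm.\<close>
  define M where "M = G + gain (rad \<rho>) * B"
  have xR: "norm (traj t0 x0 a T) \<le> rad \<rho>" if "hamil H" "admissible H t0 x0 a" for H and a :: "real \<Rightarrow> (real^'n) \<times> real"
    by (rule weight_le_rad[OF \<rho>0 TT(2) admissible_bound[OF that(1) t0 \<rho> that(2) TT(1)]])
  have VM: "?V \<le> ereal M"
  proof -
    obtain b where b: "admissible H2 t0 x0 b" "integral {t0..T} (\<lambda>t. norm (b t)) \<le> gain (rad \<rho>) * B"
      using admissible_exists[OF H2 t0 \<rho>] B by blast
    have bi: "b absolutely_integrable_on {t0..T}" using b by (simp add: admissible_def)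
    have "integral {t0..T} (\<lambda>t. snd (b t)) \<le> integral {t0..T} (\<lambda>t. norm (b t))"
    proof (rule integral_le)
      show "(\<lambda>t. snd (b t)) integrable_on {t0..T}" by (intro absint_imp_int absint_fst_snd bi)
      show "(\<lambda>t. norm (b t)) integrable_on {t0..T}" by (intro absint_imp_int set_integrable_norm bi)
      show "snd (b t) \<le> norm (b t)" for t
        using norm_snd_le[of "snd (b t)" "fst (b t)"] by simp
    qed
    then have "g2 (traj t0 x0 b T) + integral {t0..T} (\<lambda>t. snd (b t)) \<le> M"
      using g2[OF xR[OF H2 b(1)]] b(2) unfolding M_def by linarith
    then show ?thesis using value_fun_le_admissible[OF H2 t0(1) b(1), of g2] by (meson ereal_less_eq(3) order_trans)
  qed
  have key: "?V \<le> ereal (g1 (traj t0 x0 a T) + integral {t0..T} (\<lambda>t. snd (a t)) + e)"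
    if a: "admissible H1 t0 x0 a" for a
  \<comment> \<open>A competitor with cost at least \<open>M\<close> is already beaten by the a
    priori bound; only the others need to be approximated.\<close>
  proof (cases "g1 (traj t0 x0 a T) + integral {t0..T} (\<lambda>t. snd (a t)) \<ge> M")
    case True
    then have "M \<le> g1 (traj t0 x0 a T) + integral {t0..T} (\<lambda>t. snd (a t)) + e" using e by simp
    then show ?thesis using VM by (meson ereal_less_eq(3) order_trans)
  next
    case False
    have ai: "a absolutely_integrable_on {t0..T}" using a by (simp add: admissible_def)
    \<comment> \<open>Total cost below \<open>M\<close> and terminal cost at least \<open>-G\<close>
      leave a running cost below \<open>2 * G + gain (rad \<rho>) * B\<close>; passing to absolute
      values adds \<open>2 * B\<close>.\<close>
    have "integral {t0..T} (\<lambda>t. \<bar>snd (a t)\<bar>) \<le> 2 * G + gain (rad \<rho>) * B + 2 * B"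
      using integral_abs_snd_admissible_le[OF H1 t0 \<rho> a] False g1[OF xR[OF H1 a]] unfolding M_def B by linarith
    then obtain b where b: "admissible H2 t0 x0 b" "integral {t0..T} (\<lambda>t. norm (b t - a t))
       \<le> gain (rad \<rho>) * (integral {0..T} D + (2 * G + gain (rad \<rho>) * B + 2 * B + B) / N)"
      using admissible_perturbation[OF H1 H2 t0 \<rho> a N D le] B by blast
    then have ba: "integral {t0..T} (\<lambda>t. norm (b t - a t)) \<le> \<Delta>" using small by linarith
    have bi: "b absolutely_integrable_on {t0..T}" using b by (simp add: admissible_def)
    have "norm (traj t0 x0 a T - traj t0 x0 b T) \<le> \<Delta>"
      using norm_traj_diff_le[OF bi ai TT(1), of x0] ba by (simp add: norm_minus_commute)
    then have 1: "g2 (traj t0 x0 b T) \<le> g1 (traj t0 x0 a T) + e / 2"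
      by (rule g12[OF xR[OF H1 a] xR[OF H2 b(1)]])
    have "integral {t0..T} (\<lambda>t. snd (b t)) - integral {t0..T} (\<lambda>t. snd (a t)) = integral {t0..T} (\<lambda>t. snd (b t) - snd (a t))"
      by (intro integral_diff[symmetric] absint_imp_int absint_fst_snd ai bi)
    also have "\<dots> \<le> integral {t0..T} (\<lambda>t. norm (b t - a t))"
    proof (rule integral_le)
      show "(\<lambda>t. snd (b t) - snd (a t)) integrable_on {t0..T}"
        by (intro integrable_diff absint_imp_int absint_fst_snd ai bi)
      show "(\<lambda>t. norm (b t - a t)) integrable_on {t0..T}"
        by (intro absint_imp_int set_integrable_norm set_integral_diff(1) ai bi)
      show "snd (b t) - snd (a t) \<le> norm (b t - a t)" for t
      proof -
        have "norm (snd (b t - a t)) \<le> norm (b t - a t)" by (metis norm_snd_le prod.collapse)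
        then show ?thesis by simp
      qed
    qed
    finally have "g2 (traj t0 x0 b T) + integral {t0..T} (\<lambda>t. snd (b t))
       \<le> g1 (traj t0 x0 a T) + integral {t0..T} (\<lambda>t. snd (a t)) + e"
      using 1 ba \<Delta> by linarith
    then show ?thesis using value_fun_le_admissible[OF H2 t0(1) b(1), of g2] by (meson ereal_less_eq(3) order_trans)
  qed
  \<comment> \<open>With the finite number \<open>e\<close> moved to the left, the right side is a
    bare infimum and can be tested on single trajectories.\<close>
  have "?V - ereal e \<le> value_fun T g1 H1 t0 x0"
    unfolding value_fun_def[of T g1]
  proof (rule INF_greatest)
    fix xa assume xa: "xa \<in> trajectories T (steiner_f H1) t0 x0"
    obtain x a where xa': "xa = (x, a)" by (cases xa)
    show "?V - ereal e \<le> ereal (g1 (fst xa T)) + cost_integral t0 T (\<lambda>t. steiner_l H1 t (fst xa t) (snd xa t))"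
    proof (cases "set_integrable lebesgue {t0..T} (\<lambda>t. steiner_l H1 t (x t) (a t))")
      case True
      obtain b where b: "admissible H1 t0 x0 b"
        "ereal (g1 (x T)) + cost_integral t0 T (\<lambda>t. steiner_l H1 t (x t) (a t))
            = ereal (g1 (traj t0 x0 b T) + integral {t0..T} (\<lambda>t. snd (b t)))"
        using trajectory_imp_admissible[OF H1 t0 xa[unfolded xa'] True, of g1] by blast
      have "?V \<le> ereal (g1 (traj t0 x0 b T) + integral {t0..T} (\<lambda>t. snd (b t))) + ereal e"
        using key[OF b(1)] by simp
      then show ?thesis using b(2) by (simp add: xa' ereal_minus_le_iff)
    next
      case False
      then show ?thesis by (simp add: xa' cost_integral_def)
    qed
  qed
  then show ?thesis by (simp add: ereal_minus_le_iff)
qed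

text \<open>\<open>D i t\<close> is the supremum of the discrepancy over a product of balls, taken
  over a countable dense subset to keep it measurable in \<open>t\<close>; continuity extends it to
  the whole product. It tends to zero for each \<open>t\<close> and is dominated by an integrable
  function because all Hamiltonians share \<open>c\<close>, \<open>k\<close> and
  \<open>\<mu>\<close>, so its integrals tend to zero.\<close>

lemma discrepancy_bound:
  fixes Hs :: "nat \<Rightarrow> 'n::finite hamiltonian" and H :: "'n hamiltonian"
  assumes Hs: "\<And>i. hamil (Hs i)" and H: "hamil H" and R: "R > 0" and N: "N \<ge> 1"
    and conv: "\<And>t C. t \<in> {0..T} \<Longrightarrow> compact C \<Longrightarrow>
       uniform_limit C (\<lambda>i (x, p). Hs i t x p) (\<lambda>(x, p). H t x p) sequentially"
  shows "\<exists>D. (\<forall>i. D i integrable_on {0..T}) \<and> (\<forall>i. \<forall>t\<in>{0..T}. 0 \<le> D i t) \<and>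
     (\<forall>i. \<forall>t\<in>{0..T}. \<forall>x p. norm x \<le> R \<longrightarrow> norm p \<le> N \<longrightarrow> \<bar>Hs i t x p - H t x p\<bar> \<le> D i t) \<and>
     (\<lambda>i. integral {0..T} (D i)) \<longlonglongrightarrow> 0"
proof -
  define A where "A = cball (0::real^'n) R \<times> cball (0::real^'n) N"
  have cA: "compact A" unfolding A_def by (intro compact_Times) auto
  obtain Q where Q: "countable Q" "Q \<subseteq> A" "A \<subseteq> closure Q" using separable by blast
  have "(0, 0) \<in> A" using R N by (simp add: A_def)
  then have Qne: "Q \<noteq> {}" using Q(3) by auto
  define f where "f i t z = \<bar>Hs i t (fst z) (snd z) - H t (fst z) (snd z)\<bar>" for i t and z :: "(real^'n) \<times> (real^'n)"
  define D where "D i t = (SUP z\<in>Q. f i t z)" for i t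
  define h where "h t = 2 * (N * bnd R t)" for t
  have Hb: "\<bar>H' t (fst z) (snd z)\<bar> \<le> N * bnd R t" if "hamil H'" "t \<in> {0..T}" "z \<in> A" for H' t z
  proof -
    have n: "norm (fst z) \<le> R" "norm (snd z) \<le> N" using that(3) by (auto simp: A_def)
    have "\<bar>H' t (fst z) (snd z)\<bar> \<le> (\<mu> t + k R t * R) * 1 + c t * (1 + R) * norm (snd z)"
      using H_bound[OF that(1,2) R n(1), of "snd z"] by simp
    also have "\<dots> \<le> (\<mu> t + k R t * R) * N + c t * (1 + R) * N"
      using n N R \<mu>_nonneg[OF that(2)] k_nonneg[OF R that(2)] c_nonneg[OF that(2)] by (intro add_mono mult_left_mono) auto
    finally show ?thesis by (simp add: bnd_def algebra_simps)
  qed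
  have fb: "f i t z \<le> h t" if "t \<in> {0..T}" "z \<in> A" for i t z
    using Hb[OF Hs that, of i] Hb[OF H that] unfolding f_def h_def by linarith
  have bdd: "bdd_above (f i t ` Q)" if "t \<in> {0..T}" for i t
    by (rule bdd_aboveI2[where M="h t"]) (use fb[OF that] Q(2) in auto)
  have Dle: "D i t \<le> z" if "\<And>q. q \<in> Q \<Longrightarrow> f i t q \<le> z" for i t z
    unfolding D_def using Qne that by (rule cSUP_least)
  have fQ: "f i t q \<le> D i t" if "t \<in> {0..T}" "q \<in> Q" for i t q
    unfolding D_def using bdd[OF that(1)] that(2) by (rule cSUP_upper[rotated])
  have D0: "0 \<le> D i t" if "t \<in> {0..T}" for i t
  proof -
    obtain q where "q \<in> Q" using Qne by auto
    moreover have "0 \<le> f i t q" by (simp add: f_def)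
    ultimately show ?thesis using fQ[OF that, of q i] by linarith
  qed
  have Dh: "D i t \<le> h t" if "t \<in> {0..T}" for i t by (rule Dle) (use fb[OF that] Q(2) in auto)
  have fA: "f i t z \<le> D i t" if t: "t \<in> {0..T}" and z: "z \<in> A" for i t z
  proof -
    have "continuous_on UNIV (f i t)"
      using H_cont[OF Hs t, of i] H_cont[OF H t] unfolding f_def[abs_def] case_prod_beta
      by (intro continuous_on_rabs continuous_on_diff)
    then have "closed {z. f i t z \<le> D i t}" by (intro closed_Collect_le continuous_on_const)
    moreover have "Q \<subseteq> {z. f i t z \<le> D i t}" using fQ[OF t] by auto
    ultimately have "closure Q \<subseteq> {z. f i t z \<le> D i t}" by (rule closure_minimal[rotated])
    then show ?thesis using Q(3) z by auto
  qed
  have hi: "h integrable_on {0..T}" unfolding h_def[abs_def] by (intro absint_imp_int set_integrable_mult_right bnd_int R)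
  have Di: "D i integrable_on {0..T}" for i
  proof (rule absint_imp_int, rule measurable_bounded_by_integrable_imp_absolutely_integrable[OF _ _ hi])
    show "D i \<in> borel_measurable (lebesgue_on {0..T})"
      unfolding D_def[abs_def]
    proof (rule borel_measurable_cSUP[OF Q(1)])
      show "(\<lambda>t. f i t q) \<in> borel_measurable (lebesgue_on {0..T})" for q
        unfolding f_def by (intro borel_measurable_abs borel_measurable_diff H_meas Hs H)
      show "bdd_above ((\<lambda>q. f i t q) ` Q)" if "t \<in> space (lebesgue_on {0..T})" for t
        using that by (intro bdd) auto
    qed
    show "norm (D i t) \<le> h t" if "t \<in> {0..T}" for t using D0[OF that, of i] Dh[OF that, of i] by simp
  qed auto
  have "(\<lambda>i. integral {0..T} (D i)) \<longlonglongrightarrow> integral {0..T} (\<lambda>_. 0)"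
  proof (rule dominated_convergence(2)[OF Di hi])
    show "norm (D i t) \<le> h t" if "t \<in> {0..T}" for i t using D0[OF that, of i] Dh[OF that, of i] by simp
    fix t assume t: "t \<in> {0..T}"
    show "(\<lambda>i. D i t) \<longlonglongrightarrow> 0"
    proof (rule tendstoI)
      fix e :: real assume e: "e > 0"
      then have "e / 2 > 0" by simp
      from uniform_limitD[OF conv[OF t cA] this]
      show "\<forall>\<^sub>F i in sequentially. dist (D i t) 0 < e"
      proof eventually_elim
        case (elim i)
        have "D i t \<le> e / 2"
        proof (rule Dle)
          fix q assume "q \<in> Q"
          then have "q \<in> A" using Q(2) by auto
          from elim[rule_format, OF this] show "f i t q \<le> e / 2"
            by (simp add: f_def dist_real_def case_prod_beta)
        qed
        then show ?case using D0[OF t, of i] e by (simp add: dist_real_def)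
      qed
    qed
  qed
  then have "(\<lambda>i. integral {0..T} (D i)) \<longlonglongrightarrow> 0" by simp
  then show ?thesis using Di D0 fA
    by (intro exI[of _ D]) (auto simp: f_def A_def)
qed

end

section \<open>Choice of constants and uniform convergence of the value functions on compact
  sets\<close>

theorem theorem4p11:
  fixes T :: real
    and Hs :: "nat \<Rightarrow> 'n::finite hamiltonian" and H :: "'n hamiltonian"
    and gs :: "nat \<Rightarrow> real^'n \<Rightarrow> real" and g :: "real^'n \<Rightarrow> real"
    and c :: "real \<Rightarrow> real" and k :: "real \<Rightarrow> real \<Rightarrow> real" and \<mu> :: "real \<Rightarrow> real"
  assumes c_int: "set_integrable lebesgue {0..T} c" and c_nonneg: "\<forall>t\<in>{0..T}. 0 \<le> c t"
    and k_int: "\<forall>R>0. set_integrable lebesgue {0..T} (k R)"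
    and k_nonneg: "\<forall>R>0. \<forall>t\<in>{0..T}. 0 \<le> k R t"
    and Hs_hyps: "\<forall>i. hamiltonian_hyps T c k (Hs i)"
    and H_hyps: "hamiltonian_hyps T c k H"
    and gs_cont: "\<forall>i. continuous_on UNIV (gs i)" and g_cont: "continuous_on UNIV g"
    and gs_conv: "\<forall>C. compact C \<longrightarrow> uniform_limit C gs g sequentially"
    and \<mu>_int: "set_integrable lebesgue {0..T} \<mu>"
    and \<mu>_bound: "\<forall>t\<in>{0..T}. \<forall>i. max \<bar>Hs i t 0 0\<bar> \<bar>H t 0 0\<bar> \<le> \<mu> t"
    and Hs_conv: "\<forall>t\<in>{0..T}. \<forall>C. compact C \<longrightarrow>
                    uniform_limit C (\<lambda>i (x, p). Hs i t x p) (\<lambda>(x, p). H t x p) sequentially"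
  shows "\<forall>K. compact K \<and> K \<subseteq> {0..T} \<times> UNIV \<longrightarrow>
           (\<forall>e>0. \<forall>\<^sub>F i in sequentially. \<forall>(t0, x0)\<in>K.
              value_fun T (gs i) (Hs i) t0 x0 \<le> value_fun T g H t0 x0 + ereal e \<and>
              value_fun T g H t0 x0 \<le> value_fun T (gs i) (Hs i) t0 x0 + ereal e)"
proof (intro allI impI)
  fix K :: "(real \<times> (real^'n)) set" and e :: real
  assume K: "compact K \<and> K \<subseteq> {0..T} \<times> UNIV" and e: "e > 0"
  interpret control_bounds T c k \<mu>
  proof
    show "0 \<le> \<mu> t" if "t \<in> {0..T}" for t
    proof -
      have "max \<bar>Hs 0 t 0 0\<bar> \<bar>H t 0 0\<bar> \<le> \<mu> t" using \<mu>_bound that by blast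
      then show ?thesis by linarith
    qed
  qed (use c_int c_nonneg k_int k_nonneg \<mu>_int in auto)
  have hH: "hamil H"
    unfolding hamil_def using H_hyps \<mu>_bound by (meson max.bounded_iff)
  have hHs: "hamil (Hs i)" for i
    unfolding hamil_def using Hs_hyps \<mu>_bound by (meson max.bounded_iff)
  obtain \<rho> where \<rho>: "\<rho> > 0" "\<And>z. z \<in> K \<Longrightarrow> norm (snd z) \<le> \<rho>"
  proof -
    have "bounded (snd ` K)"
      by (intro compact_imp_bounded compact_continuous_image continuous_intros) (use K in auto)
    then show ?thesis using that unfolding bounded_pos by blast
  qed
  define R where "R = rad \<rho>"
  have R: "R > 0" unfolding R_def using \<rho>(1) by (intro rad_pos) auto
  have cB: "compact (cball (0::real^'n) R)" by simp
  have "bounded (g ` cball 0 R)"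
    by (rule compact_imp_bounded[OF compact_continuous_image[OF continuous_on_subset[OF g_cont] cB]]) simp
  then obtain G0 where "\<forall>y\<in>g ` cball 0 R. norm y \<le> G0" unfolding bounded_iff by blast
  then have G0: "\<bar>g x\<bar> \<le> G0" if "x \<in> cball 0 R" for x using that by auto
  \<comment> \<open>The extra 1 makes \<open>G\<close> a bound for \<open>gs i\<close> as well, once
    \<open>gs i\<close> is within 1 of \<open>g\<close> on the ball.\<close>
  define G where "G = G0 + 1"
  have "uniformly_continuous_on (cball 0 R) g"
    by (rule compact_uniformly_continuous[OF continuous_on_subset[OF g_cont] cB]) simp
  moreover have "e / 4 > 0" using e by simp
  ultimately obtain \<eta> where \<eta>: "\<eta> > 0"
    and \<eta>': "\<forall>x\<in>cball (0::real^'n) R. \<forall>y\<in>cball 0 R. dist y x < \<eta> \<longrightarrow> dist (g y) (g x) < e / 4"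
    unfolding uniformly_continuous_on_def by blast
  \<comment> \<open>\<open>\<Delta>\<close> bounds the L^1 distance of the two controls. It must
    stay strictly below the modulus \<open>\<eta>\<close> for the terminal cost and may use half of
    \<open>e\<close> for the running cost.\<close>
  define \<Delta> where "\<Delta> = min (\<eta> / 2) (e / 2)"
  have \<Delta>: "\<Delta> > 0" "\<Delta> \<le> e / 2" "\<Delta> < \<eta>" using \<eta> e by (auto simp: \<Delta>_def)
  define B where "B = integral {0..T} (bnd R)"
  \<comment> \<open>\<open>Z\<close> depends neither on \<open>N\<close> nor on the index, so
    \<open>N\<close> can be chosen with \<open>Z / N \<le> \<Delta> / 2\<close>. The other half of
    \<open>\<Delta>\<close> is left for the integrated discrepancy, which depends on
    \<open>N\<close> and becomes small only as the index grows.\<close>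
  define Z where "Z = gain R * (2 * G + gain R * B + 2 * B + B)"
  define N where "N = max 1 (2 * Z / \<Delta>)"
  have N: "N \<ge> 1" by (simp add: N_def)
  have ZN: "Z / N \<le> \<Delta> / 2"
  proof -
    have "2 * Z / \<Delta> \<le> N" by (simp add: N_def)
    then have "2 * Z \<le> N * \<Delta>" using \<Delta>(1) by (simp add: pos_divide_le_eq)
    then show ?thesis using N by (simp add: pos_divide_le_eq field_simps)
  qed
  have "\<exists>D. (\<forall>i. D i integrable_on {0..T}) \<and> (\<forall>i. \<forall>t\<in>{0..T}. 0 \<le> D i t) \<and>
     (\<forall>i. \<forall>t\<in>{0..T}. \<forall>x p. norm x \<le> R \<longrightarrow> norm p \<le> N \<longrightarrow> \<bar>Hs i t x p - H t x p\<bar> \<le> D i t) \<and>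
     (\<lambda>i. integral {0..T} (D i)) \<longlonglongrightarrow> 0"
    by (rule discrepancy_bound[OF hHs hH R N]) (use Hs_conv in blast)
  then obtain D where DD: "\<forall>i. D i integrable_on {0..T}" "\<forall>i. \<forall>t\<in>{0..T}. 0 \<le> D i t"
     "\<forall>i. \<forall>t\<in>{0..T}. \<forall>x p. norm x \<le> R \<longrightarrow> norm p \<le> N \<longrightarrow> \<bar>Hs i t x p - H t x p\<bar> \<le> D i t"
     "(\<lambda>i. integral {0..T} (D i)) \<longlonglongrightarrow> 0" by blast
  have D: "D i integrable_on {0..T}" "t \<in> {0..T} \<Longrightarrow> 0 \<le> D i t"
     "t \<in> {0..T} \<Longrightarrow> norm x \<le> R \<Longrightarrow> norm p \<le> N \<Longrightarrow> \<bar>Hs i t x p - H t x p\<bar> \<le> D i t" for i t x p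
    using DD(1-3) by simp_all
  have "(\<lambda>i. gain R * integral {0..T} (D i)) \<longlonglongrightarrow> gain R * 0" by (intro tendsto_intros DD(4))
  then have ev1: "\<forall>\<^sub>F i in sequentially. gain R * integral {0..T} (D i) < \<Delta> / 2"
    using \<Delta>(1) by (intro order_tendstoD(2)) auto
  \<comment> \<open>The 1 serves the common bound \<open>G\<close>; \<open>e / 4\<close> joins the
    \<open>e / 4\<close> from uniform continuity of \<open>g\<close> to give the
    \<open>e / 2\<close> allowed for the terminal cost.\<close>
  have "min 1 (e / 4) > 0" using e by simp
  from uniform_limitD[OF gs_conv[rule_format, OF cB] this]
  have ev2: "\<forall>\<^sub>F i in sequentially. \<forall>x\<in>cball 0 R. dist (gs i x) (g x) < min 1 (e / 4)" .
  from ev1 ev2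
  show "\<forall>\<^sub>F i in sequentially. \<forall>(t0, x0)\<in>K.
          value_fun T (gs i) (Hs i) t0 x0 \<le> value_fun T g H t0 x0 + ereal e \<and>
          value_fun T g H t0 x0 \<le> value_fun T (gs i) (Hs i) t0 x0 + ereal e"
  proof eventually_elim
    case (elim i)
    have small: "gain R * (integral {0..T} (D i) + (2 * G + gain R * B + 2 * B + B) / N) \<le> \<Delta>"
    proof -
      have "gain R * (integral {0..T} (D i) + (2 * G + gain R * B + 2 * B + B) / N) = gain R * integral {0..T} (D i) + Z / N"
        unfolding Z_def by (simp only: distrib_left times_divide_eq_right)
      then show ?thesis using elim(1) ZN by linarith
    qed
    have gi: "\<bar>gs i x - g x\<bar> < 1" "\<bar>gs i x - g x\<bar> < e / 4" if "norm x \<le> R" for x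
      using elim(2) that by (auto simp: dist_real_def)
    have gG: "\<bar>g x\<bar> \<le> G" if "norm x \<le> R" for x using G0[of x] that by (simp add: G_def)
    have giG: "\<bar>gs i x\<bar> \<le> G" if "norm x \<le> R" for x
      using G0[of x] gi(1)[OF that] that unfolding G_def by (simp add: abs_le_iff) linarith
    have gu: "\<bar>g y - g x\<bar> < e / 4" if "norm x \<le> R" "norm y \<le> R" "norm (x - y) \<le> \<Delta>" for x y
      using \<eta>'[rule_format, of x y] that \<Delta>(3) by (simp add: dist_norm norm_minus_commute)
    show ?case
    proof (clarify, intro conjI)
      fix t0 x0 assume z: "(t0, x0) \<in> K"
      then have t0: "0 \<le> t0" "t0 \<le> T" and x0: "norm x0 \<le> \<rho>" using K \<rho>(2)[OF z] by auto
      show "value_fun T (gs i) (Hs i) t0 x0 \<le> value_fun T g H t0 x0 + ereal e"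
      proof (rule value_fun_perturbation[OF hH hHs t0 x0 N D(1) D(2), folded R_def])
        show "\<bar>H t x p - Hs i t x p\<bar> \<le> D i t" if "t \<in> {0..T}" "norm x \<le> R" "norm p \<le> N" for t x p
          using D(3)[OF that] by (simp add: abs_minus_commute)
        show "gs i y \<le> g x + e / 2" if "norm x \<le> R" "norm y \<le> R" "norm (x - y) \<le> \<Delta>" for x y
          using gu[OF that] gi(2)[OF that(2)] by linarith
      qed (use gG giG \<Delta>(2) B_def small e in auto)
      show "value_fun T g H t0 x0 \<le> value_fun T (gs i) (Hs i) t0 x0 + ereal e"
      proof (rule value_fun_perturbation[OF hHs hH t0 x0 N D(1) D(2), folded R_def])
        show "\<bar>Hs i t x p - H t x p\<bar> \<le> D i t" if "t \<in> {0..T}" "norm x \<le> R" "norm p \<le> N" for t x p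
          using D(3)[OF that] .
        show "g y \<le> gs i x + e / 2" if "norm x \<le> R" "norm y \<le> R" "norm (x - y) \<le> \<Delta>" for x y
          using gu[OF that] gi(2)[OF that(1)] by linarith
      qed (use gG giG \<Delta>(2) B_def small e in auto)
    qed
  qed
qed

end
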